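(* Let $d\in\mathbb{N}$ and $1\le p<\infty$. Then there exists a constant $c>0$, independent of $f$, such that $$\big\|d^2_{j,k}(f)\,|\,s^{1/p}_{p,\infty}b\big\| = \sup_{j\in\mathbb{N}_{-1}^d}\Big(\sum_{k\in\mathbb{Z}^d}|d^2_{j,k}(f)|^p\Big)^{1/p}\le c\,\|f|S^{1/p}_{p,1}B(\mathbb{R}^d)\|$$ for all $f\in S^{1/p}_{p,1}B(\mathbb{R}^d)$.
   Context: Notation: $\mathbb{N}=\{1,2,\dots\}$, $\mathbb{N}_0=\mathbb{N}\cup\{0\}$, $\mathbb{N}_{-1}=\mathbb{N}_0\cup\{-1\}$, $a_+=\max\{a,0\}$, $|x|_1=\sum_i|x_i|$. Function spaces. Let $\mathcal{F}$ be the Fourier transform on $\mathbb{R}^d$, $\mathcal{F}f(\xi)=(2\pi)^{-d/2}\int_{\mathbb{R}^d}f(x)e^{-i\xi\cdot x}dx$. Fix a system $\varphi=\{\varphi_n\}_{n=0}^\infty\subset C_0^\infty(\mathbb{R})$ with (i) $\operatorname{supp}\varphi_0\subset\{|x|\le 2\}$; (ii) $\operatorname{supp}\varphi_n\subset\{2^{n-1}\le|x|\le 2^{n+1}\}$ for $n\ge1$; (iii) for every $\ell\in\mathbb{N}_0$, $\sup_{x,n}2^{n\ell}|D^\ell\varphi_n(x)|<\infty$; (iv) $\sum_{n=0}^\infty\varphi_n(x)=1$ for all $x\in\mathbb{R}$. For $f\in L_1(\mathbb{R}^d)$ and $\ell\in\mathbb{N}_0^d$ put $f_\ell=\mathcal{F}^{-1}[\varphi_{\ell_1}(\xi_1)\cdots\varphi_{\ell_d}(\xi_d)\mathcal{F}f(\xi)]$.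 For $0<p,q\le\infty$ and $r>(1/p-1)_+$, $S^r_{p,q}B(\mathbb{R}^d)$ is the set of all $f\in L_1(\mathbb{R}^d)$ with $\|f|S^r_{p,q}B(\mathbb{R}^d)\|=\big(\sum_{j\in\mathbb{N}_0^d}2^{|j|_1rq}\|f_j\|_p^q\big)^{1/q}<\infty$ (usual modification for $q=\infty$); different systems $\varphi$ give equivalent (quasi-)norms. Elements of $S^{1/p}_{p,1}B(\mathbb{R}^d)$ are identified with their continuous representatives (one has $S^{1/p}_{p,1}B(\mathbb{R}^d)\hookrightarrow C(\mathbb{R}^d)$). Faber-Schauder coefficients. For a continuous $f$ on $\mathbb{R}^d$, $j\in\mathbb{N}_{-1}^d$ and $k\in\mathbb{Z}^d$, let $e(j)=\{i:j_i\ne-1\}$, $x_{j,k}=(2^{-(j_1)_+}k_1,\dots,2^{-(j_d)_+}k_d)$ and $$d^2_{j,k}(f)=(-2)^{-|e(j)|}\Big(\prod_{i\in e(j)}\Delta^{2,i}_{2^{-(j_i+1)}}\Big)f(x_{j,k}),$$ where $|e(j)|$ is the cardinality of $e(j)$ and $\Delta^{2,i}_hf(x)=f(x+2he_i)-2f(x+he_i)+f(x)$ is the second difference in direction of the $i$-th unit vector $e_i$ (no difference is taken in directions $i\notin e(j)$). Sequence space norm. For $r\ge 1/p$ and $\lambda=\{\lambda_{j,k}\}_{j\in\mathbb{N}_{-1}^d,k\in\mathbb{Z}^d}$, $\|\lambda|s^r_{p,q}b\|=\big[\sum_{j}2^{|j|_1(r-1/p)q}(\sum_{k}|\lambda_{j,k}|^p)^{q/p}\big]^{1/q}$,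 with a supremum over $j$ when $q=\infty$. *)

theory Defs
  imports "HOL-Analysis.Analysis"
begin

section \<open>Smooth decompositions of unity on the real line\<close>

definition nth_derivative :: "nat \<Rightarrow> (real \<Rightarrow> complex) \<Rightarrow> real \<Rightarrow> complex" where
  "nth_derivative l g = ((\<lambda>h x. vector_derivative h (at x)) ^^ l) g"

definition test_function :: "(real \<Rightarrow> complex) \<Rightarrow> bool" where
  "test_function g \<longleftrightarrow>
     (\<forall>l x. nth_derivative l g differentiable (at x)) \<and> compact (closure {x. g x \<noteq> 0})"

definition decomposition_system :: "(nat \<Rightarrow> real \<Rightarrow> complex) \<Rightarrow> bool" where
  "decomposition_system \<phi> \<longleftrightarrow>
     (\<forall>n. test_function (\<phi> n)) \<and>
     closure {x. \<phi> 0 x \<noteq> 0} \<subseteq> {x. \<bar>x\<bar> \<le> 2} \<and>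
     (\<forall>n\<ge>1. closure {x. \<phi> n x \<noteq> 0} \<subseteq> {x. 2 ^ (n - 1) \<le> \<bar>x\<bar> \<and> \<bar>x\<bar> \<le> 2 ^ (n + 1)}) \<and>
     (\<forall>l. bdd_above (range (\<lambda>(n, x). 2 ^ (n * l) * norm (nth_derivative l (\<phi> n) x)))) \<and>
     (\<forall>x. (\<lambda>n. \<phi> n x) sums 1)"


section \<open>Fourier transform and dyadic blocks\<close>

definition fourier :: "(real ^ 'd \<Rightarrow> complex) \<Rightarrow> real ^ 'd \<Rightarrow> complex" where
  "fourier f \<xi> = complex_of_real ((2 * pi) powr (- real CARD('d) / 2)) *
     (LINT x|lebesgue. f x * exp (- \<i> * complex_of_real (\<xi> \<bullet> x)))"

text \<open>The inverse transform is only applied to bounded, compactly supported symbols, where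
  the integral converges absolutely.\<close>

definition inverse_fourier :: "(real ^ 'd \<Rightarrow> complex) \<Rightarrow> real ^ 'd \<Rightarrow> complex" where
  "inverse_fourier g x = complex_of_real ((2 * pi) powr (- real CARD('d) / 2)) *
     (LINT \<xi>|lebesgue. g \<xi> * exp (\<i> * complex_of_real (\<xi> \<bullet> x)))"

definition dyadic_block ::
    "(nat \<Rightarrow> real \<Rightarrow> complex) \<Rightarrow> (real ^ 'd \<Rightarrow> complex) \<Rightarrow> nat ^ 'd \<Rightarrow> real ^ 'd \<Rightarrow> complex" where
  "dyadic_block \<phi> f l = inverse_fourier (\<lambda>\<xi>. (\<Prod>i\<in>UNIV. \<phi> (l $ i) (\<xi> $ i)) * fourier f \<xi>)"


section \<open>Besov spaces of dominating mixed smoothness\<close>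

text \<open>Real powers of extended nonnegative reals, meant for exponents \<open>a > 0\<close>.\<close>

definition epowr :: "ennreal \<Rightarrow> real \<Rightarrow> ennreal"  (infixr "epowr" 80) where
  "x epowr a = (if x = \<infinity> then \<infinity> else ennreal (enn2real x powr a))"

definition Lp_norm :: "real \<Rightarrow> (real ^ 'd \<Rightarrow> complex) \<Rightarrow> ennreal" where
  "Lp_norm p f = (\<integral>\<^sup>+ x. ennreal (norm (f x) powr p) \<partial>lebesgue) epowr (1 / p)"

text \<open>Extended-valued norm, for finite integrability \<open>p > 0\<close>; the fine index \<open>q\<close> may be \<open>\<infinity>\<close>.
  Sums of extended nonnegative reals over arbitrary index sets always exist.\<close>

definition besov_norm ::
    "(nat \<Rightarrow> real \<Rightarrow> complex) \<Rightarrow> real \<Rightarrow> real \<Rightarrow> ennreal \<Rightarrow> (real ^ 'd \<Rightarrow> complex) \<Rightarrow> ennreal" where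
  "besov_norm \<phi> r p q f =
    (if q = \<infinity>
     then (SUP j::nat ^ 'd. ennreal (2 powr (real (\<Sum>i\<in>UNIV. j $ i) * r))
                               * Lp_norm p (dyadic_block \<phi> f j))
     else (\<Sum>\<^sub>\<infinity>j::nat ^ 'd. ennreal (2 powr (real (\<Sum>i\<in>UNIV. j $ i) * r * enn2real q))
                               * Lp_norm p (dyadic_block \<phi> f j) epowr enn2real q)
            epowr (1 / enn2real q))"

text \<open>The elements are functions rather than classes modulo null sets. The definition is meant for
  \<open>r > max (1 / p - 1) 0\<close>.\<close>

definition besov_space ::
    "(nat \<Rightarrow> real \<Rightarrow> complex) \<Rightarrow> real \<Rightarrow> real \<Rightarrow> ennreal \<Rightarrow> (real ^ 'd \<Rightarrow> complex) set" where
  "besov_space \<phi> r p q = {f. integrable lebesgue f \<and> besov_norm \<phi> r p q f < \<infinity>}"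

text \<open>The continuous function in the class of \<open>f\<close> modulo null sets. It is unique if it exists, and
  it exists for all \<open>f\<close> in \<open>besov_space \<phi> (1 / p) p 1\<close>.\<close>

definition continuous_rep :: "(real ^ 'd \<Rightarrow> complex) \<Rightarrow> real ^ 'd \<Rightarrow> complex" where
  "continuous_rep f = (THE g. continuous_on UNIV g \<and> (AE x in lebesgue. g x = f x))"


section \<open>Faber-Schauder coefficients\<close>

text \<open>The index set of level vectors: integer vectors with all entries at least \<open>-1\<close>.\<close>

definition levels :: "(int ^ 'd) set" where
  "levels = {j. \<forall>i. j $ i \<ge> -1}"

definition active :: "int ^ 'd \<Rightarrow> 'd set" where
  "active j = {i. j $ i \<noteq> -1}"

definition dyadic_point :: "int ^ 'd \<Rightarrow> int ^ 'd \<Rightarrow> real ^ 'd" where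
  "dyadic_point j k = (\<chi> i. 2 powi (- max (j $ i) 0) * of_int (k $ i))"

definition second_diff ::
    "'d::finite \<Rightarrow> real \<Rightarrow> (real ^ 'd \<Rightarrow> complex) \<Rightarrow> real ^ 'd \<Rightarrow> complex" where
  "second_diff i h f x = f (x + (2 * h) *\<^sub>R axis i 1) - 2 * f (x + h *\<^sub>R axis i 1) + f x"

text \<open>Second differences in different directions commute, so their product over a finite set of
  directions is well defined as a fold.\<close>

lemma comp_fun_commute_second_diff:
  "comp_fun_commute (\<lambda>i. second_diff i (h i))"
proof
  fix i j
  show "second_diff j (h j) \<circ> second_diff i (h i) = second_diff i (h i) \<circ> second_diff j (h j)"
    by (rule ext)+ (simp add: second_diff_def algebra_simps)
qed

definition fs_coeff ::
    "(real ^ 'd \<Rightarrow> complex) \<Rightarrow> int ^ 'd \<Rightarrow> int ^ 'd \<Rightarrow> complex" where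
  "fs_coeff f j k =
     (-2) powi (- int (card (active j))) *
     Finite_Set.fold (\<lambda>i. second_diff i (2 powi (- (j $ i + 1)))) f (active j) (dyadic_point j k)"


section \<open>Sequence space norm\<close>

definition seq_norm ::
    "real \<Rightarrow> real \<Rightarrow> ennreal \<Rightarrow> (int ^ 'd \<Rightarrow> int ^ 'd \<Rightarrow> complex) \<Rightarrow> ennreal" where
  "seq_norm r p q a =
    (if q = \<infinity>
     then (SUP j\<in>levels. ennreal (2 powr (real_of_int (\<Sum>i\<in>UNIV. \<bar>j $ i\<bar>) * (r - 1 / p)))
                          * (\<Sum>\<^sub>\<infinity>k. ennreal (norm (a j k) powr p)) epowr (1 / p))
     else (\<Sum>\<^sub>\<infinity>j\<in>levels.
             ennreal (2 powr (real_of_int (\<Sum>i\<in>UNIV. \<bar>j $ i\<bar>) * (r - 1 / p) * enn2real q))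
               * (\<Sum>\<^sub>\<infinity>k. ennreal (norm (a j k) powr p)) epowr (enn2real q / p))
            epowr (1 / enn2real q))"

end

theory Submission
  imports Defs "HOL-Probability.Characteristic_Functions" "HOL-Probability.Sinc_Integral"
begin

text \<open>
  Since the supremum over the levels is taken with the weight exponent \<open>r - 1/p = 0\<close>, it suffices to bound
  the coefficients of one dyadic block \<open>f\<^sub>l\<close> by \<open>c 2\<^bsup>|l|/p\<^esup> \<parallel>f\<^sub>l\<parallel>\<^sub>p\<close>, uniformly in the level \<open>j\<close>, and to sum
  over \<open>l\<close> by Minkowski's inequality.

  Put \<open>b = \<phi> 0 + \<phi> 1 + \<phi> 2\<close>, which equals 1 on \<open>(-4, 4)\<close>, and let \<open>\<psi>\<close> be its inverse Fourier transform.
  The block \<open>f\<^sub>l\<close> is its own convolution with the tensor product of the dilates \<open>2\<^sup>n \<psi> (2\<^sup>n t)\<close>, \<open>n = l\<^sub>i\<close>, so its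
  coefficients of level \<open>j\<close> are samples of a convolution of \<open>f\<^sub>l\<close> with differences of these dilates. By Jensen's
  inequality one needs only that these one-dimensional kernels have bounded \<open>L\<^sub>1\<close> norms, and that the sums of
  their absolute values over the grid of level \<open>j\<close> are at most \<open>c 2\<^sup>n\<close>. If the grid is coarser than \<open>2\<^sup>-\<^sup>n\<close>, the
  decay of \<open>\<psi>\<close> gives this; if it is finer, the difference gains a factor \<open>2\<^bsup>n-j\<^esup>\<close>, which compensates for the
  number of grid points.

  The same kernel estimate bounds \<open>f\<^sub>l\<close> uniformly, so the sum of the blocks is a continuous function. It agrees
  with \<open>f\<close> almost everywhere because both have the same Gaussian means.
\<close>

section \<open>Gaussian summability and Fourier inversion\<close>

text \<open>The functions \<open>\<phi> n\<close> need not be dilates of one another, so a block is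
  reproduced by dilates of the single bump \<open>b\<close>; its kernel estimates then hold at all
  scales with one constant. They rest on decay of order 1 / (1 + t^2), which makes a kernel
  integrable and summable over every grid, and which two derivatives of \<open>b\<close> yield. On a
  grid finer than the scale of the block, the number of grid points is balanced exactly by the gain
  of a first difference, so the second difference enters only as a difference of two first
  differences. Jensen's inequality contributes \<open>A ^ CARD('d)\<close> to the power p - 1, and
  the sum over the grid contributes it once more, times 2^|l|; the p-th root gives a constant that
  is free of \<open>p\<close>. That the blocks add up to \<open>f\<close> needs care, because
  \<open>f\<close> is merely integrable: its Fourier transform need not be integrable, and its
  Gaussian means need not converge at a given point. Hence a Gaussian factor is inserted on the
  Fourier side, where all integrals then converge absolutely, and the means of \<open>f\<close> are
  tested against indicators of boxes instead of being evaluated at points.\<close>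

lemma
  fixes f :: "'d::finite \<Rightarrow> real \<Rightarrow> complex"
  assumes f: "\<And>i. integrable lborel (f i)"
  shows integrable_prod_vec: "integrable lborel (\<lambda>x::real^'d. \<Prod>i\<in>UNIV. f i (x $ i))"
    and integral_prod_vec:
      "(LINT x|lborel. (\<Prod>i\<in>UNIV. f i ((x::real^'d) $ i))) = (\<Prod>i\<in>UNIV. (LINT t|lborel. f i t))"
proof -
  interpret product_sigma_finite "\<lambda>_::real^'d. lborel :: real measure"
    by standard
  \<comment> \<open>The factors of the product measure are indexed by basis vectors;
    \<open>ix\<close> leads back from \<open>axis i 1\<close> to \<open>i\<close>.\<close>
  define ix :: "real^'d \<Rightarrow> 'd" where "ix = inv (\<lambda>i. axis i 1)"
  have inj: "inj (\<lambda>i::'d. axis i (1::real))"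
    by (auto simp: inj_def axis_eq_axis)
  have ix: "ix (axis i 1) = i" for i
    unfolding ix_def by (simp add: inv_f_f[OF inj])
  have B: "(Basis :: (real^'d) set) = range (\<lambda>i. axis i 1)"
    by (auto simp: Basis_vec_def)
  have reindex: "(\<Prod>b\<in>(Basis :: (real^'d) set). h b) = (\<Prod>i\<in>UNIV. h (axis i 1))" for h :: "real^'d \<Rightarrow> complex"
    unfolding B by (subst prod.reindex[OF inj]) simp
  have coord: "(\<Sum>b\<in>Basis. g b *\<^sub>R b) $ i = g (axis i 1)" for g and i :: 'd
  proof -
    have "(\<Sum>b\<in>Basis. g b *\<^sub>R b) $ i = (\<Sum>b\<in>Basis. g b *\<^sub>R b) \<bullet> axis i 1"
      by (simp add: inner_axis)
    also have "\<dots> = g (axis i 1)"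
      by (rule inner_sum_left_Basis) (simp add: B)
    finally show ?thesis .
  qed
  have m[measurable]: "f i \<in> borel_measurable borel" for i
    using borel_measurable_integrable[OF f] by simp
  have eq: "(\<Prod>i\<in>UNIV. f i ((\<Sum>b\<in>Basis. g b *\<^sub>R b) $ i)) = (\<Prod>b\<in>Basis. f (ix b) (g b))" for g
    by (simp only: reindex ix coord)
  have meas: "(\<lambda>x::real^'d. \<Prod>i\<in>UNIV. f i (x $ i)) \<in> borel_measurable borel"
    by measurable
  have meas2: "(\<lambda>f. \<Sum>b\<in>(Basis::(real^'d) set). f b *\<^sub>R b) \<in> (\<Pi>\<^sub>M b\<in>Basis. lborel) \<rightarrow>\<^sub>M borel"
    by measurable
  show "integrable lborel (\<lambda>x::real^'d. \<Prod>i\<in>UNIV. f i (x $ i))"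
    apply (subst lborel_eq)
    apply (subst integrable_distr_eq[OF meas2 meas])
    apply (simp only: eq)
    apply (rule product_integrable_prod)
    using f by auto
  show "(LINT x|lborel. (\<Prod>i\<in>UNIV. f i ((x::real^'d) $ i))) = (\<Prod>i\<in>UNIV. (LINT t|lborel. f i t))"
    apply (subst lborel_eq)
    apply (subst integral_distr[OF meas2 meas])
    apply (simp only: eq)
    apply (subst product_integral_prod)
    using f by (auto simp: reindex ix)
qed

lemma
  fixes f :: "'a::euclidean_space \<Rightarrow> 'b::{banach, second_countable_topology}"
  assumes "c \<noteq> 0"
  shows integrable_lborel_affine: "integrable lborel f \<Longrightarrow> integrable lborel (\<lambda>x. f (t + c *\<^sub>R x))"
    and integral_lborel_affine: "f \<in> borel_measurable borel \<Longrightarrow>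
      (LINT x|lborel. f (t + c *\<^sub>R x)) = (LINT x|lborel. f x) /\<^sub>R \<bar>c\<bar> ^ DIM('a)"
proof -
  have T[measurable]: "(\<lambda>x::'a. t + c *\<^sub>R x) \<in> lborel \<rightarrow>\<^sub>M borel" by measurable
  show "integrable lborel (\<lambda>x. f (t + c *\<^sub>R x))" if "integrable lborel f"
  proof -
    have [measurable]: "f \<in> borel_measurable borel"
      using borel_measurable_integrable[OF that] by simp
    have "integrable (density (distr lborel borel (\<lambda>x. t + c *\<^sub>R x)) (\<lambda>_. \<bar>c\<bar>^DIM('a))) f"
      using that lborel_affine[OF assms, of t] by simp
    then have "integrable (distr lborel borel (\<lambda>x. t + c *\<^sub>R x)) (\<lambda>x. \<bar>c\<bar>^DIM('a) *\<^sub>R f x)"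
      by (subst (asm) integrable_density) auto
    then have "integrable lborel (\<lambda>x. \<bar>c\<bar>^DIM('a) *\<^sub>R f (t + c *\<^sub>R x))"
      by (subst (asm) integrable_distr_eq) auto
    from integrable_scaleR_right[OF this, of "inverse (\<bar>c\<bar>^DIM('a))"] show ?thesis
      using assms by simp
  qed
  show "(LINT x|lborel. f (t + c *\<^sub>R x)) = (LINT x|lborel. f x) /\<^sub>R \<bar>c\<bar> ^ DIM('a)"
    if [measurable]: "f \<in> borel_measurable borel"
  proof -
    have "(LINT x|lborel. f x) = (LINT x|density (distr lborel borel (\<lambda>x. t + c *\<^sub>R x)) (\<lambda>_. \<bar>c\<bar>^DIM('a)). f x)"
      using lborel_affine[OF assms, of t] by simp
    also have "\<dots> = \<bar>c\<bar>^DIM('a) *\<^sub>R (LINT x|lborel. f (t + c *\<^sub>R x))"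
      by (subst integral_density, simp, simp, simp) (subst integral_distr, auto)
    finally show ?thesis using assms by simp
  qed
qed

text \<open>Left without a normalising constant: bounded by 1, it serves as convergence factor on
  the Fourier side, and the same function is the averaging kernel in space. The price is a factor
  \<open>sqrt (2 * pi) ^ CARD('d)\<close> whenever it is integrated.\<close>

definition gauss :: "real ^ 'd \<Rightarrow> real" where
  "gauss x = exp (- (x \<bullet> x) / 2)"

lemma gauss_pos: "gauss x > 0" by (simp add: gauss_def)

lemma gauss_prod: "gauss x = (\<Prod>i\<in>UNIV. exp (- (x $ i)\<^sup>2 / 2))"
  by (simp add: gauss_def inner_vec_def exp_sum[symmetric] sum_divide_distrib sum_negf power2_eq_square)

lemma borel_measurable_gauss[measurable]: "gauss \<in> borel_measurable borel"
  unfolding gauss_def by measurable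

lemma borel_measurable_iexp[measurable (raw)]:
  "f \<in> borel_measurable M \<Longrightarrow> (\<lambda>x. iexp (f x)) \<in> borel_measurable M"
  by (rule borel_measurable_continuous_on[where f=iexp]) (auto intro!: continuous_intros)

lemma
  shows integrable_iexp_gauss_1: "integrable lborel (\<lambda>t::real. iexp (a * t) * complex_of_real (exp (- t\<^sup>2 / 2)))"
    and integral_iexp_gauss_1: "(LINT t|lborel. iexp (a * t) * complex_of_real (exp (- t\<^sup>2 / 2))) = complex_of_real (sqrt (2 * pi) * exp (- a\<^sup>2 / 2))"
proof -
  have eq: "exp (- t\<^sup>2 / 2) = sqrt (2 * pi) * std_normal_density t" for t :: real
    by (simp add: std_normal_density_def)
  have 1: "integrable lborel (\<lambda>t::real. exp (- t\<^sup>2 / 2))"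
    unfolding eq using integrable_std_normal_moment[of 0] by (auto intro!: integrable_mult_right)
  have "integrable lborel (\<lambda>t::real. complex_of_real (exp (- t\<^sup>2 / 2)))"
    using 1 by (rule integrable_of_real)
  then show "integrable lborel (\<lambda>t::real. iexp (a * t) * complex_of_real (exp (- t\<^sup>2 / 2)))"
    by (rule Bochner_Integration.integrable_bound) (auto simp: norm_mult)
  have "complex_of_real (exp (- a\<^sup>2 / 2)) = char std_normal_distribution a"
    by (simp add: char_std_normal_distribution)
  also have "\<dots> = (LINT t|lborel. std_normal_density t *\<^sub>R iexp (a * t))"
    unfolding char_def by (subst integral_density) (auto intro: normal_density_nonneg)
  finally have "complex_of_real (exp (- a\<^sup>2 / 2)) = (LINT t|lborel. std_normal_density t *\<^sub>R iexp (a * t))" .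
  moreover have "iexp (a * t) * complex_of_real (exp (- t\<^sup>2 / 2)) = sqrt (2 * pi) * (std_normal_density t *\<^sub>R iexp (a * t))" for t
    unfolding eq by (simp add: scaleR_conv_of_real)
  moreover have "(LINT t|lborel. sqrt (2 * pi) * (std_normal_density t *\<^sub>R iexp (a * t))) =
      sqrt (2 * pi) * (LINT t|lborel. std_normal_density t *\<^sub>R iexp (a * t))"
    by (rule integral_mult_right_zero)
  ultimately show "(LINT t|lborel. iexp (a * t) * complex_of_real (exp (- t\<^sup>2 / 2))) = complex_of_real (sqrt (2 * pi) * exp (- a\<^sup>2 / 2))"
    by (metis (no_types, lifting) Bochner_Integration.integral_cong of_real_mult)
qed

lemma
  fixes a :: "real ^ 'd"
  shows integrable_iexp_gauss: "integrable lborel (\<lambda>x. iexp (a \<bullet> x) * gauss x)"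
    and integral_iexp_gauss: "(LINT x|lborel. iexp (a \<bullet> x) * gauss x) = sqrt (2 * pi) ^ CARD('d) * gauss a"
proof -
  have eq: "iexp (a \<bullet> x) * gauss x = (\<Prod>i\<in>UNIV. iexp (a $ i * x $ i) * complex_of_real (exp (- (x $ i)\<^sup>2 / 2)))" for x
    by (simp add: gauss_prod prod.distrib inner_vec_def sum_distrib_left exp_sum)
  show "integrable lborel (\<lambda>x. iexp (a \<bullet> x) * gauss x)"
    unfolding eq by (rule integrable_prod_vec) (rule integrable_iexp_gauss_1)
  show "(LINT x|lborel. iexp (a \<bullet> x) * gauss x) = sqrt (2 * pi) ^ CARD('d) * gauss a"
    unfolding eq integral_prod_vec[OF integrable_iexp_gauss_1] integral_iexp_gauss_1
    by (simp add: gauss_prod prod.distrib)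
qed

lemma integrable_gauss: "integrable lborel (gauss :: real ^ 'd \<Rightarrow> real)"
proof -
  have "integrable lborel (\<lambda>x::real^'d. Re (iexp (0 \<bullet> x) * gauss x))"
    by (rule integrable_Re[OF integrable_iexp_gauss])
  then show ?thesis by simp
qed

lemma integral_gauss: "(LINT x|lborel. complex_of_real (gauss (x :: real ^ 'd))) = sqrt (2 * pi) ^ CARD('d)"
  using integral_iexp_gauss[of "0 :: real ^ 'd"] by (simp add: gauss_def)

text \<open>The kernels \<open>k\<close> to be used are exponentials of modulus 1 and Gaussians, so
  \<open>u x * v y\<close> is an integrable majorant and Fubini's theorem applies.\<close>

lemma integral_swap:
  fixes u :: "'a::euclidean_space \<Rightarrow> complex" and v :: "'b::euclidean_space \<Rightarrow> complex"
  assumes u: "integrable lborel u" and v: "integrable lborel v"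
    and k[measurable]: "case_prod k \<in> borel_measurable (borel \<Otimes>\<^sub>M borel)"
    and b: "\<And>x y. norm (k x y) \<le> 1"
  shows "(LINT y|lborel. (LINT x|lborel. u x * k x y) * v y) = (LINT x|lborel. u x * (LINT y|lborel. k x y * v y))"
proof -
  have [measurable]: "u \<in> borel_measurable borel" "v \<in> borel_measurable borel"
    using borel_measurable_integrable[OF u] borel_measurable_integrable[OF v] by simp_all
  have 1: "integrable (lborel \<Otimes>\<^sub>M lborel) (\<lambda>(x, y). u x * v y)"
  proof (rule lborel_pair.Fubini_integrable)
    show "integrable lborel (\<lambda>x. LINT y|lborel. norm (case (x, y) of (x, y) \<Rightarrow> u x * v y))"
      using u by (simp add: norm_mult)
    show "AE x in lborel. integrable lborel (\<lambda>y. case (x, y) of (x, y) \<Rightarrow> u x * v y)"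
      using v by simp
  qed measurable
  have "integrable (lborel \<Otimes>\<^sub>M lborel) (\<lambda>(x, y). u x * k x y * v y)"
    apply (rule Bochner_Integration.integrable_bound[OF 1])
    subgoal by measurable
    subgoal
      apply (rule AE_I2)
      apply (clarsimp simp: norm_mult)
      apply (rule mult_right_mono)
      apply (metis b mult.right_neutral mult_left_mono norm_ge_zero)
      apply simp
      done
    done
  from lborel_pair.Fubini_integral[OF this]
  have "(LINT y|lborel. LINT x|lborel. u x * k x y * v y) = (LINT x|lborel. LINT y|lborel. u x * (k x y * v y))"
    by (simp only: mult.assoc)
  then show ?thesis
    by (simp only: integral_mult_left_zero integral_mult_right_zero)
qed

lemma integrable_iexp_mult:
  assumes "integrable M u" "g \<in> borel_measurable M"
  shows "integrable M (\<lambda>x. u x * iexp (g x))"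
  by (rule Bochner_Integration.integrable_bound[OF assms(1)])
    (use assms in \<open>auto simp: norm_mult intro!: borel_measurable_times borel_measurable_iexp\<close>)

text \<open>The order of integration is exchanged, and the transform of a modulated Gaussian is
  again a Gaussian, now of width \<open>e\<close> about \<open>x\<close>. Only integrability is
  asked of \<open>u\<close>, which matters since the inversion integral of \<open>u\<close> may
  diverge.\<close>

lemma fourier_gauss_summation:
  fixes u :: "real ^ 'd \<Rightarrow> complex"
  assumes u: "integrable lborel u" and e: "e > 0"
  shows "(LINT \<xi>|lborel. (LINT y|lborel. u y * iexp (- (\<xi> \<bullet> y))) * (iexp (\<xi> \<bullet> x) * gauss (e *\<^sub>R \<xi>)))
    = sqrt (2 * pi) ^ CARD('d) * (LINT z|lborel. u (x + e *\<^sub>R z) * gauss z)"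
proof -
  have um[measurable]: "u \<in> borel_measurable borel"
    using borel_measurable_integrable[OF u] by simp
  have "integrable lborel (\<lambda>\<xi>. complex_of_real (gauss (e *\<^sub>R (\<xi> :: real ^ 'd))))"
    using integrable_lborel_affine[of e "gauss :: real ^ 'd \<Rightarrow> real" 0] integrable_gauss[where 'd='d] e
    by (intro integrable_of_real) simp
  then have v: "integrable lborel (\<lambda>\<xi>. iexp (\<xi> \<bullet> x) * gauss (e *\<^sub>R \<xi>))"
    by (subst mult.commute) (rule integrable_iexp_mult, auto)
  have inner: "(LINT \<xi>|lborel. iexp (- (\<xi> \<bullet> y)) * (iexp (\<xi> \<bullet> x) * gauss (e *\<^sub>R \<xi>)))
      = sqrt (2 * pi) ^ CARD('d) * gauss ((y - x) /\<^sub>R e) / e ^ CARD('d)" for y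
  proof -
    have "(LINT \<xi>|lborel. iexp (- (\<xi> \<bullet> y)) * (iexp (\<xi> \<bullet> x) * gauss (e *\<^sub>R \<xi>)))
      = (LINT \<xi>|lborel. iexp (((x - y) /\<^sub>R e) \<bullet> (0 + e *\<^sub>R \<xi>)) * gauss (0 + e *\<^sub>R \<xi>))"
    proof (intro Bochner_Integration.integral_cong refl)
      fix \<xi>
      have "((x - y) /\<^sub>R e) \<bullet> (0 + e *\<^sub>R \<xi>) = - (\<xi> \<bullet> y) + \<xi> \<bullet> x"
        using e by (simp add: inner_diff_left inner_diff_right inner_commute mult.assoc[symmetric])
      then have "iexp (((x - y) /\<^sub>R e) \<bullet> (0 + e *\<^sub>R \<xi>)) = iexp (- (\<xi> \<bullet> y)) * iexp (\<xi> \<bullet> x)"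
        by (simp only: of_real_add distrib_left exp_add)
      then show "iexp (- (\<xi> \<bullet> y)) * (iexp (\<xi> \<bullet> x) * gauss (e *\<^sub>R \<xi>)) =
          iexp (((x - y) /\<^sub>R e) \<bullet> (0 + e *\<^sub>R \<xi>)) * gauss (0 + e *\<^sub>R \<xi>)"
        by (simp only: mult.assoc add_0)
    qed
    also have "\<dots> = (LINT \<xi>|lborel. iexp (((x - y) /\<^sub>R e) \<bullet> \<xi>) * gauss \<xi>) /\<^sub>R \<bar>e\<bar> ^ DIM(real ^ 'd)"
      by (rule integral_lborel_affine[where f="\<lambda>z. iexp (((x - y) /\<^sub>R e) \<bullet> z) * gauss z"]) (use e in auto)
    also have "\<dots> = (sqrt (2 * pi) ^ CARD('d) * gauss ((x - y) /\<^sub>R e)) /\<^sub>R e ^ CARD('d)"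
      using e by (simp only: integral_iexp_gauss) (simp add: scaleR_conv_of_real)
    also have "gauss ((x - y) /\<^sub>R e) = gauss ((y - x) /\<^sub>R e)"
      by (simp add: gauss_def inner_diff_left inner_diff_right inner_commute)
    finally show ?thesis by (simp add: scaleR_conv_of_real divide_inverse mult.commute)
  qed
  have "(LINT \<xi>|lborel. (LINT y|lborel. u y * iexp (- (\<xi> \<bullet> y))) * (iexp (\<xi> \<bullet> x) * gauss (e *\<^sub>R \<xi>)))
    = (LINT y|lborel. u y * (sqrt (2 * pi) ^ CARD('d) * gauss ((y - x) /\<^sub>R e) / e ^ CARD('d)))"
    unfolding inner[symmetric]
    by (rule integral_swap[OF u v, of "\<lambda>y \<xi>. iexp (- (\<xi> \<bullet> y))"]) auto
  also have "\<dots> = (LINT y|lborel. (sqrt (2 * pi) ^ CARD('d) / e ^ CARD('d)) * (u y * gauss ((y - x) /\<^sub>R e)))"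
    by (intro Bochner_Integration.integral_cong refl) (simp add: divide_inverse mult_ac)
  also have "\<dots> = (sqrt (2 * pi) ^ CARD('d) / e ^ CARD('d)) * (LINT y|lborel. u y * gauss ((y - x) /\<^sub>R e))"
    by (rule integral_mult_right_zero)
  also have "(LINT z|lborel. u (x + e *\<^sub>R z) * gauss z) = (LINT y|lborel. u y * gauss ((y - x) /\<^sub>R e)) /\<^sub>R e ^ CARD('d)"
    using integral_lborel_affine[of e "\<lambda>y. u y * gauss ((y - x) /\<^sub>R e)" x] e by simp
  then have "(LINT y|lborel. u y * gauss ((y - x) /\<^sub>R e)) = e ^ CARD('d) * (LINT z|lborel. u (x + e *\<^sub>R z) * gauss z)"
    using e by (simp add: scaleR_conv_of_real)
  finally show ?thesis using e by simp
qed

text \<open>The counterpart for a function given by an inverse transform. Both formulas contain a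
  symbol integrated against \<open>iexp (\<xi> \<bullet> x) * gauss (e *\<^sub>R \<xi>)\<close>, so
  the Gaussian means of a function and of its blocks can be compared on the Fourier side.\<close>

lemma gauss_mean_inverse_fourier:
  fixes G :: "real ^ 'd \<Rightarrow> complex"
  assumes G: "integrable lborel G"
  shows "(LINT z|lborel. (LINT \<xi>|lborel. G \<xi> * iexp (\<xi> \<bullet> (x + e *\<^sub>R z))) * gauss z)
    = sqrt (2 * pi) ^ CARD('d) * (LINT \<xi>|lborel. G \<xi> * (iexp (\<xi> \<bullet> x) * gauss (e *\<^sub>R \<xi>)))"
proof -
  have v: "integrable lborel (\<lambda>z::real^'d. complex_of_real (gauss z))"
    by (rule integrable_of_real[OF integrable_gauss])
  have inner: "(LINT z|lborel. iexp (\<xi> \<bullet> (x + e *\<^sub>R z)) * gauss z) = iexp (\<xi> \<bullet> x) * (sqrt (2 * pi) ^ CARD('d) * gauss (e *\<^sub>R \<xi>))" for \<xi>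
  proof -
    have "(LINT z|lborel. iexp (\<xi> \<bullet> (x + e *\<^sub>R z)) * gauss z) = (LINT z|lborel. iexp (\<xi> \<bullet> x) * (iexp ((e *\<^sub>R \<xi>) \<bullet> z) * gauss z))"
      by (simp add: inner_add_right exp_add algebra_simps)
    also have "\<dots> = iexp (\<xi> \<bullet> x) * (sqrt (2 * pi) ^ CARD('d) * gauss (e *\<^sub>R \<xi>))"
      by (simp only: integral_mult_right_zero integral_iexp_gauss)
    finally show ?thesis .
  qed
  have "(LINT z|lborel. (LINT \<xi>|lborel. G \<xi> * iexp (\<xi> \<bullet> (x + e *\<^sub>R z))) * gauss z)
    = (LINT \<xi>|lborel. G \<xi> * (iexp (\<xi> \<bullet> x) * (sqrt (2 * pi) ^ CARD('d) * gauss (e *\<^sub>R \<xi>))))"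
    by (subst integral_swap[OF G v]) (auto simp: inner)
  also have "\<dots> = (LINT \<xi>|lborel. sqrt (2 * pi) ^ CARD('d) * (G \<xi> * (iexp (\<xi> \<bullet> x) * gauss (e *\<^sub>R \<xi>))))"
    by (simp add: mult_ac)
  finally show ?thesis by (simp only: integral_mult_right_zero)
qed

section \<open>Gaussian means as approximate identities, and Fourier inversion\<close>

lemma gauss_le_1: "gauss x \<le> 1"
  by (simp add: gauss_def)

lemma isCont_gauss: "isCont gauss x"
  unfolding gauss_def by (intro continuous_intros) auto

text \<open>Continuity is required at the single point \<open>x\<close> and no sign is imposed on
  \<open>e\<close>: the lemma is also applied to the indicator of a box off its boundary, with a
  negative null sequence.\<close>

lemma tendsto_gauss_mean:
  fixes u :: "real ^ 'd \<Rightarrow> complex"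
  assumes u[measurable]: "u \<in> borel_measurable borel" and B: "\<And>x. norm (u x) \<le> B" and c: "isCont u x"
    and e: "e \<longlonglongrightarrow> 0"
  shows "(\<lambda>n. LINT z|lborel. u (x + e n *\<^sub>R z) * gauss z) \<longlonglongrightarrow> sqrt (2 * pi) ^ CARD('d) * u x"
proof -
  have "(\<lambda>n. LINT z|lborel. u (x + e n *\<^sub>R z) * gauss z) \<longlonglongrightarrow> (LINT z|lborel. u x * gauss (z :: real ^ 'd))"
  proof (rule integral_dominated_convergence[where w="\<lambda>z. B * gauss z"])
    show "integrable lborel (\<lambda>z::real^'d. B * gauss z)" by (simp add: integrable_gauss)
    have "(\<lambda>n. u (x + e n *\<^sub>R z)) \<longlonglongrightarrow> u x" for z
      by (rule isCont_tendsto_compose[OF c])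
        (use tendsto_add[OF tendsto_const[of x] tendsto_scaleR[OF e tendsto_const[of z]]] in simp)
    then show "AE z in lborel. (\<lambda>n. u (x + e n *\<^sub>R z) * gauss z) \<longlonglongrightarrow> u x * gauss (z :: real ^ 'd)"
      by (auto intro!: tendsto_intros)
    show "AE z in lborel. norm (u (x + e n *\<^sub>R z) * gauss z) \<le> B * gauss z" for n
      using B by (intro AE_I2) (auto simp: norm_mult gauss_pos less_imp_le intro!: mult_right_mono)
  qed (auto)
  then show ?thesis by (simp only: integral_mult_right_zero integral_gauss mult.commute)
qed

text \<open>Both sides of \<open>fourier_gauss_summation\<close> are followed as the width tends to
  0: the modulus of \<open>v\<close> is the majorant on the Fourier side, and in space the means
  converge to the value at \<open>x\<close>.\<close>

lemma fourier_inversion: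
  fixes u :: "real ^ 'd \<Rightarrow> complex"
  defines "v \<equiv> \<lambda>\<xi>. LINT y|lborel. u y * iexp (- (\<xi> \<bullet> y))"
  assumes u: "integrable lborel u" and B: "\<And>x. norm (u x) \<le> B" and c: "isCont u x"
    and v: "integrable lborel v"
  shows "(LINT \<xi>|lborel. v \<xi> * iexp (\<xi> \<bullet> x)) = (2 * pi) ^ CARD('d) * u x"
proof -
  have um[measurable]: "u \<in> borel_measurable borel"
    using borel_measurable_integrable[OF u] by simp
  have vm[measurable]: "v \<in> borel_measurable borel"
    using borel_measurable_integrable[OF v] by simp
  define e where "e n = inverse (real (Suc n))" for n
  have e: "e \<longlonglongrightarrow> 0" "e n > 0" for n
    unfolding e_def by (rule LIMSEQ_inverse_real_of_nat) simp
  have "(\<lambda>n. LINT \<xi>|lborel. v \<xi> * (iexp (\<xi> \<bullet> x) * gauss (e n *\<^sub>R \<xi>))) \<longlonglongrightarrow> (LINT \<xi>|lborel. v \<xi> * iexp (\<xi> \<bullet> x))"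
  proof (rule integral_dominated_convergence[where w="\<lambda>z. norm (v z)"])
    have "(\<lambda>n. gauss (e n *\<^sub>R \<xi>)) \<longlonglongrightarrow> gauss (0::real^'d)" for \<xi> :: "real ^ 'd"
      by (rule isCont_tendsto_compose[where g=gauss and l="0::real^'d", OF isCont_gauss])
        (use tendsto_scaleR[OF e(1) tendsto_const[of \<xi>]] in simp)
    then have "(\<lambda>n. v \<xi> * (iexp (\<xi> \<bullet> x) * complex_of_real (gauss (e n *\<^sub>R \<xi>)))) \<longlonglongrightarrow> v \<xi> * (iexp (\<xi> \<bullet> x) * complex_of_real (gauss (0::real^'d)))" for \<xi>
      by (intro tendsto_intros)
    then show "AE \<xi> in lborel. (\<lambda>n. v \<xi> * (iexp (\<xi> \<bullet> x) * gauss (e n *\<^sub>R \<xi>))) \<longlonglongrightarrow> v \<xi> * iexp (\<xi> \<bullet> x)"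
      by (simp add: gauss_def)
    show "AE z in lborel. norm (v z * (iexp (z \<bullet> x) * gauss (e n *\<^sub>R z))) \<le> norm (v z)" for n
      by (intro AE_I2) (simp add: norm_mult abs_of_pos gauss_pos gauss_le_1 mult_left_le)
  qed (use v in auto)
  moreover have "(\<lambda>n. LINT \<xi>|lborel. v \<xi> * (iexp (\<xi> \<bullet> x) * gauss (e n *\<^sub>R \<xi>))) \<longlonglongrightarrow> sqrt (2 * pi) ^ CARD('d) * (sqrt (2 * pi) ^ CARD('d) * u x)"
    unfolding v_def fourier_gauss_summation[OF u e(2)]
    by (intro tendsto_intros tendsto_gauss_mean[OF _ B c e(1)]) auto
  ultimately have "(LINT \<xi>|lborel. v \<xi> * iexp (\<xi> \<bullet> x)) = sqrt (2 * pi) ^ CARD('d) * (sqrt (2 * pi) ^ CARD('d) * u x)"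
    by (rule LIMSEQ_unique)
  also have "\<dots> = complex_of_real (sqrt (2 * pi) * sqrt (2 * pi)) ^ CARD('d) * u x"
    by (simp only: of_real_mult power_mult_distrib mult.assoc of_real_power)
  finally show ?thesis by simp
qed

text \<open>Convolution with \<open>\<Psi>\<close> multiplies the symbol of \<open>F\<close> by
  \<open>\<Phi>\<close>, which is 1 wherever \<open>G\<close> does not vanish. To see this one needs
  the transform of \<open>\<Psi>\<close>, and this is where inversion is used.\<close>

lemma reproducing_formula:
  fixes G \<Phi> :: "real ^ 'd \<Rightarrow> complex"
  defines "F \<equiv> \<lambda>x. LINT \<xi>|lborel. G \<xi> * iexp (\<xi> \<bullet> x)"
    and "\<Psi> \<equiv> \<lambda>x. (LINT \<xi>|lborel. \<Phi> \<xi> * iexp (\<xi> \<bullet> x)) / (2 * pi) ^ CARD('d)"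
  assumes G: "integrable lborel G" and \<Phi>: "integrable lborel \<Phi>" "\<And>\<xi>. norm (\<Phi> \<xi>) \<le> B" "\<And>\<xi>. isCont \<Phi> \<xi>"
    and \<Psi>: "integrable lborel \<Psi>" and eq: "\<And>\<xi>. G \<xi> * \<Phi> \<xi> = G \<xi>"
  shows "F x = (LINT y|lborel. F y * \<Psi> (x - y))"
proof -
  \<comment> \<open>The reflection makes the forward transform in \<open>fourier_inversion\<close>
    agree with the inverse transform that defines \<open>\<Psi>\<close>.\<close>
  let ?u = "\<lambda>y. \<Phi> (0 + (-1) *\<^sub>R y)"
  have [measurable]: "\<Psi> \<in> borel_measurable borel" "\<Phi> \<in> borel_measurable borel"
    using borel_measurable_integrable[OF \<Psi>] borel_measurable_integrable[OF \<Phi>(1)] by simp_all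
  have v: "(LINT y|lborel. ?u y * iexp (- (\<xi> \<bullet> y))) = (2 * pi) ^ CARD('d) * \<Psi> \<xi>" for \<xi>
    using integral_lborel_affine[of "-1" "\<lambda>z. \<Phi> z * iexp (z \<bullet> \<xi>)" 0]
    by (simp add: \<Psi>_def inner_commute)
  have inv: "(LINT y|lborel. \<Psi> y * iexp (y \<bullet> \<xi>)) = \<Phi> (- \<xi>)" for \<xi>
  proof -
    have u: "integrable lborel ?u" by (rule integrable_lborel_affine) (use \<Phi> in auto)
    have "isCont ?u \<xi>"
      by (rule isCont_o2[where f="\<lambda>y. 0 + (-1) *\<^sub>R y" and g=\<Phi>, OF _ \<Phi>(3)]) (intro continuous_intros)
    from fourier_inversion[OF u _ this, of B] v \<Psi> \<Phi>(2)
    have "(LINT y|lborel. ((2 * pi) ^ CARD('d) * \<Psi> y) * iexp (y \<bullet> \<xi>)) = (2 * pi) ^ CARD('d) * \<Phi> (- \<xi>)"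
      by simp
    then have "(2 * pi) ^ CARD('d) * (LINT y|lborel. \<Psi> y * iexp (y \<bullet> \<xi>)) = (2 * pi) ^ CARD('d) * \<Phi> (- \<xi>)"
      by (simp only: mult.assoc integral_mult_right_zero of_real_power[symmetric])
    then show ?thesis by simp
  qed
  have inner: "(LINT y|lborel. iexp (\<xi> \<bullet> y) * \<Psi> (x - y)) = iexp (\<xi> \<bullet> x) * \<Phi> \<xi>" for \<xi>
  proof -
    have "(LINT y|lborel. iexp (\<xi> \<bullet> y) * \<Psi> (x - y)) = (LINT y|lborel. iexp (\<xi> \<bullet> x) * (\<Psi> y * iexp (y \<bullet> (- \<xi>))))"
    proof -
      let ?h = "\<lambda>y. iexp (\<xi> \<bullet> x) * (\<Psi> y * iexp (y \<bullet> (- \<xi>)))"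
      have "iexp (\<xi> \<bullet> y) * \<Psi> (x - y) = ?h (x + (-1) *\<^sub>R y)" for y
      proof -
        have "\<xi> \<bullet> y = \<xi> \<bullet> x + (x - y) \<bullet> (- \<xi>)"
          by (simp add: inner_diff_left inner_diff_right inner_commute)
        then have "iexp (\<xi> \<bullet> y) = iexp (\<xi> \<bullet> x) * iexp ((x - y) \<bullet> (- \<xi>))"
          by (simp only: of_real_add distrib_left exp_add)
        then show ?thesis by simp
      qed
      then have "(LINT y|lborel. iexp (\<xi> \<bullet> y) * \<Psi> (x - y)) = (LINT y|lborel. ?h (x + (-1) *\<^sub>R y))"
        by (simp only:)
      also have "\<dots> = (LINT y|lborel. ?h y) /\<^sub>R \<bar>-1\<bar> ^ DIM(real ^ 'd)"
        by (rule integral_lborel_affine) auto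
      finally show ?thesis by simp
    qed
    then show ?thesis by (simp only: integral_mult_right_zero inv) simp
  qed
  have \<Psi>': "integrable lborel (\<lambda>y. \<Psi> (x - y))"
    using integrable_lborel_affine[of "-1" \<Psi> x] \<Psi> by simp
  have "(LINT y|lborel. F y * \<Psi> (x - y)) = (LINT \<xi>|lborel. G \<xi> * (iexp (\<xi> \<bullet> x) * \<Phi> \<xi>))"
    unfolding F_def by (subst integral_swap[OF G \<Psi>']) (auto simp: inner)
  also have "\<dots> = F x"
    unfolding F_def by (intro Bochner_Integration.integral_cong refl) (metis eq mult.assoc mult.commute)
  finally show ?thesis ..
qed

section \<open>Decay of one-dimensional kernels\<close>

lemma has_vector_derivative_iexp:
  "((\<lambda>s. iexp (s * t)) has_vector_derivative (\<i> * t * iexp (s * t))) (at s)"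
proof -
  have "((\<lambda>z. exp (\<i> * (z * of_real t))) has_field_derivative (\<i> * t * iexp (s * t))) (at (of_real s))"
    by (auto intro!: derivative_eq_intros)
  then show ?thesis
    using has_vector_derivative_real_field[of "\<lambda>z. exp (\<i> * (z * of_real t))" _ s UNIV] by simp
qed

text \<open>Two integrations by parts in one step: (m' - \<i> t m) iexp (s t) has the derivative
  (m'' + t^2 m) iexp (s t) and vanishes at both ends of [-a, a]. Hence t^2 times the integral
  belonging to \<open>m\<close> has the modulus of the one belonging to \<open>m''\<close>; the
  trivial bound 2 a M for each of the two gives the constant 4 a M.\<close>

lemma fourier_decay:
  fixes m m' m'' :: "real \<Rightarrow> complex"
  assumes a: "a \<ge> 0"
    and m: "\<And>s. (m has_vector_derivative m' s) (at s)"
    and m': "\<And>s. (m' has_vector_derivative m'' s) (at s)"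
    and c: "continuous_on UNIV m''"
    and z: "\<And>s. \<bar>s\<bar> \<ge> a \<Longrightarrow> m s = 0" "\<And>s. \<bar>s\<bar> \<ge> a \<Longrightarrow> m' s = 0"
    and M: "\<And>s. norm (m s) \<le> M" "\<And>s. norm (m'' s) \<le> M"
  shows "norm (LINT s|lborel. m s * iexp (s * t)) \<le> 4 * a * M / (1 + t\<^sup>2)"
proof -
  have cm: "continuous_on UNIV m"
    using m by (auto intro!: continuous_at_imp_continuous_on has_vector_derivative_continuous)
  define J where "J g = (LINT s|lborel. indicator {-a..a} s *\<^sub>R (g s * iexp (s * t)))" for g
  have int: "integrable lborel (\<lambda>s. indicator {-a..a} s *\<^sub>R (g s * iexp (s * t)))" if "continuous_on UNIV g" for g
    by (rule borel_integrable_compact[OF _ continuous_on_subset[OF _ subset_UNIV]])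
      (auto intro!: continuous_intros that)
  have J: "norm (J g) \<le> 2 * a * M" if g: "continuous_on UNIV g" "\<And>s. norm (g s) \<le> M" for g
  proof -
    have "norm (J g) \<le> (LINT s|lborel. norm (indicator {-a..a} s *\<^sub>R (g s * iexp (s * t))))"
      unfolding J_def by (rule integral_norm_bound)
    also have "\<dots> \<le> (LINT s|lborel. indicator {-a..a} s *\<^sub>R M)"
    proof (rule integral_mono)
      show "integrable lborel (\<lambda>s. indicator {-a..a} s *\<^sub>R M)"
        by (rule borel_integrable_compact) auto
      show "norm (indicator {-a..a} s *\<^sub>R (g s * iexp (s * t))) \<le> indicator {-a..a} s *\<^sub>R M" for s
        using g(2)[of s] by (simp add: norm_mult indicator_def)
    qed (rule integrable_norm[OF int[OF g(1)]])
    also have "\<dots> = 2 * a * M" using a by simp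
    finally show ?thesis .
  qed
  have I: "(LINT s|lborel. m s * iexp (s * t)) = J m"
    unfolding J_def by (rule Bochner_Integration.integral_cong) (auto simp: indicator_def z)
  have "(LINT s|lborel. indicator {-a..a} s *\<^sub>R (m'' s * iexp (s * t) + t\<^sup>2 * (m s * iexp (s * t)))) =
      (m' a - \<i> * t * m a) * iexp (a * t) - (m' (-a) - \<i> * t * m (-a)) * iexp (-a * t)"
  proof (rule integral_FTC_atLeastAtMost)
    show "((\<lambda>s. (m' s - \<i> * t * m s) * iexp (s * t)) has_vector_derivative
        m'' s * iexp (s * t) + t\<^sup>2 * (m s * iexp (s * t))) (at s within {-a..a})" for s
    proof -
      have e: "((\<lambda>s. iexp (s * t)) has_vector_derivative (\<i> * t * iexp (s * t))) (at s)"
        by (rule has_vector_derivative_iexp)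
      have "((\<lambda>s. (m' s - \<i> * t * m s) * iexp (s * t)) has_vector_derivative
         (m' s - \<i> * t * m s) * (\<i> * t * iexp (s * t)) + (m'' s - \<i> * t * m' s) * iexp (s * t)) (at s)"
        by (intro has_vector_derivative_mult has_vector_derivative_diff has_vector_derivative_mult_right m m' e)
      then have "((\<lambda>s. (m' s - \<i> * t * m s) * iexp (s * t)) has_vector_derivative
        m'' s * iexp (s * t) + t\<^sup>2 * (m s * iexp (s * t))) (at s)"
        by (rule has_vector_derivative_eq_rhs) (simp add: algebra_simps power2_eq_square)
      then show ?thesis by (rule has_vector_derivative_at_within)
    qed
    show "continuous_on {-a..a} (\<lambda>s. m'' s * iexp (s * t) + t\<^sup>2 * (m s * iexp (s * t)))"
      by (rule continuous_on_subset[OF _ subset_UNIV]) (intro continuous_intros c cm)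
  qed (use a in auto)
  then have "(LINT s|lborel. indicator {-a..a} s *\<^sub>R (m'' s * iexp (s * t)) + t\<^sup>2 * (indicator {-a..a} s *\<^sub>R (m s * iexp (s * t)))) = 0"
    using a z by (simp add: algebra_simps)
  then have "J m'' + t\<^sup>2 * J m = 0"
    using Bochner_Integration.integral_add[OF int[OF c] integrable_mult_right[OF int[OF cm]], of "complex_of_real t ^ 2"]
    unfolding J_def by (simp only: integral_mult_right_zero of_real_power)
  then have "t\<^sup>2 * J m = - J m''" by (simp add: add_eq_0_iff)
  then have "t\<^sup>2 * norm (J m) = norm (J m'')"
    by (metis norm_minus_cancel norm_mult norm_of_real abs_of_nonneg zero_le_power2)
  then have "(1 + t\<^sup>2) * norm (J m) \<le> 4 * a * M"
    using J[OF cm M(1)] J[OF c M(2)] by (simp add: algebra_simps)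
  moreover have "1 + t\<^sup>2 > 0" by (simp add: add_pos_nonneg)
  ultimately show ?thesis unfolding I by (simp add: field_simps)
qed

text \<open>Mean value theorem for \<open>arctan\<close>: the intermediate point \<open>z\<close> is
  within distance 1 of \<open>t\<close>, which gives
  \<open>1 + z\<^sup>2 \<le> 3 * (1 + t\<^sup>2)\<close> and thus the factor 3. The purpose is a
  right-hand side that telescopes when summed over a grid.\<close>

lemma inverse_square_le_arctan_diff:
  fixes t :: real
  assumes "0 < d" "d \<le> 1"
  shows "1 / (1 + t\<^sup>2) \<le> 3 / d * (arctan (t + d) - arctan t)"
proof -
  obtain z where z: "t < z" "z < t + d" "arctan (t + d) - arctan t = (t + d - t) * inverse (1 + z\<^sup>2)"
    using MVT2[of t "t + d" arctan "\<lambda>z. inverse (1 + z\<^sup>2)"] assms DERIV_arctan by auto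
  have "\<bar>z\<bar> \<le> \<bar>t\<bar> + 1" using z assms by linarith
  then have "z\<^sup>2 \<le> (\<bar>t\<bar> + 1)\<^sup>2" by (metis abs_ge_zero power2_abs power_mono)
  also have "\<dots> \<le> 2 + 3 * t\<^sup>2"
  proof -
    have "2 * \<bar>t\<bar> \<le> 1 + t\<^sup>2"
      using zero_le_power2[of "\<bar>t\<bar> - 1"] by (simp add: power2_diff)
    moreover have "(\<bar>t\<bar> + 1)\<^sup>2 = t\<^sup>2 + 2 * \<bar>t\<bar> + 1"
      by (simp add: power2_sum)
    ultimately show ?thesis using zero_le_power2[of t] by linarith
  qed
  finally have "1 + z\<^sup>2 \<le> 3 * (1 + t\<^sup>2)" by simp
  moreover have "1 + z\<^sup>2 > 0" "1 + t\<^sup>2 > 0" by (simp_all add: add_pos_nonneg)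
  ultimately have "1 / (1 + t\<^sup>2) \<le> 3 * inverse (1 + z\<^sup>2)"
    by (simp add: field_simps)
  then show ?thesis using z(3) assms by simp
qed

text \<open>The intervals of length \<open>d = min a 1\<close> that start at the grid points do not
  overlap, so the increments of \<open>arctan\<close> over them add up to at most pi. In
  \<open>1 + 1 / a\<close> the second summand counts the grid points per unit length, and the first
  one takes over for coarse grids.\<close>

lemma sum_inverse_square_le:
  fixes a y :: real and K :: "int set"
  assumes a: "a > 0" and K: "finite K"
  shows "(\<Sum>k\<in>K. 1 / (1 + (a * of_int k - y)\<^sup>2)) \<le> 3 * pi * (1 + 1 / a)"
proof -
  define d where "d = min a 1"
  have d: "0 < d" "d \<le> 1" "d \<le> a" using a by (auto simp: d_def)
  obtain N :: nat where N: "K \<subseteq> {- int N..<int N}"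
  proof
    have "\<bar>k\<bar> \<le> (\<Sum>k\<in>K. \<bar>k\<bar>)" if "k \<in> K" for k
      using K that by (intro member_le_sum) auto
    then show "K \<subseteq> {- int (nat (1 + (\<Sum>k\<in>K. \<bar>k\<bar>)))..<int (nat (1 + (\<Sum>k\<in>K. \<bar>k\<bar>)))}"
      by (force simp: sum_nonneg)
  qed
  let ?F = "\<lambda>k::int. arctan (a * of_int k - y)"
  have tel: "(\<Sum>k\<in>{- int N..<int N}. F (k + 1) - F k) = F (int N) - F (- int N)" for N and F :: "int \<Rightarrow> real"
  proof (induction N)
    case (Suc N)
    have "{- int (Suc N)..<int (Suc N)} = insert (- int N - 1) (insert (int N) {- int N..<int N})" by auto
    then show ?case using Suc by (simp add: algebra_simps minus_diff_commute)
  qed simp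
  have "(\<Sum>k\<in>K. 1 / (1 + (a * of_int k - y)\<^sup>2)) \<le> (\<Sum>k\<in>{- int N..<int N}. 1 / (1 + (a * of_int k - y)\<^sup>2))"
    by (rule sum_mono2) (use N in \<open>auto intro!: divide_nonneg_nonneg add_nonneg_nonneg\<close>)
  also have "\<dots> \<le> (\<Sum>k\<in>{- int N..<int N}. 3 / d * (?F (k + 1) - ?F k))"
  proof (rule sum_mono)
    fix k
    have "1 / (1 + (a * of_int k - y)\<^sup>2) \<le> 3 / d * (arctan (a * of_int k - y + d) - ?F k)"
      by (rule inverse_square_le_arctan_diff) (use d in auto)
    also have "arctan (a * of_int k - y + d) \<le> ?F (k + 1)"
      using d by (intro arctan_monotone') (simp add: algebra_simps)
    finally show "1 / (1 + (a * of_int k - y)\<^sup>2) \<le> 3 / d * (?F (k + 1) - ?F k)"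
      using d by (simp add: divide_right_mono)
  qed
  also have "\<dots> = 3 / d * (?F (int N) - ?F (- int N))"
    by (simp only: sum_distrib_left[symmetric] tel[of ?F])
  also have "\<dots> \<le> 3 / d * pi"
  proof (rule mult_left_mono)
    show "?F (int N) - ?F (- int N) \<le> pi"
      using arctan_ubound[of "a * of_int (int N) - y"] arctan_lbound[of "a * of_int (- int N) - y"]
      by linarith
  qed (use d in simp)
  also have "1 / d \<le> 1 + 1 / a"
    using a by (auto simp: d_def min_def field_simps)
  then have "3 / d * pi \<le> 3 * pi * (1 + 1 / a)"
    using mult_left_mono[of "1 / d" "1 + 1 / a" "3 * pi"] by simp
  finally show ?thesis .
qed

text \<open>The functions of index \<open>n \<ge> 3\<close> live on \<bar>s\<bar> \<ge> 4, and those
  of index at most 2 on \<bar>s\<bar> \<le> 8. Two functions would add up to 1 on (-2, 2), but the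
  rescaled blocks occupy the closed interval [-2, 2]; the third one provides the margin. The bound 9
  stays clear of the boundary point 8, about which the argument below says nothing.\<close>

lemma bump_exists:
  assumes "decomposition_system \<phi>"
  obtains b b' b'' :: "real \<Rightarrow> complex" where
    "\<And>s. (b has_vector_derivative b' s) (at s)"
    "\<And>s. (b' has_vector_derivative b'' s) (at s)"
    "continuous_on UNIV b''"
    "\<And>s. \<bar>s\<bar> \<ge> 9 \<Longrightarrow> b s = 0 \<and> b' s = 0 \<and> b'' s = 0"
    "\<And>s. \<bar>s\<bar> < 4 \<Longrightarrow> b s = 1"
proof -
  define D where "D l = (\<lambda>s. \<Sum>n<3. nth_derivative l (\<phi> n) s)" for l
  have tf: "test_function (\<phi> n)" for n using assms by (simp add: decomposition_system_def)
  have d: "(nth_derivative l (\<phi> n) has_vector_derivative nth_derivative (Suc l) (\<phi> n) s) (at s)" for n l s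
  proof -
    have "nth_derivative l (\<phi> n) differentiable (at s)"
      using tf[of n] by (simp add: test_function_def)
    then show ?thesis
      by (simp add: nth_derivative_def vector_derivative_works)
  qed
  have D: "(D l has_vector_derivative D (Suc l) s) (at s)" for l s
    unfolding D_def by (intro has_vector_derivative_sum d)
  have phi_le: "\<phi> n s = 0" if "n < 3" "\<bar>s\<bar> > 8" for n s
  proof (rule ccontr)
    assume "\<phi> n s \<noteq> 0"
    then have s: "s \<in> closure {x. \<phi> n x \<noteq> 0}" using closure_subset[of "{x. \<phi> n x \<noteq> 0}"] by auto
    have "\<bar>s\<bar> \<le> 2 \<or> (n \<ge> 1 \<and> \<bar>s\<bar> \<le> 2 ^ (n + 1))"
      using s assms unfolding decomposition_system_def
      by (cases "n = 0") (auto simp: subset_iff)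
    moreover have "(2::real) ^ (n + 1) \<le> 2 ^ 3" using that by (intro power_increasing) auto
    ultimately show False using that by auto
  qed
  \<comment> \<open>The set \<bar>s\<bar> > 8 is open, so all derivatives inherit the vanishing
    there.\<close>
  have zero: "D l s = 0" if "\<bar>s\<bar> > 8" for l s
    using that
  proof (induction l arbitrary: s)
    case 0
    then show ?case using phi_le by (simp add: D_def nth_derivative_def)
  next
    case (Suc l)
    have "((\<lambda>_. 0) has_vector_derivative D (Suc l) s) (at s)"
    proof (rule has_vector_derivative_transform_within_open[OF D[of l]])
      show "open {s::real. \<bar>s\<bar> > 8}" by (intro open_Collect_less continuous_intros)
    qed (use Suc in auto)
    then show ?case by (metis has_vector_derivative_const vector_derivative_at)
  qed
  have one: "D 0 s = 1" if "\<bar>s\<bar> < 4" for s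
  proof -
    have z: "\<phi> n s = 0" if n: "n \<notin> {..<3}" for n
    proof (rule ccontr)
      assume "\<phi> n s \<noteq> 0"
      then have s: "s \<in> closure {x. \<phi> n x \<noteq> 0}" using closure_subset[of "{x. \<phi> n x \<noteq> 0}"] by auto
      have "2 ^ (n - 1) \<le> \<bar>s\<bar>"
        using s assms n unfolding decomposition_system_def by (auto simp: subset_iff)
      moreover have "(2::real) ^ (n - 1) \<ge> 2 ^ 2" using n by (intro power_increasing) auto
      ultimately show False using \<open>\<bar>s\<bar> < 4\<close> by simp
    qed
    have "(\<lambda>n. \<phi> n s) sums 1" using assms by (simp add: decomposition_system_def)
    moreover have "(\<lambda>n. \<phi> n s) sums (\<Sum>n<3. \<phi> n s)" by (rule sums_finite) (use z in auto)
    ultimately show ?thesis by (auto simp: D_def nth_derivative_def dest: sums_unique2)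
  qed
  show ?thesis
  proof (rule that[of "D 0" "D (Suc 0)" "D (Suc (Suc 0))"])
    show "continuous_on UNIV (D (Suc (Suc 0)))"
      using D by (auto intro!: continuous_at_imp_continuous_on has_vector_derivative_continuous)
  qed (use D zero one in auto)
qed

text \<open>The increment of \<open>\<psi>\<close> is the transform of
  \<open>(iexp (s * h) - 1) * b s\<close>. On [-a, a] the first factor is at most
  \<open>a * h\<close> in modulus, and its derivatives carry a factor \<open>h\<close>; so
  \<open>fourier_decay\<close> applies with a bound of order \<open>h\<close>.\<close>

lemma bump_kernel_bounds:
  fixes b b' b'' :: "real \<Rightarrow> complex"
  assumes b: "\<And>s. (b has_vector_derivative b' s) (at s)"
    and b': "\<And>s. (b' has_vector_derivative b'' s) (at s)"
    and c: "continuous_on UNIV b''"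
    and z: "\<And>s. \<bar>s\<bar> \<ge> a \<Longrightarrow> b s = 0 \<and> b' s = 0 \<and> b'' s = 0" and a: "a \<ge> 1"
  defines "\<psi> \<equiv> \<lambda>t. (LINT s|lborel. b s * iexp (s * t)) / (2 * pi)"
  obtains C where "C > 0" "\<And>s. norm (b s) \<le> C" "\<And>t. norm (\<psi> t) \<le> C / (1 + t\<^sup>2)"
    "\<And>t h. 0 \<le> h \<Longrightarrow> h \<le> 1 \<Longrightarrow> norm (\<psi> (t + h) - \<psi> t) \<le> C * h / (1 + t\<^sup>2)"
proof -
  have cb: "continuous_on UNIV b" "continuous_on UNIV b'"
    using b b' by (auto intro!: continuous_at_imp_continuous_on has_vector_derivative_continuous)
  have bd: "\<exists>B\<ge>0. \<forall>s. norm (g s) \<le> B" if "continuous_on UNIV g" "\<And>s. \<bar>s\<bar> \<ge> a \<Longrightarrow> g s = 0" for g :: "real \<Rightarrow> complex"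
  proof -
    have "compact (g ` {-a..a})"
      by (intro compact_continuous_image continuous_on_subset[OF that(1)]) auto
    then obtain B where B: "\<And>s. s \<in> {-a..a} \<Longrightarrow> norm (g s) \<le> B"
      using compact_imp_bounded bounded_iff by (metis imageI)
    have "norm (g s) \<le> max B 0" for s
      using B[of s] that(2)[of s] by (cases "s \<in> {-a..a}") auto
    then show ?thesis by (intro exI[of _ "max B 0"]) auto
  qed
  obtain B0 where B0: "B0 \<ge> 0" "\<And>s. norm (b s) \<le> B0" using bd[OF cb(1)] z by auto
  obtain B1 where B1: "B1 \<ge> 0" "\<And>s. norm (b' s) \<le> B1" using bd[OF cb(2)] z by auto
  obtain B2 where B2: "B2 \<ge> 0" "\<And>s. norm (b'' s) \<le> B2" using bd[OF c] z by auto
  \<comment> \<open>\<open>a * B0\<close> bounds the symbol of the increment divided by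
    \<open>h\<close>, and \<open>B0 + 2 * B1 + a * B2\<close> its second derivative divided by
    \<open>h\<close>; \<open>B0\<close> and \<open>B2\<close> alone serve \<open>\<psi>\<close>
    itself, and 1 makes \<open>M\<close> positive.\<close>
  define M where "M = a * B0 + B0 + 2 * B1 + a * B2 + B2 + 1"
  have M: "a * B0 + B0 + 2 * B1 + a * B2 \<le> M" "B0 \<le> M" "B2 \<le> M" "M > 0" "a * B0 \<le> M"
    using a B0 B1 B2 by (auto simp: M_def intro!: add_nonneg_nonneg add_nonneg_pos mult_nonneg_nonneg)
  define C where "C = 4 * a * M"
  have CM: "C \<ge> M" "C > 0" unfolding C_def using a M(4) by (auto intro: mult_right_mono)
  have pi1: "norm (w / (2 * pi)) \<le> norm w" for w :: complex
    using pi_gt3 by (simp add: norm_divide divide_le_eq mult_le_cancel_left1)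
  have intb: "integrable lborel (\<lambda>s. b s * iexp (s * t))" for t
  proof -
    have "integrable lborel (\<lambda>s. indicator {-a..a} s *\<^sub>R (b s * iexp (s * t)))"
      by (rule borel_integrable_compact[OF _ continuous_on_subset[OF _ subset_UNIV]])
        (auto intro!: continuous_intros cb)
    also have "(\<lambda>s. indicator {-a..a} s *\<^sub>R (b s * iexp (s * t))) = (\<lambda>s. b s * iexp (s * t))"
      using z by (auto simp: fun_eq_iff indicator_def)
    finally show ?thesis .
  qed
  show ?thesis
  proof
    show "C > 0" by fact
    show "norm (b s) \<le> C" for s using B0(2)[of s] M CM by linarith
    show "norm (\<psi> t) \<le> C / (1 + t\<^sup>2)" for t
      unfolding \<psi>_def
      by (rule order_trans[OF pi1], unfold C_def, rule fourier_decay[OF _ b b' c])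
        (use a z in \<open>auto intro: order_trans[OF B0(2) M(2)] order_trans[OF B2(2) M(3)]\<close>)
    show "norm (\<psi> (t + h) - \<psi> t) \<le> C * h / (1 + t\<^sup>2)" if h: "0 \<le> h" "h \<le> 1" for t h
    proof -
      let ?m = "\<lambda>s. (iexp (s * h) - 1) * b s"
      let ?m' = "\<lambda>s. (iexp (s * h) - 1) * b' s + (\<i> * h * iexp (s * h)) * b s"
      let ?m'' = "\<lambda>s. (iexp (s * h) - 1) * b'' s + 2 * (\<i> * h * iexp (s * h)) * b' s + (\<i> * h * (\<i> * h * iexp (s * h))) * b s"
      have e: "((\<lambda>s. iexp (s * h)) has_vector_derivative (\<i> * h * iexp (s * h))) (at s)" for s
        by (rule has_vector_derivative_iexp)
      have e1: "((\<lambda>s. iexp (s * h) - 1) has_vector_derivative (\<i> * h * iexp (s * h))) (at s)" for s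
        using has_vector_derivative_diff[OF e has_vector_derivative_const[of 1]] by simp
      have e2: "((\<lambda>s. \<i> * h * iexp (s * h)) has_vector_derivative (\<i> * h * (\<i> * h * iexp (s * h)))) (at s)" for s
        by (rule has_vector_derivative_mult_right[OF e])
      have small: "norm (iexp (s * h) - 1) * norm (g s) \<le> a * h * B"
        if "\<And>s. \<bar>s\<bar> \<ge> a \<Longrightarrow> g s = 0" "\<And>s. norm (g s) \<le> B" "B \<ge> 0" for g :: "real \<Rightarrow> complex" and s B
      proof (cases "\<bar>s\<bar> \<ge> a")
        case True
        then show ?thesis using that a h by simp
      next
        case False
        have "norm (iexp (s * h) - 1) \<le> \<bar>s * h\<bar>"
          using iexp_approx1[of "s * h" 0] by simp
        also have "\<dots> \<le> a * h" using False h by (simp add: abs_mult mult_right_mono)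
        finally show ?thesis using that a h by (intro mult_mono) auto
      qed
      have "norm (LINT s|lborel. ?m s * iexp (s * t)) \<le> 4 * a * (h * M) / (1 + t\<^sup>2)"
      proof (rule fourier_decay)
        show "(?m has_vector_derivative ?m' s) (at s)" for s
          by (rule has_vector_derivative_mult[OF e1 b])
        show "(?m' has_vector_derivative ?m'' s) (at s)" for s
          by (rule has_vector_derivative_eq_rhs[OF has_vector_derivative_add[OF
             has_vector_derivative_mult[OF e1 b'] has_vector_derivative_mult[OF e2 b]]]) (simp add: algebra_simps)
        show "continuous_on UNIV ?m''" by (intro continuous_intros c cb)
        show "norm (?m s) \<le> h * M" for s
        proof -
          have "norm (?m s) \<le> h * (a * B0)"
            using small[of b B0 s] z B0 by (simp add: norm_mult mult_ac)
          also have "\<dots> \<le> h * M" using M(5) h(1) by (rule mult_left_mono)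
          finally show ?thesis .
        qed
        show "norm (?m'' s) \<le> h * M" for s
        proof -
          have "norm (?m'' s) \<le> norm (iexp (s * h) - 1) * norm (b'' s) + 2 * h * norm (b' s) + h * h * norm (b s)"
            by (rule order_trans[OF norm_triangle_ineq] add_mono)+ (use h in \<open>auto simp: norm_mult\<close>)
          also have "\<dots> \<le> a * h * B2 + 2 * h * B1 + h * 1 * B0"
            by (intro add_mono small mult_mono B0 B1 B2) (use z h in auto)
          also have "\<dots> = h * (B0 + 2 * B1 + a * B2)" by (simp add: algebra_simps)
          also have "\<dots> \<le> h * M" using M(1) h a B0 by (intro mult_left_mono) (auto intro: order_trans[rotated])
          finally show ?thesis .
        qed
      qed (use a z in auto)
      moreover have "\<psi> (t + h) - \<psi> t = (LINT s|lborel. ?m s * iexp (s * t)) / (2 * pi)"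
      proof -
        have "(LINT s|lborel. ?m s * iexp (s * t)) = (LINT s|lborel. b s * iexp (s * (t + h)) - b s * iexp (s * t))"
          by (intro Bochner_Integration.integral_cong refl) (simp add: algebra_simps exp_add)
        also have "\<dots> = (LINT s|lborel. b s * iexp (s * (t + h))) - (LINT s|lborel. b s * iexp (s * t))"
          by (rule Bochner_Integration.integral_diff[OF intb intb])
        finally show ?thesis by (simp add: \<psi>_def diff_divide_distrib)
      qed
      ultimately show ?thesis using pi1[of "LINT s|lborel. ?m s * iexp (s * t)"] by (simp add: C_def mult_ac)
    qed
  qed
qed

section \<open>Sampling of convolutions\<close>

text \<open>The factor \<open>-1/2\<close> that each active direction contributes to a Faber-Schauder coefficient is
  absorbed into the difference. As in the level vectors, \<open>j = -1\<close> means that no difference is taken.\<close>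

definition step_diff :: "real \<Rightarrow> (real \<Rightarrow> complex) \<Rightarrow> real \<Rightarrow> complex" where
  "step_diff h u t = (u (t + 2 * h) - 2 * u (t + h) + u t) / (-2)"

definition kern :: "(real \<Rightarrow> complex) \<Rightarrow> nat \<Rightarrow> int \<Rightarrow> real \<Rightarrow> complex" where
  "kern \<psi> n j = (if j = -1 then (\<lambda>t. 2 ^ n * \<psi> (2 ^ n * t))
     else step_diff (2 powi (- (j + 1))) (\<lambda>t. 2 ^ n * \<psi> (2 ^ n * t)))"

text \<open>The constant 2 is (1 + 2 + 1) / 2, from the weights of the second difference and the
  division by -2.\<close>

lemma step_diff_integrable:
  assumes u: "integrable lborel u"
  shows "integrable lborel (step_diff h u)"
    and "(LINT t|lborel. norm (step_diff h u t)) \<le> 2 * (LINT t|lborel. norm (u t))"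
proof -
  have sh: "integrable lborel (\<lambda>t. u (t + c))" for c
    using lborel_integrable_real_affine[OF u, of 1 c] by (simp add: add.commute)
  have sh': "(LINT t|lborel. norm (u (t + c))) = (LINT t|lborel. norm (u t))" for c
    using lborel_integral_real_affine[of 1 "\<lambda>t. norm (u t)" c] by (simp add: add.commute)
  show 1: "integrable lborel (step_diff h u)"
    unfolding step_diff_def
    by (intro integrable_divide Bochner_Integration.integrable_add Bochner_Integration.integrable_diff integrable_mult_right sh u)
  have "norm (step_diff h u t) \<le> (norm (u (t + 2 * h)) + 2 * norm (u (t + h)) + norm (u t)) / 2" for t
  proof -
    have "norm (u (t + 2 * h) - 2 * u (t + h) + u t) \<le> norm (u (t + 2 * h)) + norm (2 * u (t + h)) + norm (u t)"
      by (intro order_trans[OF norm_triangle_ineq] add_mono norm_triangle_ineq4 order_refl)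
    then show ?thesis by (simp add: step_diff_def norm_divide norm_mult)
  qed
  then have "(LINT t|lborel. norm (step_diff h u t)) \<le> (LINT t|lborel. (norm (u (t + 2 * h)) + 2 * norm (u (t + h)) + norm (u t)) / 2)"
    by (intro integral_mono integrable_norm[OF 1] integrable_divide Bochner_Integration.integrable_add
       integrable_mult_right integrable_norm sh u)
  also have "\<dots> = 2 * (LINT t|lborel. norm (u t))"
    by (subst integral_divide_zero, subst Bochner_Integration.integral_add, (intro Bochner_Integration.integrable_add
       integrable_mult_right integrable_norm sh u)+, subst Bochner_Integration.integral_add, (intro Bochner_Integration.integrable_add
       integrable_mult_right integrable_norm sh u)+) (simp only: integral_mult_right_zero sh', simp)
  finally show "(LINT t|lborel. norm (step_diff h u t)) \<le> 2 * (LINT t|lborel. norm (u t))" .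
qed

lemma integrable_inverse_square: "integrable lborel (\<lambda>t::real. 1 / (1 + t\<^sup>2))"
  using integrable_inverse_1_plus_square by (simp add: set_integrable_def divide_inverse)

text \<open>In the variable 2^n t the grid of a level j \<ge> 0 has step 2 e and the difference has
  step e = 2^(n - j - 1); at level -1 the grid has step 2^n \<ge> 1 and there is no difference. The
  bound must be uniform in \<open>y\<close>, which becomes the variable of integration in the
  convolution.\<close>

lemma kern_sum_bound:
  assumes C: "C > 0" and d0: "\<And>t. norm (\<psi> t) \<le> C / (1 + t\<^sup>2)"
    and d1: "\<And>t h. 0 \<le> h \<Longrightarrow> h \<le> 1 \<Longrightarrow> norm (\<psi> (t + h) - \<psi> t) \<le> C * h / (1 + t\<^sup>2)"
    and j: "j \<ge> -1" and K: "finite K"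
  shows "(\<Sum>k\<in>K. norm (kern \<psi> n j (2 powi (- max j 0) * of_int k - y))) \<le> 12 * pi * C * 2 ^ n"
proof -
  have S: "(\<Sum>k\<in>K. c / (1 + (a * of_int k - z)\<^sup>2)) \<le> c * (3 * pi * (1 + 1 / a))" if "a > 0" "c \<ge> 0" for a c z :: real
  proof -
    have "(\<Sum>k\<in>K. c / (1 + (a * of_int k - z)\<^sup>2)) = c * (\<Sum>k\<in>K. 1 / (1 + (a * of_int k - z)\<^sup>2))"
      by (simp add: sum_distrib_left)
    also have "\<dots> \<le> c * (3 * pi * (1 + 1 / a))"
      using that K by (intro mult_left_mono sum_inverse_square_le) auto
    finally show ?thesis .
  qed
  have S2: "(\<Sum>k\<in>K. C / (1 + (a * of_int k - z)\<^sup>2)) \<le> 6 * pi * C" if "a \<ge> 1" for a z :: real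
  proof -
    have "(\<Sum>k\<in>K. C / (1 + (a * of_int k - z)\<^sup>2)) \<le> C * (3 * pi * (1 + 1 / a))"
      using that C by (intro S) auto
    also have "\<dots> \<le> C * (3 * pi * 2)"
      using that C by (intro mult_left_mono) auto
    finally show ?thesis by (simp add: mult_ac)
  qed
  show ?thesis
  proof (cases "j = -1")
    case True
    have "(\<Sum>k\<in>K. norm (kern \<psi> n j (2 powi (- max j 0) * of_int k - y)))
        = (\<Sum>k\<in>K. 2 ^ n * norm (\<psi> (2 ^ n * of_int k - 2 ^ n * y)))"
      using True by (simp add: kern_def norm_mult norm_power algebra_simps)
    also have "\<dots> \<le> (\<Sum>k\<in>K. 2 ^ n * (C / (1 + (2 ^ n * of_int k - 2 ^ n * y)\<^sup>2)))"
      by (intro sum_mono mult_left_mono d0) auto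
    also have "\<dots> = 2 ^ n * (\<Sum>k\<in>K. C / (1 + (2 ^ n * of_int k - 2 ^ n * y)\<^sup>2))"
      by (simp only: sum_distrib_left)
    also have "\<dots> \<le> 2 ^ n * (6 * pi * C)"
      by (intro mult_left_mono S2) auto
    also have "\<dots> \<le> 12 * pi * C * 2 ^ n" using C by simp
    finally show ?thesis .
  next
    case False
    with j have j0: "j \<ge> 0" by simp
    define h :: real where "h = 2 powi (- (j + 1))"
    define e where "e = 2 ^ n * h"
    have h: "h > 0" by (simp add: h_def)
    have g: "2 powi (- max j 0) = 2 * h"
      using j0 power_int_add_1[of "2::real" "- j - 1"] by (simp add: h_def max_def)
    have e: "e > 0" using h by (simp add: e_def)
    have kd: "kern \<psi> n j = step_diff h (\<lambda>t. 2 ^ n * \<psi> (2 ^ n * t))"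
      using False by (simp add: kern_def h_def)
    let ?s = "\<lambda>k. 2 * e * of_int k - 2 ^ n * y"
    have kern: "norm (kern \<psi> n j (2 powi (- max j 0) * of_int k - y))
        = 2 ^ n * (norm (\<psi> (?s k + 2 * e) - 2 * \<psi> (?s k + e) + \<psi> (?s k)) / 2)" for k
    proof -
      have "kern \<psi> n j (2 powi (- max j 0) * of_int k - y)
        = 2 ^ n * ((\<psi> (?s k + 2 * e) - 2 * \<psi> (?s k + e) + \<psi> (?s k)) / (-2))"
        unfolding kd g step_diff_def e_def by (simp add: algebra_simps diff_divide_distrib)
      then show ?thesis by (simp add: norm_mult norm_divide norm_power)
    qed
    show ?thesis
    proof (cases "2 * e \<ge> 1")
      \<comment> \<open>The three terms are bounded one by one: each is summed over a shifted grid
        of step at least 1, which gives at most \<open>6 * pi * C\<close>, and the weights are 1/2,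
        1 and 1/2.\<close>
      case True
      have "norm (kern \<psi> n j (2 powi (- max j 0) * of_int k - y)) \<le> 2 ^ n * ((C / (1 + (2 * e * of_int k - (2 ^ n * y - 2 * e))\<^sup>2)
          + 2 * (C / (1 + (2 * e * of_int k - (2 ^ n * y - e))\<^sup>2)) + C / (1 + (2 * e * of_int k - 2 ^ n * y)\<^sup>2)) / 2)" for k
      proof -
        have "norm (\<psi> (?s k + 2 * e) - 2 * \<psi> (?s k + e) + \<psi> (?s k))
            \<le> norm (\<psi> (?s k + 2 * e)) + norm (2 * \<psi> (?s k + e)) + norm (\<psi> (?s k))"
          by (intro order_trans[OF norm_triangle_ineq] add_mono norm_triangle_ineq4 order_refl)
        also have "\<dots> \<le> C / (1 + (2 * e * of_int k - (2 ^ n * y - 2 * e))\<^sup>2)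
          + 2 * (C / (1 + (2 * e * of_int k - (2 ^ n * y - e))\<^sup>2)) + C / (1 + (2 * e * of_int k - 2 ^ n * y)\<^sup>2)"
        proof -
          have "2 * e * of_int k - (2 ^ n * y - 2 * e) = ?s k + 2 * e" "2 * e * of_int k - (2 ^ n * y - e) = ?s k + e"
            by simp_all
          note eqs = this
          have "norm (2 * \<psi> (?s k + e)) = 2 * norm (\<psi> (?s k + e))" by (simp add: norm_mult)
          then show ?thesis
            unfolding eqs using d0[of "?s k + 2 * e"] d0[of "?s k + e"] d0[of "?s k"] by linarith
        qed
        finally show ?thesis unfolding kern by (intro mult_left_mono divide_right_mono) auto
      qed
      then have "(\<Sum>k\<in>K. norm (kern \<psi> n j (2 powi (- max j 0) * of_int k - y))) \<le>
         (\<Sum>k\<in>K. 2 ^ n * ((C / (1 + (2 * e * of_int k - (2 ^ n * y - 2 * e))\<^sup>2)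
          + 2 * (C / (1 + (2 * e * of_int k - (2 ^ n * y - e))\<^sup>2)) + C / (1 + (2 * e * of_int k - 2 ^ n * y)\<^sup>2)) / 2))"
        by (rule sum_mono)
      also have "\<dots> = 2 ^ n * (((\<Sum>k\<in>K. C / (1 + (2 * e * of_int k - (2 ^ n * y - 2 * e))\<^sup>2))
          + 2 * (\<Sum>k\<in>K. C / (1 + (2 * e * of_int k - (2 ^ n * y - e))\<^sup>2)) + (\<Sum>k\<in>K. C / (1 + (2 * e * of_int k - 2 ^ n * y)\<^sup>2))) / 2)"
        by (simp only: sum.distrib sum_distrib_left[symmetric] sum_divide_distrib[symmetric])
      also have "\<dots> \<le> 2 ^ n * ((6 * pi * C + 2 * (6 * pi * C) + 6 * pi * C) / 2)"
        by (intro mult_left_mono divide_right_mono add_mono S2 True) auto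
      also have "\<dots> = 12 * pi * C * 2 ^ n" by simp
      finally show ?thesis .
    next
      case False
      have e1: "e \<le> 1" using False e by simp
      have "norm (kern \<psi> n j (2 powi (- max j 0) * of_int k - y)) \<le> 2 ^ n * ((C * e / (1 + (2 * e * of_int k - (2 ^ n * y - e))\<^sup>2)
          + C * e / (1 + (2 * e * of_int k - 2 ^ n * y)\<^sup>2)) / 2)" for k
      proof -
        \<comment> \<open>A gain of first order suffices, so the second difference is split into two
          first differences of step \<open>e \<le> 1\<close>, to which \<open>d1\<close>
          applies.\<close>
        have "\<psi> (?s k + 2 * e) - 2 * \<psi> (?s k + e) + \<psi> (?s k) = (\<psi> (?s k + e + e) - \<psi> (?s k + e)) - (\<psi> (?s k + e) - \<psi> (?s k))"
          by (simp add: algebra_simps)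
        then have "norm (\<psi> (?s k + 2 * e) - 2 * \<psi> (?s k + e) + \<psi> (?s k)) \<le>
            norm (\<psi> (?s k + e + e) - \<psi> (?s k + e)) + norm (\<psi> (?s k + e) - \<psi> (?s k))"
          by (simp only: norm_triangle_ineq4)
        also have "\<dots> \<le> C * e / (1 + (?s k + e)\<^sup>2) + C * e / (1 + (?s k)\<^sup>2)"
          using e e1 by (intro add_mono d1) auto
        finally have le: "norm (\<psi> (?s k + 2 * e) - 2 * \<psi> (?s k + e) + \<psi> (?s k)) \<le>
            C * e / (1 + (?s k + e)\<^sup>2) + C * e / (1 + (?s k)\<^sup>2)" .
        have eq: "2 * e * of_int k - (2 ^ n * y - e) = ?s k + e" by simp
        show ?thesis unfolding kern eq by (intro mult_left_mono divide_right_mono le) auto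
      qed
      then have "(\<Sum>k\<in>K. norm (kern \<psi> n j (2 powi (- max j 0) * of_int k - y))) \<le>
         (\<Sum>k\<in>K. 2 ^ n * ((C * e / (1 + (2 * e * of_int k - (2 ^ n * y - e))\<^sup>2)
          + C * e / (1 + (2 * e * of_int k - 2 ^ n * y)\<^sup>2)) / 2))"
        by (rule sum_mono)
      also have "\<dots> = 2 ^ n * (((\<Sum>k\<in>K. C * e / (1 + (2 * e * of_int k - (2 ^ n * y - e))\<^sup>2))
          + (\<Sum>k\<in>K. C * e / (1 + (2 * e * of_int k - 2 ^ n * y)\<^sup>2))) / 2)"
        by (simp only: sum.distrib sum_distrib_left[symmetric] sum_divide_distrib[symmetric])
      \<comment> \<open>The gain \<open>e\<close> against the factor \<open>1 + 1 / (2 * e)\<close>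
        from the sum over the grid leaves \<open>e + 1 / 2\<close>, which is bounded.\<close>
      also have "\<dots> \<le> 2 ^ n * ((C * e * (3 * pi * (1 + 1 / (2 * e))) + C * e * (3 * pi * (1 + 1 / (2 * e)))) / 2)"
        using e C by (intro mult_left_mono divide_right_mono add_mono S) auto
      also have "\<dots> = 2 ^ n * (3 * pi * C * (e + 1 / 2))" using e by (simp add: field_simps)
      also have "\<dots> \<le> 2 ^ n * (3 * pi * C * 4)" using e1 C by (intro mult_left_mono) auto
      finally show ?thesis by (simp add: mult_ac)
    qed
  qed
qed

lemma
  assumes m[measurable]: "\<psi> \<in> borel_measurable borel"
    and d0: "\<And>t. norm (\<psi> t) \<le> C / (1 + t\<^sup>2)"
  shows integrable_kern: "integrable lborel (kern \<psi> n j)"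
    and integral_norm_kern: "(LINT t|lborel. norm (kern \<psi> n j t)) \<le> 2 * (LINT t|lborel. norm (\<psi> t))"
proof -
  have "integrable lborel \<psi>"
  proof (rule Bochner_Integration.integrable_bound)
    show "integrable lborel (\<lambda>t. C * (1 / (1 + t\<^sup>2)))"
      by (intro integrable_mult_right integrable_inverse_square)
    show "AE t in lborel. norm (\<psi> t) \<le> norm (C * (1 / (1 + t\<^sup>2)))"
      using order_trans[OF d0 abs_ge_self] by (intro AE_I2) simp
  qed simp
  then have i: "integrable lborel (\<lambda>t. 2 ^ n * \<psi> (2 ^ n * t))"
    using lborel_integrable_real_affine[of \<psi> "2 ^ n" 0] by (intro integrable_mult_right) simp
  have n: "(LINT t|lborel. norm (2 ^ n * \<psi> (2 ^ n * t))) = (LINT t|lborel. norm (\<psi> t))"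
    using lborel_integral_real_affine[of "2 ^ n" "\<lambda>t. norm (\<psi> t)" 0]
    by (simp add: norm_mult norm_power)
  show "integrable lborel (kern \<psi> n j)"
    unfolding kern_def using i step_diff_integrable(1)[OF i] by simp
  show "(LINT t|lborel. norm (kern \<psi> n j t)) \<le> 2 * (LINT t|lborel. norm (\<psi> t))"
    unfolding kern_def using n step_diff_integrable(2)[OF i] by (simp add: Bochner_Integration.integral_nonneg)
qed

text \<open>Convexity of the power function, with its tangent at \<open>s\<close>. It is Young's
  inequality with the weights \<open>1 / p\<close> and \<open>1 - 1 / p\<close>, which also covers
  \<open>p = 1\<close>.\<close>

lemma powr_tangent_le:
  fixes u s p :: real
  assumes "p \<ge> 1" "u \<ge> 0" "s > 0"
  shows "p * s powr (p - 1) * u \<le> u powr p + (p - 1) * s powr p"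
proof (cases "u = 0")
  case False
  then have u: "u > 0" using assms by simp
  have "(u powr p) powr (1 / p) * (s powr p) powr (1 - 1 / p) \<le> 1 / p * u powr p + (1 - 1 / p) * s powr p"
    using assms u by (intro Youngs_inequality_0) auto
  also have "(u powr p) powr (1 / p) * (s powr p) powr (1 - 1 / p) = u * s powr (p - 1)"
    using assms u by (simp add: powr_powr algebra_simps)
  finally have "p * (u * s powr (p - 1)) \<le> p * (1 / p * u powr p + (1 - 1 / p) * s powr p)"
    using assms by (intro mult_left_mono) auto
  then show ?thesis using assms by (simp add: algebra_simps)
qed (use assms in auto)

text \<open>Jensen's inequality for a weight that is not normalised: the tangent inequality at the
  mean value \<open>s = ?U / A\<close> is integrated. An upper bound \<open>A\<close> for the mass
  is enough, because the mass enters only with the nonnegative factor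
  \<open>(p - 1) * s powr p\<close>.\<close>

lemma integral_powr_le:
  fixes u w :: "'a \<Rightarrow> real"
  assumes p: "p \<ge> 1" and u: "\<And>x. u x \<ge> 0" and w: "\<And>x. w x \<ge> 0"
    and iw: "integrable M w" and iuw: "integrable M (\<lambda>x. u x * w x)" and iup: "integrable M (\<lambda>x. u x powr p * w x)"
    and A: "integral\<^sup>L M w \<le> A" "A > 0"
  shows "(LINT x|M. u x * w x) powr p \<le> A powr (p - 1) * (LINT x|M. u x powr p * w x)"
proof -
  let ?U = "LINT x|M. u x * w x" and ?B = "LINT x|M. u x powr p * w x"
  have B: "?B \<ge> 0" by (intro Bochner_Integration.integral_nonneg) (use u w in auto)
  have U: "?U \<ge> 0" by (intro Bochner_Integration.integral_nonneg) (use u w in auto)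
  show ?thesis
  proof (cases "?U = 0")
    case False
    define s where "s = ?U / A"
    have s: "s > 0" using False U A by (simp add: s_def)
    have "(LINT x|M. p * s powr (p - 1) * (u x * w x)) \<le> (LINT x|M. u x powr p * w x + (p - 1) * s powr p * w x)"
    proof (rule integral_mono)
      show "p * s powr (p - 1) * (u x * w x) \<le> u x powr p * w x + (p - 1) * s powr p * w x" for x
        using mult_right_mono[OF powr_tangent_le[OF p u s], of "w x"] w[of x] by (simp add: algebra_simps)
    qed (intro integrable_mult_right Bochner_Integration.integrable_add iw iuw iup)+
    then have "p * s powr (p - 1) * ?U \<le> ?B + (p - 1) * s powr p * integral\<^sup>L M w"
      by (subst (asm) Bochner_Integration.integral_add[OF iup integrable_mult_right[OF iw]]) simp
    also have "\<dots> \<le> ?B + (p - 1) * s powr p * A"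
      using p A by (intro add_left_mono mult_left_mono) auto
    finally have "p * s powr (p - 1) * (s * A) \<le> ?B + (p - 1) * s powr p * A"
      using A by (simp add: s_def)
    moreover have "s powr (p - 1) * s = s powr p" using s powr_add[of s "p - 1" 1] by simp
    ultimately have "p * s powr p * A \<le> ?B + (p - 1) * s powr p * A"
      by (metis mult.assoc)
    then have "s powr p * A \<le> ?B" by (simp add: algebra_simps)
    then have "A powr (p - 1) * (s powr p * A) \<le> A powr (p - 1) * ?B"
      by (intro mult_left_mono) auto
    moreover have "A powr (p - 1) * A = A powr p" using A powr_add[of A "p - 1" 1] by simp
    then have "A powr (p - 1) * (s powr p * A) = (s * A) powr p"
      using s A by (simp add: powr_mult mult_ac)
    moreover have "s * A = ?U" using A by (simp add: s_def)
    ultimately show ?thesis by metis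
  qed (use B in simp)
qed


section \<open>Convolution with tensor products, and its samples on a grid\<close>

definition conv :: "(real ^ 'd \<Rightarrow> complex) \<Rightarrow> ('d \<Rightarrow> real \<Rightarrow> complex) \<Rightarrow> real ^ 'd \<Rightarrow> complex" where
  "conv F v x = (LINT y|lborel. F y * (\<Prod>i\<in>UNIV. v i (x $ i - y $ i)))"

lemma
  fixes v :: "'d::finite \<Rightarrow> real \<Rightarrow> complex" and x :: "real ^ 'd"
  assumes v: "\<And>i. integrable lborel (v i)"
  shows integrable_tensor_shift: "integrable lborel (\<lambda>y. \<Prod>i\<in>UNIV. v i (x $ i - y $ i))"
    and integral_norm_tensor_shift: "(LINT y|lborel. norm (\<Prod>i\<in>UNIV. v i (x $ i - y $ i))) = (\<Prod>i\<in>UNIV. (LINT t|lborel. norm (v i t)))"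
proof -
  show "integrable lborel (\<lambda>y. \<Prod>i\<in>UNIV. v i (x $ i - y $ i))"
    using integrable_lborel_affine[OF _ integrable_prod_vec[of v, OF v], of "-1" x] by simp
  have v': "integrable lborel (\<lambda>t. complex_of_real (norm (v i t)))" for i
    by (intro integrable_of_real integrable_norm v)
  have m[measurable]: "v i \<in> borel_measurable borel" for i
    using borel_measurable_integrable[OF v] by simp
  have "complex_of_real (LINT y|lborel. norm (\<Prod>i\<in>UNIV. v i (x $ i - y $ i))) =
      (LINT y|lborel. (\<Prod>i\<in>UNIV. complex_of_real (norm (v i ((x + (-1) *\<^sub>R y) $ i)))))"
    by (simp only: integral_complex_of_real[symmetric] prod_norm[symmetric] of_real_prod) simp
  also have "\<dots> = (LINT y|lborel. (\<Prod>i\<in>UNIV. complex_of_real (norm (v i ((y :: real ^ 'd) $ i))))) /\<^sub>R \<bar>-1\<bar> ^ DIM(real ^ 'd)"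
    by (rule integral_lborel_affine[where f="\<lambda>y. \<Prod>i\<in>UNIV. complex_of_real (norm (v i (y $ i)))"]) auto
  also have "\<dots> = of_real (\<Prod>i\<in>UNIV. (LINT t|lborel. norm (v i t)))"
    by (subst integral_prod_vec[OF v']) simp
  finally show "(LINT y|lborel. norm (\<Prod>i\<in>UNIV. v i (x $ i - y $ i))) = (\<Prod>i\<in>UNIV. (LINT t|lborel. norm (v i t)))"
    by (simp only: of_real_eq_iff)
qed

lemma integrable_bounded_mult:
  fixes F g :: "'a \<Rightarrow> 'b::{real_normed_algebra, banach, second_countable_topology}"
  assumes F: "F \<in> borel_measurable M" "\<And>x. norm (F x) \<le> B" and g: "integrable M g"
  shows "integrable M (\<lambda>x. F x * g x)"
proof (rule Bochner_Integration.integrable_bound)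
  show "integrable M (\<lambda>x. B *\<^sub>R g x)" by (intro integrable_scaleR_right g)
  show "(\<lambda>x. F x * g x) \<in> borel_measurable M"
    using F(1) borel_measurable_integrable[OF g] by (rule borel_measurable_times)
  show "AE x in M. norm (F x * g x) \<le> norm (B *\<^sub>R g x)"
  proof (rule AE_I2)
    fix x
    have "norm (F x * g x) \<le> norm (F x) * norm (g x)" by (rule norm_mult_ineq)
    also have "\<dots> \<le> \<bar>B\<bar> * norm (g x)" using F(2)[of x] by (intro mult_right_mono) auto
    finally show "norm (F x * g x) \<le> norm (B *\<^sub>R g x)" by simp
  qed
qed

text \<open>Only the \<open>i\<close>-th factor sees a shift in direction \<open>i\<close>, so the
  difference passes to that factor. The constant -2 undoes the division in \<open>step_diff\<close>;
  the normalisation of the coefficients will cancel these constants.\<close>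

lemma conv_second_diff:
  fixes F :: "real ^ 'd \<Rightarrow> complex"
  assumes F: "F \<in> borel_measurable borel" "\<And>x. norm (F x) \<le> B" and v: "\<And>i. integrable lborel (v i)"
  shows "second_diff i h (conv F v) x = (-2) * conv F (v(i := step_diff h (v i))) x"
proof -
  let ?P = "\<lambda>y. \<Prod>m\<in>UNIV - {i}. v m (x $ m - y $ m)"
  have s: "F y * (\<Prod>m\<in>UNIV. v m ((x + c *\<^sub>R axis i 1) $ m - y $ m)) = F y * (v i (x $ i - y $ i + c) * ?P y)" for c y
  proof -
    have "(\<Prod>m\<in>UNIV - {i}. v m ((x + c *\<^sub>R axis i 1) $ m - y $ m)) = ?P y"
      by (rule prod.cong) (auto simp: axis_def)
    then show ?thesis
      by (subst prod.remove[of UNIV i]) (simp_all add: axis_def algebra_simps)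
  qed
  have int: "integrable lborel (\<lambda>y. F y * (v i (x $ i - y $ i + c) * ?P y))" for c
    unfolding s[symmetric]
    by (rule integrable_bounded_mult[OF _ F(2) integrable_tensor_shift[OF v]]) (use F in simp)
  have conv: "conv F v (x + c *\<^sub>R axis i 1) = (LINT y|lborel. F y * (v i (x $ i - y $ i + c) * ?P y))" for c
    unfolding conv_def s ..
  have "second_diff i h (conv F v) x = conv F v (x + (2 * h) *\<^sub>R axis i 1) - 2 * conv F v (x + h *\<^sub>R axis i 1) + conv F v (x + 0 *\<^sub>R axis i 1)"
    by (simp add: second_diff_def)
  also have "\<dots> = (LINT y|lborel. F y * (v i (x $ i - y $ i + 2 * h) * ?P y) - 2 * (F y * (v i (x $ i - y $ i + h) * ?P y))
      + F y * (v i (x $ i - y $ i + 0) * ?P y))"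
    unfolding conv
    by (subst Bochner_Integration.integral_add, (intro Bochner_Integration.integrable_diff integrable_mult_right int)+,
        subst Bochner_Integration.integral_diff, (intro integrable_mult_right int)+) (simp only: integral_mult_right_zero)
  also have "\<dots> = (LINT y|lborel. (-2) * (F y * (\<Prod>m\<in>UNIV. (v(i := step_diff h (v i))) m (x $ m - y $ m))))"
  proof (rule Bochner_Integration.integral_cong[OF refl])
    fix y
    have "(\<Prod>m\<in>UNIV - {i}. (v(i := step_diff h (v i))) m (x $ m - y $ m)) = ?P y"
      by (rule prod.cong) auto
    then have "(\<Prod>m\<in>UNIV. (v(i := step_diff h (v i))) m (x $ m - y $ m)) = step_diff h (v i) (x $ i - y $ i) * ?P y"
      by (subst prod.remove[of UNIV i]) simp_all
    then show "F y * (v i (x $ i - y $ i + 2 * h) * ?P y) - 2 * (F y * (v i (x $ i - y $ i + h) * ?P y))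
      + F y * (v i (x $ i - y $ i + 0) * ?P y) = (-2) * (F y * (\<Prod>m\<in>UNIV. (v(i := step_diff h (v i))) m (x $ m - y $ m)))"
      by (simp only: step_diff_def) (simp add: field_simps)
  qed
  also have "\<dots> = (-2) * conv F (v(i := step_diff h (v i))) x"
    unfolding conv_def by (rule integral_mult_right_zero)
  finally show ?thesis .
qed

lemma conv_second_diff_fold:
  fixes F :: "real ^ 'd \<Rightarrow> complex"
  assumes F: "F \<in> borel_measurable borel" "\<And>x. norm (F x) \<le> B" and v: "\<And>i. integrable lborel (v i)"
  shows "Finite_Set.fold (\<lambda>i. second_diff i (h i)) (conv F v) S =
    (\<lambda>x. (-2) ^ card S * conv F (\<lambda>i. if i \<in> S then step_diff (h i) (v i) else v i) x)"
  using finite[of S]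
proof (induction S rule: finite_induct)
  case (insert i S)
  interpret comp_fun_commute "\<lambda>i. second_diff i (h i)" by (rule comp_fun_commute_second_diff)
  let ?w = "\<lambda>i. if i \<in> S then step_diff (h i) (v i) else v i"
  have w: "integrable lborel (?w i)" for i using v step_diff_integrable by simp
  have "Finite_Set.fold (\<lambda>i. second_diff i (h i)) (conv F v) (insert i S) =
      second_diff i (h i) (\<lambda>x. (-2) ^ card S * conv F ?w x)"
    using insert by simp
  also have "\<dots> = (\<lambda>x. (-2) ^ card S * second_diff i (h i) (conv F ?w) x)"
    by (simp add: second_diff_def fun_eq_iff algebra_simps)
  also have "\<dots> = (\<lambda>x. (-2) ^ card S * ((-2) * conv F (?w(i := step_diff (h i) (?w i))) x))"
    by (simp only: conv_second_diff[OF F w])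
  also have "?w(i := step_diff (h i) (?w i)) = (\<lambda>m. if m \<in> insert i S then step_diff (h m) (v m) else v m)"
    using insert by (auto simp: fun_eq_iff)
  finally show ?case using insert by (simp add: mult_ac)
qed simp

text \<open>An active direction turns its factor \<open>kern \<psi> (l $ i) (-1)\<close>, the plain
  dilate, into the kernel of level \<open>j $ i\<close>, while an inactive one has
  \<open>j $ i = -1\<close> and keeps it. The powers of -2 cancel.\<close>

lemma fs_coeff_conv:
  fixes F :: "real ^ 'd \<Rightarrow> complex"
  assumes F: "F \<in> borel_measurable borel" "\<And>x. norm (F x) \<le> B"
    and k: "\<And>i n j. integrable lborel (kern \<psi> n j)"
    and rep: "F = conv F (\<lambda>i. kern \<psi> (l $ i) (-1))"
  shows "fs_coeff F j k = conv F (\<lambda>i. kern \<psi> (l $ i) (j $ i)) (dyadic_point j k)"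
proof -
  have "fs_coeff F j k = fs_coeff (conv F (\<lambda>i. kern \<psi> (l $ i) (-1))) j k"
    using rep by simp
  also have "\<dots> = (-2) powi (- int (card (active j))) * ((-2) ^ card (active j) *
      conv F (\<lambda>i. if i \<in> active j then step_diff (2 powi (- (j $ i + 1))) (kern \<psi> (l $ i) (-1)) else kern \<psi> (l $ i) (-1)) (dyadic_point j k))"
    unfolding fs_coeff_def by (subst conv_second_diff_fold[OF F k]) simp
  also have "\<dots> = conv F (\<lambda>i. if i \<in> active j then step_diff (2 powi (- (j $ i + 1))) (kern \<psi> (l $ i) (-1)) else kern \<psi> (l $ i) (-1)) (dyadic_point j k)"
    by (simp add: power_int_minus)
  also have "(\<lambda>i. if i \<in> active j then step_diff (2 powi (- (j $ i + 1))) (kern \<psi> (l $ i) (-1)) else kern \<psi> (l $ i) (-1))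
      = (\<lambda>i. kern \<psi> (l $ i) (j $ i))"
    by (auto simp: active_def kern_def fun_eq_iff)
  finally show ?thesis .
qed

text \<open>Jensen's inequality is applied at each sample with the modulus of the kernel as weight;
  then the sum over the samples is taken under the integral, where only the kernels depend on
  \<open>k\<close>. The sample points are arbitrary: a grid yields the bound for the coefficients, a
  single point the uniform bound for a block.\<close>

lemma conv_sample_le:
  fixes F :: "real ^ 'd \<Rightarrow> complex"
  assumes p: "p \<ge> 1" and F: "F \<in> borel_measurable borel" "\<And>x. norm (F x) \<le> B"
    and Fp: "integrable lborel (\<lambda>x. norm (F x) powr p)"
    and v: "\<And>i. integrable lborel (v i)" and A: "\<And>i. (LINT t|lborel. norm (v i t)) \<le> A" "A > 0"
    and K: "finite K" and W: "\<And>y. (\<Sum>k\<in>K. (\<Prod>i\<in>UNIV. norm (v i (x k $ i - y $ i)))) \<le> W"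
  shows "(\<Sum>k\<in>K. norm (conv F v (x k)) powr p) \<le> (A ^ CARD('d)) powr (p - 1) * (W * (LINT y|lborel. norm (F y) powr p))"
proof -
  let ?w = "\<lambda>k y. norm (\<Prod>i\<in>UNIV. v i (x k $ i - y $ i))"
  let ?A = "A ^ CARD('d)"
  have B0: "B \<ge> 0" using norm_ge_zero F(2) order_trans by blast
  have Fm[measurable]: "F \<in> borel_measurable borel" by fact
  have iw: "integrable lborel (?w k)" for k by (intro integrable_norm integrable_tensor_shift v)
  have iuw: "integrable lborel (\<lambda>y. norm (F y) * ?w k y)" for k
    by (rule integrable_bounded_mult[OF _ _ iw, of _ B]) (use F in auto)
  have iup: "integrable lborel (\<lambda>y. norm (F y) powr p * ?w k y)" for k
    by (rule integrable_bounded_mult[OF _ _ iw, of _ "B powr p"]) (use F p B0 in \<open>auto intro!: powr_mono2\<close>)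
  have 1: "norm (conv F v (x k)) powr p \<le> ?A powr (p - 1) * (LINT y|lborel. norm (F y) powr p * ?w k y)" for k
  proof -
    have "norm (conv F v (x k)) \<le> (LINT y|lborel. norm (F y) * ?w k y)"
      unfolding conv_def by (rule order_trans[OF integral_norm_bound]) (simp add: norm_mult)
    then have "norm (conv F v (x k)) powr p \<le> (LINT y|lborel. norm (F y) * ?w k y) powr p"
      using p by (intro powr_mono2) auto
    also have "\<dots> \<le> ?A powr (p - 1) * (LINT y|lborel. norm (F y) powr p * ?w k y)"
    proof (rule integral_powr_le[OF p _ _ iw iuw iup])
      show "integral\<^sup>L lborel (?w k) \<le> ?A"
        unfolding integral_norm_tensor_shift[OF v]
        using prod_mono[of UNIV "\<lambda>i. LINT t|lborel. norm (v i t)" "\<lambda>_. A"] A by simp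
    qed (use A in auto)
    finally show ?thesis .
  qed
  have "(\<Sum>k\<in>K. norm (conv F v (x k)) powr p) \<le> (\<Sum>k\<in>K. ?A powr (p - 1) * (LINT y|lborel. norm (F y) powr p * ?w k y))"
    by (rule sum_mono) (rule 1)
  also have "\<dots> = ?A powr (p - 1) * (LINT y|lborel. (\<Sum>k\<in>K. norm (F y) powr p * ?w k y))"
    by (subst Bochner_Integration.integral_sum[OF iup]) (simp only: sum_distrib_left)
  also have "\<dots> \<le> ?A powr (p - 1) * (LINT y|lborel. W * norm (F y) powr p)"
  proof (intro mult_left_mono integral_mono)
    show "(\<Sum>k\<in>K. norm (F y) powr p * ?w k y) \<le> W * norm (F y) powr p" for y
      using mult_right_mono[OF W[of y], of "norm (F y) powr p"]
      by (simp add: sum_distrib_left[symmetric] prod_norm[symmetric] mult.commute)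
  qed (use iup Fp in auto)
  finally show ?thesis by simp
qed

text \<open>\<open>K\<close> lies in the product of its coordinate projections \<open>L i\<close>.
  As all terms are nonnegative, enlarging \<open>K\<close> to this product only increases the sum,
  which then factorises.\<close>

lemma sum_prod_vec_le:
  fixes f :: "'d::finite \<Rightarrow> 'k \<Rightarrow> real"
  assumes K: "finite K" and f: "\<And>i k. f i k \<ge> 0" and b: "\<And>i L. finite L \<Longrightarrow> (\<Sum>k\<in>L. f i k) \<le> c i"
  shows "(\<Sum>k\<in>K. \<Prod>i\<in>UNIV. f i (k $ i)) \<le> (\<Prod>i\<in>UNIV. c i)"
proof -
  define L where "L i = (\<lambda>k. k $ i) ` K" for i
  have L: "finite (L i)" for i using K by (simp add: L_def)
  have "(\<Sum>k\<in>K. \<Prod>i\<in>UNIV. f i (k $ i)) = (\<Sum>g\<in>vec_nth ` K. \<Prod>i\<in>UNIV. f i (g i))"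
    by (subst sum.reindex) (auto simp: inj_on_def vec_nth_inject)
  also have "\<dots> \<le> (\<Sum>g\<in>PiE UNIV L. \<Prod>i\<in>UNIV. f i (g i))"
    by (rule sum_mono2) (auto intro!: finite_PiE L prod_nonneg f simp: L_def)
  also have "\<dots> = (\<Prod>i\<in>UNIV. \<Sum>k\<in>L i. f i k)"
    by (rule prod_sum_PiE[symmetric]) (auto simp: L)
  also have "\<dots> \<le> (\<Prod>i\<in>UNIV. c i)"
    by (rule prod_mono) (auto intro!: sum_nonneg f b L)
  finally show ?thesis .
qed

section \<open>Functions with equal Gaussian means\<close>

text \<open>Jensen's inequality for finite sums, with the weights \<open>W l\<close> and the
  normalised terms \<open>norm (a l k) / W l\<close>, whose p-th powers have a sum over
  \<open>k\<close> of at most 1.\<close>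

lemma minkowski_sum:
  fixes a :: "'l \<Rightarrow> 'k \<Rightarrow> 'b::real_normed_vector"
  assumes p: "p \<ge> 1" and K: "finite K" and L: "finite L" and W0: "\<And>l. l \<in> L \<Longrightarrow> W l \<ge> 0"
    and W: "\<And>l. l \<in> L \<Longrightarrow> (\<Sum>k\<in>K. norm (a l k) powr p) \<le> W l powr p"
  shows "(\<Sum>k\<in>K. norm (\<Sum>l\<in>L. a l k) powr p) \<le> (\<Sum>l\<in>L. W l) powr p"
proof -
  \<comment> \<open>Weights 0 must be dropped before the division; the corresponding terms vanish on
    \<open>K\<close>.\<close>
  define L' where "L' = {l\<in>L. W l > 0}"
  have L': "finite L'" using L by (simp add: L'_def)
  have zero: "a l k = 0" if "l \<in> L" "l \<notin> L'" "k \<in> K" for l k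
  proof -
    have "W l = 0" using that W0[of l] by (auto simp: L'_def)
    then have "(\<Sum>k\<in>K. norm (a l k) powr p) = 0"
      using W[OF that(1)] by (intro antisym sum_nonneg) auto
    then show ?thesis using K that by (subst (asm) sum_nonneg_eq_0_iff) auto
  qed
  have eq: "(\<Sum>l\<in>L. a l k) = (\<Sum>l\<in>L'. a l k)" if "k \<in> K" for k
    by (rule sum.mono_neutral_right) (use L zero that in \<open>auto simp: L'_def\<close>)
  have eqW: "(\<Sum>l\<in>L. W l) = (\<Sum>l\<in>L'. W l)"
    by (rule sum.mono_neutral_right) (use L W0 in \<open>force simp: L'_def\<close>)+
  show ?thesis
  proof (cases "L' = {}")
    case True
    have "(\<Sum>k\<in>K. norm (\<Sum>l\<in>L. a l k) powr p) = (\<Sum>k\<in>K. 0)"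
      using True p by (intro sum.cong refl) (simp add: eq)
    then show ?thesis by simp
  next
    case False
    let ?A = "\<Sum>l\<in>L'. W l"
    have A: "?A > 0" using False L' by (intro sum_pos) (auto simp: L'_def)
    have "norm (\<Sum>l\<in>L'. a l k) powr p \<le> ?A powr (p - 1) * (\<Sum>l\<in>L'. (norm (a l k) / W l) powr p * W l)" for k
    proof -
      have "norm (\<Sum>l\<in>L'. a l k) powr p \<le> (\<Sum>l\<in>L'. (norm (a l k) / W l) * W l) powr p"
      proof (rule powr_mono2)
        have "norm (\<Sum>l\<in>L'. a l k) \<le> (\<Sum>l\<in>L'. norm (a l k))" by (rule norm_sum)
        also have "\<dots> = (\<Sum>l\<in>L'. norm (a l k) / W l * W l)" by (rule sum.cong) (auto simp: L'_def)
        finally show "norm (\<Sum>l\<in>L'. a l k) \<le> (\<Sum>l\<in>L'. norm (a l k) / W l * W l)" .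
      qed (use p in auto)
      also have "\<dots> \<le> ?A powr (p - 1) * (\<Sum>l\<in>L'. (norm (a l k) / W l) powr p * W l)"
        \<comment> \<open>The absolute values provide nonnegativity at all indices, also outside
          \<open>L'\<close>.\<close>
        using integral_powr_le[of p "\<lambda>l. norm (a l k) / \<bar>W l\<bar>" "\<lambda>l. \<bar>W l\<bar>" "count_space L'" ?A] p A L'
        by (simp add: lebesgue_integral_count_space_finite integrable_count_space L'_def)
      finally show ?thesis .
    qed
    then have "(\<Sum>k\<in>K. norm (\<Sum>l\<in>L'. a l k) powr p) \<le> (\<Sum>k\<in>K. ?A powr (p - 1) * (\<Sum>l\<in>L'. (norm (a l k) / W l) powr p * W l))"
      by (rule sum_mono)
    also have "\<dots> = ?A powr (p - 1) * (\<Sum>l\<in>L'. \<Sum>k\<in>K. (norm (a l k) / W l) powr p * W l)"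
      by (subst sum.swap) (simp only: sum_distrib_left)
    also have "\<dots> \<le> ?A powr (p - 1) * (\<Sum>l\<in>L'. W l)"
    proof (intro mult_left_mono sum_mono)
      fix l assume l: "l \<in> L'"
      have "(\<Sum>k\<in>K. (norm (a l k) / W l) powr p * W l) = (\<Sum>k\<in>K. norm (a l k) powr p) / W l powr p * W l"
        using l by (simp add: L'_def powr_divide sum_distrib_right sum_divide_distrib)
      also have "\<dots> \<le> 1 * W l"
        using l W[of l] by (intro mult_right_mono) (auto simp: L'_def divide_le_eq)
      finally show "(\<Sum>k\<in>K. (norm (a l k) / W l) powr p * W l) \<le> W l" by simp
    qed auto
    also have "\<dots> = ?A powr p" using A powr_add[of ?A "p - 1" 1] by simp
    finally show ?thesis using eq eqW by simp
  qed
qed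

section \<open>Fourier integrals, and equality almost everywhere from averages\<close>

lemma continuous_fourier_integral:
  fixes G :: "'a::euclidean_space \<Rightarrow> complex"
  assumes G: "integrable lborel G"
  shows "continuous_on UNIV (\<lambda>x. LINT \<xi>|lborel. G \<xi> * iexp (\<xi> \<bullet> x))"
  unfolding continuous_on_sequentially comp_def
proof (intro allI impI ballI)
  fix x :: "nat \<Rightarrow> 'a" and a assume "(\<forall>n. x n \<in> UNIV) \<and> x \<longlonglongrightarrow> a"
  then have x: "x \<longlonglongrightarrow> a" by simp
  show "(\<lambda>n. LINT \<xi>|lborel. G \<xi> * iexp (\<xi> \<bullet> x n)) \<longlonglongrightarrow> (LINT \<xi>|lborel. G \<xi> * iexp (\<xi> \<bullet> a))"
  proof (rule integral_dominated_convergence[where w="\<lambda>\<xi>. norm (G \<xi>)"])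
    show "AE \<xi> in lborel. (\<lambda>n. G \<xi> * iexp (\<xi> \<bullet> x n)) \<longlonglongrightarrow> G \<xi> * iexp (\<xi> \<bullet> a)"
      by (intro AE_I2 tendsto_intros x)
    show "(\<lambda>\<xi>. G \<xi> * iexp (\<xi> \<bullet> a)) \<in> borel_measurable lborel"
         "(\<lambda>\<xi>. G \<xi> * iexp (\<xi> \<bullet> x n)) \<in> borel_measurable lborel" for n
      using borel_measurable_integrable[OF G] by measurable
  qed (use G in \<open>auto simp: norm_mult\<close>)
qed

lemma norm_fourier_integral_le:
  fixes G :: "'a::euclidean_space \<Rightarrow> complex"
  shows "norm (LINT \<xi>|lborel. G \<xi> * iexp (g \<xi>)) \<le> (LINT \<xi>|lborel. norm (G \<xi>))"
  by (rule order_trans[OF integral_norm_bound]) (simp add: norm_mult)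

text \<open>Off a negligible set, \<open>u x - v x\<close> is the limit of the averages of the
  difference over \<open>cbox x (x + h *\<^sub>R One)\<close>, all of which vanish. Integrability is
  asked on boxes only, since one of the functions will be merely bounded and continuous.\<close>

lemma AE_eq_if_cbox_integrals_eq:
  fixes u v :: "'a::euclidean_space \<Rightarrow> complex"
  assumes u: "\<And>a b. integrable lborel (\<lambda>x. indicator (cbox a b) x *\<^sub>R u x)"
    and v: "\<And>a b. integrable lborel (\<lambda>x. indicator (cbox a b) x *\<^sub>R v x)"
    and eq: "\<And>a b. (LINT x|lborel. indicator (cbox a b) x *\<^sub>R u x) = (LINT x|lborel. indicator (cbox a b) x *\<^sub>R v x)"
  shows "AE x in lebesgue. u x = v x"
proof -
  have hi: "((\<lambda>x. u x - v x) has_integral 0) (cbox a b)" for a b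
  proof -
    have "((\<lambda>x. indicator (cbox a b) x *\<^sub>R u x - indicator (cbox a b) x *\<^sub>R v x) has_integral
        (LINT x|lborel. indicator (cbox a b) x *\<^sub>R u x - indicator (cbox a b) x *\<^sub>R v x)) UNIV"
      by (rule has_integral_integral_lborel) (intro Bochner_Integration.integrable_diff u v)
    also have "(LINT x|lborel. indicator (cbox a b) x *\<^sub>R u x - indicator (cbox a b) x *\<^sub>R v x) = 0"
      by (subst Bochner_Integration.integral_diff[OF u v]) (simp add: eq)
    also have "(\<lambda>x. indicator (cbox a b) x *\<^sub>R u x - indicator (cbox a b) x *\<^sub>R v x) =
        (\<lambda>x. if x \<in> cbox a b then u x - v x else 0)"
      by (auto simp: fun_eq_iff indicator_def)
    finally show ?thesis by (subst (asm) has_integral_restrict_UNIV)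
  qed
  have int: "(\<lambda>x. u x - v x) integrable_on cbox a b" for a b
    using hi by (auto simp: integrable_on_def)
  obtain N where N: "negligible N"
    "\<And>x e. x \<notin> N \<Longrightarrow> 0 < e \<Longrightarrow> \<exists>d>0. \<forall>h. 0 < h \<and> h < d \<longrightarrow>
      norm (integral (cbox x (x + h *\<^sub>R One)) (\<lambda>x. u x - v x) /\<^sub>R h ^ DIM('a) - (u x - v x)) < e"
    by (rule integrable_ccontinuous_explicit[OF int]) (rule that)
  have "u x = v x" if "x \<notin> N" for x
  proof -
    have "norm (u x - v x) < e" if "e > 0" for e
    proof -
      obtain d where "d > 0" and d: "\<And>h. 0 < h \<Longrightarrow> h < d \<Longrightarrow>
          norm (integral (cbox x (x + h *\<^sub>R One)) (\<lambda>x. u x - v x) /\<^sub>R h ^ DIM('a) - (u x - v x)) < e"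
        using N(2)[OF \<open>x \<notin> N\<close> \<open>e > 0\<close>] by blast
      from d[of "d / 2"] \<open>d > 0\<close> show ?thesis by (simp add: integral_unique[OF hi] norm_minus_commute)
    qed
    then have "norm (u x - v x) \<le> 0" by (meson less_irrefl not_le)
    then show ?thesis by simp
  qed
  then have "{x. u x \<noteq> v x} \<subseteq> N" by auto
  then have "negligible {x. u x \<noteq> v x}" using N(1) negligible_subset by blast
  then show ?thesis
    by (simp add: negligible_iff_null_sets completion.AE_iff_null_sets eventually_ae_filter) (metis (mono_tags, lifting) order_refl)
qed

lemma integral_gauss_real: "(LINT x|lborel. gauss (x :: real ^ 'd)) = sqrt (2 * pi) ^ CARD('d)"
  using integral_gauss[where 'd='d] by (simp only: integral_complex_of_real of_real_eq_iff)

text \<open>The means of an integrable \<open>u\<close> need not converge pointwise, so Fubini's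
  theorem moves the averaging to the indicator of the box. The means \<open>T n\<close> of the
  indicator are bounded and converge off the frontier of the box, which is a null set; then
  \<open>u\<close> provides the majorant.\<close>

lemma gauss_mean_cbox:
  fixes u :: "real ^ 'd \<Rightarrow> complex"
  assumes u: "integrable lborel u" and e: "e \<longlonglongrightarrow> 0" "\<And>n. e n > 0"
  shows "(\<lambda>n. LINT x|lborel. (LINT z|lborel. u (x + e n *\<^sub>R z) * gauss z) * indicator (cbox a b) x)
    \<longlonglongrightarrow> sqrt (2 * pi) ^ CARD('d) * (LINT x|lborel. indicator (cbox a b) x *\<^sub>R u x)"
proof -
  have um[measurable]: "u \<in> borel_measurable borel" using borel_measurable_integrable[OF u] by simp
  \<comment> \<open>The shift is \<open>- e n\<close> because the averaging moves to the other
    variable; \<open>tendsto_gauss_mean\<close> allows either sign.\<close>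
  define T where "T n y = (LINT z|lborel. complex_of_real (gauss z * indicator (cbox a b) (y - e n *\<^sub>R z)))" for n and y :: "real ^ 'd"
  have ib: "integrable lborel (\<lambda>x. indicator (cbox a b) x :: complex)"
  proof -
    have "integrable lborel (\<lambda>x::real^'d. indicator (cbox a b) x *\<^sub>R (1::complex))"
      by (rule borel_integrable_compact) auto
    then show ?thesis by (simp add: scaleR_conv_of_real of_real_indicator)
  qed
  have mean: "(LINT z|lborel. u (x + e n *\<^sub>R z) * gauss z) = (LINT y|lborel. u y * gauss ((y - x) /\<^sub>R e n)) /\<^sub>R e n ^ CARD('d)" for n x
    using integral_lborel_affine[of "e n" "\<lambda>y. u y * gauss ((y - x) /\<^sub>R e n)" x] e(2)[of n]
    by simp
  have T: "(LINT x|lborel. complex_of_real (gauss ((y - x) /\<^sub>R e n)) * indicator (cbox a b) x) = e n ^ CARD('d) * T n y" for n and y :: "real ^ 'd"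
  proof -
    have "T n y = (LINT x|lborel. complex_of_real (gauss ((y - x) /\<^sub>R e n)) * indicator (cbox a b) x) /\<^sub>R \<bar>- e n\<bar> ^ DIM(real ^ 'd)"
      unfolding T_def using e(2)[of n]
      by (subst integral_lborel_affine[of "- e n" _ y, symmetric]) (auto simp: of_real_indicator)
    then show ?thesis using e(2)[of n] by (simp add: scaleR_conv_of_real)
  qed
  have "(LINT x|lborel. (LINT z|lborel. u (x + e n *\<^sub>R z) * gauss z) * indicator (cbox a b) x) = (LINT y|lborel. u y * T n y)" for n
  proof -
    have "(LINT x|lborel. (LINT z|lborel. u (x + e n *\<^sub>R z) * gauss z) * indicator (cbox a b) x)
       = (LINT x|lborel. inverse (complex_of_real (e n ^ CARD('d))) * ((LINT y|lborel. u y * gauss ((y - x) /\<^sub>R e n)) * indicator (cbox a b) x))"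
      unfolding mean by (simp add: scaleR_conv_of_real mult.assoc)
    also have "\<dots> = inverse (complex_of_real (e n ^ CARD('d))) * (LINT x|lborel. (LINT y|lborel. u y * gauss ((y - x) /\<^sub>R e n)) * indicator (cbox a b) x)"
      by (rule integral_mult_right_zero)
    also have "(LINT x|lborel. (LINT y|lborel. u y * gauss ((y - x) /\<^sub>R e n)) * indicator (cbox a b) x)
      = (LINT y|lborel. u y * (LINT x|lborel. complex_of_real (gauss ((y - x) /\<^sub>R e n)) * indicator (cbox a b) x))"
      by (rule integral_swap[OF u ib, of "\<lambda>y x. complex_of_real (gauss ((y - x) /\<^sub>R e n))"])
        (auto simp: gauss_le_1 abs_of_pos gauss_pos)
    also have "\<dots> = (LINT y|lborel. complex_of_real (e n ^ CARD('d)) * (u y * T n y))"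
      unfolding T by (simp add: mult_ac)
    also have "\<dots> = complex_of_real (e n ^ CARD('d)) * (LINT y|lborel. u y * T n y)"
      by (rule integral_mult_right_zero)
    finally show ?thesis using e(2)[of n] by simp
  qed
  moreover have "(\<lambda>n. LINT y|lborel. u y * T n y) \<longlonglongrightarrow> (LINT y|lborel. u y * (sqrt (2 * pi) ^ CARD('d) * indicator (cbox a b) y))"
  proof (rule integral_dominated_convergence[where w="\<lambda>y. norm (u y) * sqrt (2 * pi) ^ CARD('d)"])
    show "AE y in lborel. (\<lambda>n. u y * T n y) \<longlonglongrightarrow> u y * (sqrt (2 * pi) ^ CARD('d) * indicator (cbox a b) y)"
    proof -
      have "negligible (frontier (cbox a b))" by (rule negligible_convex_frontier) simp
      then have "frontier (cbox a b) \<in> null_sets lborel"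
        by (simp add: negligible_iff_null_sets null_sets_completion_iff)
      then have "AE y in lborel. y \<notin> frontier (cbox a b)"
        by (rule AE_not_in)
      then show ?thesis
      proof eventually_elim
        case (elim y)
        have *: "isCont (\<lambda>y. indicator (cbox a b) y :: real) y"
          using elim by (simp add: isCont_indicator)
        have "T n y = (LINT z|lborel. complex_of_real (indicator (cbox a b) (y + (- e n) *\<^sub>R z)) * gauss z)" for n
          unfolding T_def by (simp add: mult.commute)
        moreover have "(\<lambda>n. LINT z|lborel. complex_of_real (indicator (cbox a b) (y + (- e n) *\<^sub>R z)) * gauss z)
            \<longlonglongrightarrow> sqrt (2 * pi) ^ CARD('d) * complex_of_real (indicator (cbox a b) y)"
        proof (rule tendsto_gauss_mean[where B=1])
          show "(\<lambda>n. - e n) \<longlonglongrightarrow> 0" using tendsto_minus[OF e(1)] by simp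
          show "isCont (\<lambda>x. complex_of_real (indicator (cbox a b) x)) y" by (intro continuous_intros *)
        qed (auto simp: indicator_def)
        ultimately have "(\<lambda>n. T n y) \<longlonglongrightarrow> sqrt (2 * pi) ^ CARD('d) * complex_of_real (indicator (cbox a b) y)"
          by simp
        from tendsto_mult[OF tendsto_const[of "u y"] this] show ?case by (simp add: indicator_def)
      qed
    qed
    show "AE y in lborel. norm (u y * T n y) \<le> norm (u y) * sqrt (2 * pi) ^ CARD('d)" for n
    proof (rule AE_I2)
      fix y
      have "norm (T n y) \<le> (LINT z|lborel. norm (complex_of_real (gauss z * indicator (cbox a b) (y - e n *\<^sub>R z))))"
        unfolding T_def by (rule integral_norm_bound)
      also have "\<dots> \<le> (LINT z|lborel. gauss (z :: real ^ 'd))"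
        by (rule integral_mono_AE'[OF integrable_gauss]) (auto simp: indicator_def abs_of_pos gauss_pos less_imp_le)
      finally have "norm (T n y) \<le> sqrt (2 * pi) ^ CARD('d)" by (simp only: integral_gauss_real)
      then show "norm (u y * T n y) \<le> norm (u y) * sqrt (2 * pi) ^ CARD('d)"
        unfolding norm_mult by (intro mult_left_mono) auto
    qed
    have [measurable]: "T n \<in> borel_measurable borel" for n
      unfolding T_def by measurable
    show "(\<lambda>y. u y * T n y) \<in> borel_measurable lborel" for n by measurable
    show "integrable lborel (\<lambda>y. norm (u y) * sqrt (2 * pi) ^ CARD('d))"
      by (intro integrable_mult_left integrable_norm u)
  qed measurable
  moreover have "(LINT y|lborel. u y * (sqrt (2 * pi) ^ CARD('d) * indicator (cbox a b) y)) =
      sqrt (2 * pi) ^ CARD('d) * (LINT x|lborel. indicator (cbox a b) x *\<^sub>R u x)"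
  proof -
    have "(LINT y|lborel. u y * (sqrt (2 * pi) ^ CARD('d) * indicator (cbox a b) y)) =
        (LINT x|lborel. complex_of_real (sqrt (2 * pi) ^ CARD('d)) * (indicator (cbox a b) x *\<^sub>R u x))"
      by (intro Bochner_Integration.integral_cong refl) (simp add: indicator_def)
    then show ?thesis by (simp only: integral_mult_right_zero)
  qed
  ultimately show ?thesis by simp
qed

text \<open>Equal Gaussian means force equal integrals over boxes, and then Lebesgue differentiation applies.\<close>
lemma AE_eq_if_gauss_means_eq:
  fixes u g :: "real ^ 'd \<Rightarrow> complex"
  assumes u: "integrable lborel u" and g: "continuous_on UNIV g" "\<And>x. norm (g x) \<le> B"
    and eq: "\<And>e x. e > 0 \<Longrightarrow> (LINT z|lborel. u (x + e *\<^sub>R z) * gauss z) = (LINT z|lborel. g (x + e *\<^sub>R z) * gauss z)"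
  shows "AE x in lebesgue. u x = g x"
proof (rule AE_eq_if_cbox_integrals_eq)
  have um[measurable]: "u \<in> borel_measurable borel" using borel_measurable_integrable[OF u] by simp
  have gm[measurable]: "g \<in> borel_measurable borel" using g(1) by (rule borel_measurable_continuous_onI)
  show "integrable lborel (\<lambda>x. indicator (cbox a b) x *\<^sub>R u x)" for a b
    by (rule integrable_mult_indicator[OF _ u]) simp
  show "integrable lborel (\<lambda>x. indicator (cbox a b) x *\<^sub>R g x)" for a b
    by (rule borel_integrable_compact) (auto intro: continuous_on_subset[OF g(1)])
  fix a b :: "real ^ 'd"
  let ?s = "sqrt (2 * pi) ^ CARD('d)"
  define e where "e n = inverse (real (Suc n))" for n
  have e: "e \<longlonglongrightarrow> 0" "e n > 0" for n
    unfolding e_def by (rule LIMSEQ_inverse_real_of_nat) simp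
  have "B \<ge> 0" using norm_ge_zero g(2) by (rule order_trans)
  have gB: "norm (LINT z|lborel. g (x + e n *\<^sub>R z) * gauss z) \<le> B * ?s" for x n
  proof -
    have "norm (LINT z|lborel. g (x + e n *\<^sub>R z) * gauss z) \<le> (LINT z|lborel. norm (g (x + e n *\<^sub>R z) * gauss z))"
      by (rule integral_norm_bound)
    also have "\<dots> \<le> (LINT z|lborel. B * gauss (z :: real ^ 'd))"
      by (rule integral_mono_AE')
        (use g \<open>B \<ge> 0\<close> in \<open>auto simp: norm_mult abs_of_pos gauss_pos integrable_gauss less_imp_le intro!: AE_I2 mult_right_mono\<close>)
    finally show ?thesis by (simp add: integral_gauss_real)
  qed
  have "(\<lambda>n. LINT x|lborel. (LINT z|lborel. g (x + e n *\<^sub>R z) * gauss z) * indicator (cbox a b) x)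
      \<longlonglongrightarrow> (LINT x|lborel. (?s * g x) * indicator (cbox a b) x)"
  proof (rule integral_dominated_convergence[where w="\<lambda>x. B * ?s * indicator (cbox a b) x"])
    show "integrable lborel (\<lambda>x. B * ?s * indicator (cbox a b) x)"
      by (intro integrable_mult_right) (subst integrable_indicator_iff, simp_all add: emeasure_bounded_finite[OF bounded_cbox, simplified])
    show "AE x in lborel. norm ((LINT z|lborel. g (x + e n *\<^sub>R z) * gauss z) * indicator (cbox a b) x) \<le> B * ?s * indicator (cbox a b) x" for n
      using gB by (intro AE_I2) (simp add: indicator_def)
    have "(\<lambda>n. LINT z|lborel. g (x + e n *\<^sub>R z) * gauss z) \<longlonglongrightarrow> ?s * g x" for x
      by (rule tendsto_gauss_mean[OF gm g(2) _ e(1)]) (use g(1) in \<open>simp add: continuous_on_eq_continuous_at\<close>)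
    then show "AE x in lborel. (\<lambda>n. (LINT z|lborel. g (x + e n *\<^sub>R z) * gauss z) * indicator (cbox a b) x) \<longlonglongrightarrow> ?s * g x * indicator (cbox a b) x"
      by (intro AE_I2 tendsto_intros)
  qed measurable
  also have "(LINT x|lborel. (?s * g x) * indicator (cbox a b) x) = (LINT x|lborel. complex_of_real ?s * (indicator (cbox a b) x *\<^sub>R g x))"
    by (intro Bochner_Integration.integral_cong refl) (simp add: indicator_def)
  also have "\<dots> = ?s * (LINT x|lborel. indicator (cbox a b) x *\<^sub>R g x)"
    by (rule integral_mult_right_zero)
  finally have "(\<lambda>n. LINT x|lborel. (LINT z|lborel. u (x + e n *\<^sub>R z) * gauss z) * indicator (cbox a b) x)
      \<longlonglongrightarrow> ?s * (LINT x|lborel. indicator (cbox a b) x *\<^sub>R g x)"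
    by (simp only: eq[OF e(2)])
  with gauss_mean_cbox[OF u e, of a b]
  have "complex_of_real ?s * (LINT x|lborel. indicator (cbox a b) x *\<^sub>R u x) = ?s * (LINT x|lborel. indicator (cbox a b) x *\<^sub>R g x)"
    by (rule LIMSEQ_unique)
  then show "(LINT x|lborel. indicator (cbox a b) x *\<^sub>R u x) = (LINT x|lborel. indicator (cbox a b) x *\<^sub>R g x)"
    by simp
qed

text \<open>Uniqueness in the definite description: two continuous functions differ on an open set,
  and a negligible open set is empty.\<close>

lemma continuous_rep_eqI:
  assumes g: "continuous_on UNIV g" and AE: "AE x in lebesgue. g x = f x"
  shows "continuous_rep f = g"
  unfolding continuous_rep_def
proof (rule the_equality)
  fix h assume h: "continuous_on UNIV h \<and> (AE x in lebesgue. h x = f x)"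
  have "AE x in lebesgue. h x = g x" using AE conjunct2[OF h] by eventually_elim simp
  then have "{x. h x \<noteq> g x} \<in> null_sets lebesgue"
    by (subst (asm) completion.AE_iff_null_sets)
      (auto intro!: sets_completionI_sets borel_open open_Collect_neq g conjunct1[OF h])
  then have "negligible {x. h x \<noteq> g x}" by (simp add: negligible_iff_null_sets)
  moreover have "open {x. h x \<noteq> g x}" by (intro open_Collect_neq g conjunct1[OF h])
  ultimately have "{x. h x \<noteq> g x} = {}" using open_not_negligible by blast
  then show "h = g" by auto
qed (use assms in simp)

section \<open>Dyadic blocks\<close>

lemma decomposition_system_continuous:
  assumes "decomposition_system \<phi>"
  shows "continuous_on UNIV (\<phi> n)"
proof -
  have "nth_derivative 0 (\<phi> n) differentiable (at x)" for x
    using assms by (simp add: decomposition_system_def test_function_def)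
  then show ?thesis
    by (auto simp: nth_derivative_def intro!: continuous_at_imp_continuous_on differentiable_imp_continuous_within)
qed

lemma decomposition_system_support:
  assumes "decomposition_system \<phi>" "\<phi> n s \<noteq> 0"
  shows "\<bar>s\<bar> \<le> 2 ^ (n + 1)" and "n \<ge> 1 \<Longrightarrow> 2 ^ (n - 1) \<le> \<bar>s\<bar>"
proof -
  have s: "s \<in> closure {x. \<phi> n x \<noteq> 0}"
    using assms(2) closure_subset[of "{x. \<phi> n x \<noteq> 0}"] by auto
  show "\<bar>s\<bar> \<le> 2 ^ (n + 1)"
    using s assms unfolding decomposition_system_def by (cases "n = 0") (auto simp: subset_iff)
  show "2 ^ (n - 1) \<le> \<bar>s\<bar>" if "n \<ge> 1"
    using s assms that unfolding decomposition_system_def by (auto simp: subset_iff)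
qed

text \<open>At each point at most three of the functions with positive index are nonzero.\<close>
lemma decomposition_system_partial_sums_bounded:
  assumes D: "decomposition_system \<phi>"
  obtains M where "M \<ge> 0" "\<And>N t. norm (\<Sum>n\<le>N. \<phi> n t) \<le> M"
proof -
  have "bdd_above (range (\<lambda>(n, x). 2 ^ (n * 0) * norm (nth_derivative 0 (\<phi> n) x)))"
    using D[unfolded decomposition_system_def, THEN conjunct2, THEN conjunct2, THEN conjunct2, THEN conjunct1, rule_format, of 0] .
  then obtain B where B: "\<And>n x. norm (\<phi> n x) \<le> B"
    by (fastforce simp: bdd_above_def nth_derivative_def)
  have B0: "B \<ge> 0" using norm_ge_zero B by (rule order_trans)
  \<comment> \<open>The fourth term is that of index 0, whose support need not stay away from the
    origin.\<close>
  have "norm (\<Sum>n\<le>N. \<phi> n t) \<le> 4 * B" for N t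
  proof -
    define S where "S = {n. n \<le> N \<and> \<phi> n t \<noteq> 0 \<and> n \<ge> 1}"
    have fin: "finite S" by (simp add: S_def)
    have "card S \<le> 3"
    proof (cases "S = {}")
      case False
      define m where "m = Min S"
      have m: "m \<in> S" using False fin by (simp add: m_def)
      have "S \<subseteq> {m..m + 2}"
      proof
        fix n assume n: "n \<in> S"
        have "m \<le> n" using n fin by (simp add: m_def)
        have "(2::real) ^ (n - 1) \<le> 2 ^ (m + 1)"
          using decomposition_system_support(2)[OF D, of n t] decomposition_system_support(1)[OF D, of m t] n m
          by (force simp: S_def)
        then have "n - 1 \<le> m + 1" by (rule power_le_imp_le_exp[rotated]) simp
        with \<open>m \<le> n\<close> show "n \<in> {m..m + 2}" by auto
      qed
      then have "card S \<le> card {m..m + 2}" by (intro card_mono) auto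
      then show ?thesis by simp
    qed simp
    have "(\<Sum>n\<le>N. \<phi> n t) = (\<Sum>n\<in>insert 0 S. \<phi> n t)"
    proof (rule sum.mono_neutral_right)
      show "\<forall>i\<in>{..N} - insert 0 S. \<phi> i t = 0" by (auto simp: S_def)
    qed (auto simp: S_def)
    also have "norm \<dots> \<le> (\<Sum>n\<in>insert 0 S. B)"
      by (rule order_trans[OF norm_sum sum_mono]) (rule B)
    also have "\<dots> \<le> 4 * B"
      using \<open>card S \<le> 3\<close> B0 fin by (simp add: card_insert_if mult_right_mono)
    finally show ?thesis .
  qed
  then show ?thesis using that[of "4 * B"] B0 by auto
qed

text \<open>After division by \<open>2 ^ (l $ i)\<close> the \<open>i\<close>-th coordinate is at
  most 2 in modulus wherever \<open>G\<close> does not vanish, and \<open>b\<close> is 1 there. The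
  inverse transform of the dilated bump is \<open>2 ^ n * \<psi> (2 ^ n * t)\<close>, that is
  \<open>kern \<psi> n (-1) t\<close>.\<close>

lemma block_reproducing:
  fixes G :: "real ^ 'd \<Rightarrow> complex" and l :: "nat ^ 'd"
  assumes b: "continuous_on UNIV b" "\<And>s. norm (b s) \<le> C" "integrable lborel b" "\<And>s. \<bar>s\<bar> < 4 \<Longrightarrow> b s = 1"
    and k: "\<And>n j. integrable lborel (kern \<psi> n j)"
    and \<psi>: "\<And>t. \<psi> t = (LINT s|lborel. b s * iexp (s * t)) / (2 * pi)"
    and G: "integrable lborel G" "\<And>\<xi> i. G \<xi> \<noteq> 0 \<Longrightarrow> \<bar>\<xi> $ i\<bar> \<le> 2 ^ (l $ i + 1)"
  shows "(\<lambda>x. LINT \<xi>|lborel. G \<xi> * iexp (\<xi> \<bullet> x)) =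
    conv (\<lambda>x. LINT \<xi>|lborel. G \<xi> * iexp (\<xi> \<bullet> x)) (\<lambda>i. kern \<psi> (l $ i) (-1))"
proof
  fix x
  have bm[measurable]: "b \<in> borel_measurable borel" using b(1) by (rule borel_measurable_continuous_onI)
  have C: "C \<ge> 0" using norm_ge_zero b(2) by (rule order_trans)
  define \<Phi> :: "real ^ 'd \<Rightarrow> complex" where "\<Phi> \<xi> = (\<Prod>i\<in>UNIV. b (inverse (2 ^ (l $ i)) * \<xi> $ i))" for \<xi>
  let ?\<Psi> = "\<lambda>x. (LINT \<xi>|lborel. \<Phi> \<xi> * iexp (\<xi> \<bullet> x)) / (2 * pi) ^ CARD('d)"
  have ib: "integrable lborel (\<lambda>s. b (inverse (2 ^ n) * s))" for n :: nat
    using lborel_integrable_real_affine[OF b(3), of "inverse (2 ^ n)" 0] by simp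
  have \<Psi>: "?\<Psi> x = (\<Prod>i\<in>UNIV. kern \<psi> (l $ i) (-1) (x $ i))" for x :: "real ^ 'd"
  proof -
    have 1: "(LINT s|lborel. b (inverse (2 ^ n) * s) * iexp (s * t)) = 2 * pi * kern \<psi> n (-1) t" for n t
    proof -
      have "(LINT s|lborel. b s * iexp (s * (2 ^ n * t))) = \<bar>inverse (2 ^ n)\<bar> *\<^sub>R (LINT s|lborel. b (0 + inverse (2 ^ n) * s) * iexp ((0 + inverse (2 ^ n) * s) * (2 ^ n * t)))"
        by (rule lborel_integral_real_affine) simp
      also have "(\<lambda>s. b (0 + inverse (2 ^ n) * s) * iexp ((0 + inverse (2 ^ n) * s) * (2 ^ n * t))) = (\<lambda>s. b (inverse (2 ^ n) * s) * iexp (s * t))"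
      proof
        fix s :: real
        have "(0 + inverse (2 ^ n) * s) * (2 ^ n * t) = s * t" by simp
        then show "b (0 + inverse (2 ^ n) * s) * iexp ((0 + inverse (2 ^ n) * s) * (2 ^ n * t)) = b (inverse (2 ^ n) * s) * iexp (s * t)"
          by (simp only: add_0)
      qed
      finally have "(LINT s|lborel. b (inverse (2 ^ n) * s) * iexp (s * t)) = 2 ^ n * (LINT s|lborel. b s * iexp (s * (2 ^ n * t)))"
        by (simp add: scaleR_conv_of_real)
      also have "\<dots> = 2 ^ n * (2 * pi * \<psi> (2 ^ n * t))" by (simp add: \<psi>)
      finally show ?thesis by (simp add: kern_def)
    qed
    have "\<Phi> \<xi> * iexp (\<xi> \<bullet> x) = (\<Prod>i\<in>UNIV. b (inverse (2 ^ (l $ i)) * \<xi> $ i) * iexp (\<xi> $ i * x $ i))" for \<xi>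
      by (simp add: \<Phi>_def prod.distrib inner_vec_def sum_distrib_left exp_sum)
    then have "(LINT \<xi>|lborel. \<Phi> \<xi> * iexp (\<xi> \<bullet> x)) = (LINT \<xi>|lborel. (\<Prod>i\<in>UNIV. b (inverse (2 ^ (l $ i)) * (\<xi> :: real ^ 'd) $ i) * iexp (\<xi> $ i * x $ i)))"
      by (simp only:)
    also have "\<dots> = (\<Prod>i\<in>UNIV. (LINT s|lborel. b (inverse (2 ^ (l $ i)) * s) * iexp (s * x $ i)))"
      by (rule integral_prod_vec[where f="\<lambda>i s. b (inverse (2 ^ (l $ i)) * s) * iexp (s * x $ i)"])
        (intro integrable_iexp_mult ib, measurable)
    also have "\<dots> = (2 * pi) ^ CARD('d) * (\<Prod>i\<in>UNIV. kern \<psi> (l $ i) (-1) (x $ i))"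
      by (simp only: 1 prod.distrib prod_constant of_real_power)
    finally show ?thesis by simp
  qed
  have "(LINT \<xi>|lborel. G \<xi> * iexp (\<xi> \<bullet> x)) = (LINT y|lborel. (LINT \<xi>|lborel. G \<xi> * iexp (\<xi> \<bullet> y)) * ?\<Psi> (x - y))"
  proof (rule reproducing_formula[OF G(1), where B="C ^ CARD('d)"])
    show "integrable lborel \<Phi>" unfolding \<Phi>_def by (rule integrable_prod_vec) (rule ib)
    show "norm (\<Phi> \<xi>) \<le> C ^ CARD('d)" for \<xi>
      unfolding \<Phi>_def prod_norm[symmetric]
      using prod_mono[of UNIV "\<lambda>i. norm (b (inverse (2 ^ (l $ i)) * \<xi> $ i))" "\<lambda>_. C"] b(2) by simp
    show "isCont \<Phi> \<xi>" for \<xi>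
    proof -
      have "continuous_on UNIV (\<lambda>\<xi>::real^'d. b (inverse (2 ^ (l $ i)) * \<xi> $ i))" for i
        by (rule continuous_on_compose2[OF b(1)]) (auto intro!: continuous_intros)
      then have "continuous_on UNIV \<Phi>" unfolding \<Phi>_def by (rule continuous_on_prod)
      then show ?thesis by (simp add: continuous_on_eq_continuous_at)
    qed
    have "integrable lborel (\<lambda>x::real^'d. \<Prod>i\<in>UNIV. kern \<psi> (l $ i) (-1) (x $ i))"
      by (rule integrable_prod_vec) (rule k)
    then show "integrable lborel ?\<Psi>" by (simp only: \<Psi>)
    show "G \<xi> * \<Phi> \<xi> = G \<xi>" for \<xi>
    proof (cases "G \<xi> = 0")
      case False
      have "b (inverse (2 ^ (l $ i)) * \<xi> $ i) = 1" for i
      proof (rule b(4))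
        have "inverse (2 ^ (l $ i)) * \<bar>\<xi> $ i\<bar> \<le> inverse (2 ^ (l $ i)) * 2 ^ (l $ i + 1)"
          using G(2)[OF False, of i] by (intro mult_left_mono) auto
        also have "\<dots> = 2" by simp
        finally show "\<bar>inverse (2 ^ (l $ i)) * \<xi> $ i\<bar> < 4" by (simp add: abs_mult)
      qed
      then show ?thesis by (simp add: \<Phi>_def)
    qed simp
  qed
  then show "(LINT \<xi>|lborel. G \<xi> * iexp (\<xi> \<bullet> x)) = conv (\<lambda>x. LINT \<xi>|lborel. G \<xi> * iexp (\<xi> \<bullet> x)) (\<lambda>i. kern \<psi> (l $ i) (-1)) x"
    unfolding conv_def by (simp only: \<Psi> vector_minus_component)
qed

text \<open>The spaces and their transforms are defined with Lebesgue measure, while Fubini's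
  theorem and the product structure are used for Borel measurable functions.\<close>

lemma lebesgue_integrable_imp_lborel:
  fixes f :: "'a::euclidean_space \<Rightarrow> complex"
  assumes f: "integrable lebesgue f"
  obtains u where "integrable lborel u" "AE x in lebesgue. u x = f x"
proof -
  have fm: "f \<in> borel_measurable lebesgue" using f by simp
  have Rm: "(\<lambda>x. Re (f x)) \<in> borel_measurable lebesgue" and Im: "(\<lambda>x. Im (f x)) \<in> borel_measurable lebesgue"
    using fm by measurable
  obtain r where r[measurable]: "r \<in> borel_measurable lborel" "AE x in lborel. Re (f x) = r x"
    using completion_ex_borel_measurable_real[OF Rm] by blast
  obtain s where s[measurable]: "s \<in> borel_measurable lborel" "AE x in lborel. Im (f x) = s x"
    using completion_ex_borel_measurable_real[OF Im] by blast
  have AE: "AE x in lborel. Complex (r x) (s x) = f x"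
    using r(2) s(2) by eventually_elim (simp add: complex_eq_iff)
  then have AE': "AE x in lebesgue. Complex (r x) (s x) = f x" by (rule AE_completion)
  have m[measurable]: "(\<lambda>x. Complex (r x) (s x)) \<in> borel_measurable lborel"
    unfolding Complex_eq by measurable
  have "integrable lebesgue (\<lambda>x. Complex (r x) (s x))"
    by (rule integrable_cong_AE_imp[OF f]) (use AE' in \<open>auto intro: measurable_completion\<close>)
  then have "integrable lborel (\<lambda>x. Complex (r x) (s x))"
    by (subst (asm) integrable_completion) simp_all
  then show ?thesis using AE' by (rule that)
qed


lemma fourier_eq_lborel:
  fixes f u :: "real ^ 'd \<Rightarrow> complex"
  assumes u: "integrable lborel u" and AE: "AE x in lebesgue. u x = f x" and f: "integrable lebesgue f"
  shows "fourier f \<xi> = (2 * pi) powr (- real CARD('d) / 2) * (LINT x|lborel. u x * iexp (- (\<xi> \<bullet> x)))"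
proof -
  have [measurable]: "u \<in> borel_measurable borel" using borel_measurable_integrable[OF u] by simp
  have m: "(\<lambda>x. u x * iexp (- (\<xi> \<bullet> x))) \<in> borel_measurable lborel" by measurable
  have "(\<lambda>x. iexp (- (\<xi> \<bullet> x))) \<in> borel_measurable lebesgue"
    by (rule measurable_completion) measurable
  then have m2: "(\<lambda>x. f x * iexp (- (\<xi> \<bullet> x))) \<in> borel_measurable lebesgue"
    using borel_measurable_integrable[OF f] by (intro borel_measurable_times)
  have "(LINT x|lebesgue. f x * iexp (- (\<xi> \<bullet> x))) = (LINT x|lebesgue. u x * iexp (- (\<xi> \<bullet> x)))"
    by (rule integral_cong_AE) (use AE m2 measurable_completion[OF m] in auto)
  also have "\<dots> = (LINT x|lborel. u x * iexp (- (\<xi> \<bullet> x)))" by (rule integral_completion[OF m])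
  finally show ?thesis unfolding fourier_def by simp
qed

section \<open>Coefficients of finite sums and of pointwise limits\<close>

lemma second_diff_fold_tendsto:
  fixes g :: "real ^ 'd \<Rightarrow> complex"
  assumes "\<And>x. (\<lambda>N. f N x) \<longlonglongrightarrow> g x"
  shows "(\<lambda>N. Finite_Set.fold (\<lambda>i. second_diff i (h i)) (f N) S x) \<longlonglongrightarrow> Finite_Set.fold (\<lambda>i. second_diff i (h i)) g S x"
  using finite[of S]
proof (induction S arbitrary: x rule: finite_induct)
  case (insert i S)
  interpret comp_fun_commute "\<lambda>i. second_diff i (h i)" by (rule comp_fun_commute_second_diff)
  show ?case
    unfolding fold_insert[OF insert(1,2)] second_diff_def[of i "h i"] by (intro tendsto_intros insert.IH)
qed (use assms in simp)

lemma second_diff_fold_sum: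
  fixes F :: "'l \<Rightarrow> real ^ 'd \<Rightarrow> complex"
  assumes "finite L"
  shows "Finite_Set.fold (\<lambda>i. second_diff i (h i)) (\<lambda>x. \<Sum>l\<in>L. F l x) S = (\<lambda>x. \<Sum>l\<in>L. Finite_Set.fold (\<lambda>i. second_diff i (h i)) (F l) S x)"
  using finite[of S]
proof (induction S rule: finite_induct)
  case (insert i S)
  interpret comp_fun_commute "\<lambda>i. second_diff i (h i)" by (rule comp_fun_commute_second_diff)
  show ?case
    unfolding fold_insert[OF insert(1,2)] insert.IH second_diff_def[of i "h i"]
    by (simp add: sum.distrib sum_subtractf sum_distrib_left)
qed simp

text \<open>A coefficient is a finite combination of point values, so pointwise convergence is
  enough.\<close>

lemma fs_coeff_tendsto:
  assumes "\<And>x. (\<lambda>N. f N x) \<longlonglongrightarrow> g x"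
  shows "(\<lambda>N. fs_coeff (f N) j k) \<longlonglongrightarrow> fs_coeff g j k"
  unfolding fs_coeff_def by (intro tendsto_intros second_diff_fold_tendsto assms)

lemma fs_coeff_sum:
  assumes "finite L"
  shows "fs_coeff (\<lambda>x. \<Sum>l\<in>L. F l x) j k = (\<Sum>l\<in>L. fs_coeff (F l) j k)"
  unfolding fs_coeff_def by (simp add: second_diff_fold_sum[OF assms] sum_distrib_left)

section \<open>Extended powers, and summation over cubes of indices\<close>

lemma epowr_1 [simp]: "x epowr 1 = x"
  by (cases x) (auto simp: epowr_def)

lemma epowr_ennreal: "r \<ge> 0 \<Longrightarrow> ennreal r epowr a = ennreal (r powr a)"
  by (simp add: epowr_def)

text \<open>Over a cube a sum of tensor products factorises into one-dimensional partial sums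
  (\<open>sum_cube_prod\<close>); at the same time the cubes absorb every finite index set
  (\<open>filterlim_cube\<close>), so limits along them agree with unordered sums.\<close>

definition cube :: "nat \<Rightarrow> (nat ^ 'd) set" where
  "cube N = {l. \<forall>i. l $ i \<le> N}"

lemma finite_cube: "finite (cube N :: (nat ^ 'd) set)"
proof (rule finite_subset)
  show "cube N \<subseteq> vec_lambda ` (PiE UNIV (\<lambda>_::'d. {..N}))"
  proof
    fix l :: "nat ^ 'd" assume "l \<in> cube N"
    then show "l \<in> vec_lambda ` (PiE UNIV (\<lambda>_::'d. {..N}))"
      by (intro image_eqI[of _ _ "vec_nth l"]) (auto simp: cube_def)
  qed
qed (auto intro!: finite_PiE)

lemma sum_cube_prod:
  fixes f :: "'d::finite \<Rightarrow> nat \<Rightarrow> complex"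
  shows "(\<Sum>l\<in>cube N. \<Prod>i\<in>UNIV. f i (l $ i)) = (\<Prod>i\<in>UNIV. \<Sum>n\<le>N. f i n)"
proof -
  have "(\<Prod>i\<in>UNIV. \<Sum>n\<le>N. f i n) = (\<Sum>g\<in>PiE UNIV (\<lambda>_. {..N}). \<Prod>i\<in>UNIV. f i (g i))"
    by (rule prod_sum_PiE) auto
  also have "PiE UNIV (\<lambda>_::'d. {..N}) = vec_nth ` cube N"
  proof (intro set_eqI iffI)
    fix g :: "'d \<Rightarrow> nat" assume "g \<in> PiE UNIV (\<lambda>_. {..N})"
    then show "g \<in> vec_nth ` cube N"
      by (intro image_eqI[of _ _ "vec_lambda g"]) (auto simp: cube_def)
  qed (auto simp: cube_def)
  also have "(\<Sum>g\<in>vec_nth ` cube N. \<Prod>i\<in>UNIV. f i (g i)) = (\<Sum>l\<in>cube N. \<Prod>i\<in>UNIV. f i (l $ i))"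
    by (subst sum.reindex) (auto simp: inj_on_def vec_nth_inject)
  finally show ?thesis ..
qed

lemma filterlim_cube: "filterlim (cube :: nat \<Rightarrow> (nat ^ 'd) set) (finite_subsets_at_top UNIV) sequentially"
  unfolding filterlim_finite_subsets_at_top
proof (intro allI impI)
  fix X :: "(nat ^ 'd) set" assume X: "finite X \<and> X \<subseteq> UNIV"
  have "X \<subseteq> cube N" if "N \<ge> (\<Sum>l\<in>X. \<Sum>i\<in>UNIV. l $ i)" for N
  proof
    fix l assume l: "l \<in> X"
    have "l $ i \<le> N" for i
    proof -
      have "l $ i \<le> (\<Sum>i\<in>UNIV. l $ i)" by (rule member_le_sum) auto
      also have "\<dots> \<le> (\<Sum>l\<in>X. \<Sum>i\<in>UNIV. l $ i)" using X l by (intro member_le_sum) auto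
      finally show ?thesis using that by simp
    qed
    then show "l \<in> cube N" by (simp add: cube_def)
  qed
  then show "\<forall>\<^sub>F N in sequentially. finite (cube N) \<and> X \<subseteq> cube N \<and> cube N \<subseteq> UNIV"
    using finite_cube by (auto simp: eventually_sequentially)
qed

section \<open>From one block to the whole function\<close>

lemma integrable_prod_decomposition_system:
  assumes "decomposition_system \<phi>"
  shows "integrable lborel (\<lambda>\<xi>::real^'d. \<Prod>i\<in>UNIV. \<phi> (l $ i) (\<xi> $ i))"
proof (rule integrable_prod_vec)
  fix i
  let ?n = "l $ i"
  have "integrable lborel (\<lambda>s. indicator {-(2 ^ (?n + 1))..2 ^ (?n + 1)} s *\<^sub>R \<phi> ?n s)"
    by (rule borel_integrable_compact)
      (auto intro: continuous_on_subset[OF decomposition_system_continuous[OF assms]])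
  also have "(\<lambda>s. indicator {-(2 ^ (?n + 1))..2 ^ (?n + 1)} s *\<^sub>R \<phi> ?n s) = \<phi> ?n"
    using decomposition_system_support(1)[OF assms, of ?n] by (fastforce simp: fun_eq_iff indicator_def abs_le_iff)
  finally show "integrable lborel (\<phi> ?n)" .
qed

text \<open>\<open>W\<close> stands for 2^(|l|/p) times the p-norm of \<open>F\<close>, prescribed
  through its p-th power to avoid roots. Both conclusions are instances of
  \<open>conv_sample_le\<close>: the first on the grid of level \<open>j\<close> with the kernels of
  that level, the second at the single point \<open>x\<close> with the kernels of level -1, which
  reproduce \<open>F\<close> itself.\<close>

lemma block_estimates:
  fixes F :: "real ^ 'd \<Rightarrow> complex" and l :: "nat ^ 'd"
  assumes p: "p \<ge> 1" and A: "A > 0" "\<And>n j. (LINT t|lborel. norm (kern \<psi> n j t)) \<le> A"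
      "\<And>n j K y. j \<ge> -1 \<Longrightarrow> finite K \<Longrightarrow>
        (\<Sum>k\<in>K. norm (kern \<psi> n j (2 powi (- max j 0) * of_int k - y))) \<le> A * 2 ^ n"
    and k: "\<And>n j. integrable lborel (kern \<psi> n j)"
    and F: "F \<in> borel_measurable borel" "\<And>x. norm (F x) \<le> B" and Fp: "integrable lborel (\<lambda>x. norm (F x) powr p)"
    and rep: "F = conv F (\<lambda>i. kern \<psi> (l $ i) (-1))"
    and W: "W \<ge> 0" "W powr p = 2 ^ (\<Sum>i\<in>UNIV. l $ i) * (LINT x|lborel. norm (F x) powr p)"
  shows "j \<in> levels \<Longrightarrow> finite K \<Longrightarrow> (\<Sum>k\<in>K. norm (fs_coeff F j k) powr p) \<le> (A ^ CARD('d) * W) powr p"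
    and "norm (F x) \<le> A ^ CARD('d) * W"
proof -
  have const: "(A ^ CARD('d)) powr (p - 1) * ((\<Prod>i\<in>UNIV. A * 2 ^ (l $ i)) * (LINT y|lborel. norm (F y) powr p))
      = (A ^ CARD('d) * W) powr p"
  proof -
    have "(A ^ CARD('d)) powr (p - 1) * A ^ CARD('d) = (A ^ CARD('d)) powr p"
      using A(1) powr_add[of "A ^ CARD('d)" "p - 1" 1] by simp
    then show ?thesis
      using A(1) W by (simp add: powr_mult prod.distrib power_sum mult_ac)
  qed
  show "(\<Sum>k\<in>K. norm (fs_coeff F j k) powr p) \<le> (A ^ CARD('d) * W) powr p" if j: "j \<in> levels" and K: "finite K"
  proof -
    have "(\<Sum>k\<in>K. norm (fs_coeff F j k) powr p) = (\<Sum>k\<in>K. norm (conv F (\<lambda>i. kern \<psi> (l $ i) (j $ i)) (dyadic_point j k)) powr p)"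
      by (simp only: fs_coeff_conv[OF F k rep])
    also have "\<dots> \<le> (A ^ CARD('d)) powr (p - 1) * ((\<Prod>i\<in>UNIV. A * 2 ^ (l $ i)) * (LINT y|lborel. norm (F y) powr p))"
    proof (rule conv_sample_le[OF p F Fp k A(2) A(1) K])
      fix y :: "real ^ 'd"
      show "(\<Sum>k\<in>K. \<Prod>i\<in>UNIV. norm (kern \<psi> (l $ i) (j $ i) (dyadic_point j k $ i - y $ i))) \<le> (\<Prod>i\<in>UNIV. A * 2 ^ (l $ i))"
        unfolding dyadic_point_def vec_lambda_beta
        by (rule sum_prod_vec_le[OF K, where f="\<lambda>i m. norm (kern \<psi> (l $ i) (j $ i) (2 powi (- max (j $ i) 0) * of_int m - y $ i))"])
          (use j A(3) in \<open>auto simp: levels_def\<close>)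
    qed
    finally show ?thesis unfolding const .
  qed
  show "norm (F x) \<le> A ^ CARD('d) * W"
  proof -
    \<comment> \<open>This is the sum over the grid reduced to \<open>k = 0\<close> at level -1,
      with \<open>y = - t\<close>.\<close>
    have kb: "norm (kern \<psi> n (-1) t) \<le> A * 2 ^ n" for n t
      using A(3)[of "-1" "{0}" n "- t"] by simp
    have "(\<Sum>k\<in>{()}. norm (conv F (\<lambda>i. kern \<psi> (l $ i) (-1)) x) powr p) \<le> (A ^ CARD('d)) powr (p - 1) * ((\<Prod>i\<in>UNIV. A * 2 ^ (l $ i)) * (LINT y|lborel. norm (F y) powr p))"
    proof (rule conv_sample_le[OF p F Fp k A(2) A(1)])
      show "(\<Sum>k\<in>{()}. \<Prod>i\<in>UNIV. norm (kern \<psi> (l $ i) (-1) (x $ i - y $ i))) \<le> (\<Prod>i\<in>UNIV. A * 2 ^ (l $ i))" for y :: "real ^ 'd"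
        by (simp, rule prod_mono) (use kb in auto)
    qed simp
    then have le: "norm (F x) powr p \<le> (A ^ CARD('d) * W) powr p"
      unfolding const using rep by simp
    show ?thesis
    proof (rule ccontr)
      assume "\<not> ?thesis"
      then have "(A ^ CARD('d) * W) powr p < norm (F x) powr p"
        using A(1) W p by (intro powr_less_mono2) auto
      with le show False by simp
    qed
  qed
qed

text \<open>Over a cube of indices, the tensor products of the \<open>\<phi> n\<close> sum to the product of the one-dimensional
  partial sums, which is bounded and tends to 1; so dominated convergence applies on the Fourier side.\<close>
lemma gauss_mean_blocks_tendsto:
  fixes u fh :: "real ^ 'd \<Rightarrow> complex" and G :: "nat ^ 'd \<Rightarrow> real ^ 'd \<Rightarrow> complex"
  assumes D: "decomposition_system \<phi>" and u: "integrable lborel u" and e: "e > 0"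
  defines "fh \<equiv> \<lambda>\<xi>. LINT y|lborel. u y * iexp (- (\<xi> \<bullet> y))"
  defines "G \<equiv> \<lambda>l \<xi>. inverse ((2 * pi) ^ CARD('d)) * ((\<Prod>i\<in>UNIV. \<phi> (l $ i) (\<xi> $ i)) * fh \<xi>)"
  assumes G: "\<And>l. integrable lborel (G l)"
  shows "(\<lambda>N. LINT z|lborel. (\<Sum>l\<in>cube N. LINT \<xi>|lborel. G l \<xi> * iexp (\<xi> \<bullet> (x + e *\<^sub>R z))) * gauss z)
    \<longlonglongrightarrow> (LINT z|lborel. u (x + e *\<^sub>R z) * gauss z)"
proof -
  let ?s = "complex_of_real (sqrt (2 * pi) ^ CARD('d))" and ?c = "complex_of_real (inverse ((2 * pi) ^ CARD('d)))"
  define E where "E \<xi> = iexp (\<xi> \<bullet> x) * complex_of_real (gauss (e *\<^sub>R \<xi>))" for \<xi> :: "real ^ 'd"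
  obtain M where M: "M \<ge> 0" "\<And>N t. norm (\<Sum>n\<le>N. \<phi> n t) \<le> M"
    using decomposition_system_partial_sums_bounded[OF D] by blast
  have [measurable]: "\<phi> n \<in> borel_measurable borel" for n
    by (rule borel_measurable_continuous_onI[OF decomposition_system_continuous[OF D]])
  have [measurable]: "u \<in> borel_measurable borel" using borel_measurable_integrable[OF u] by simp
  have fhm[measurable]: "fh \<in> borel_measurable borel" unfolding fh_def by measurable
  have fhb: "norm (fh \<xi>) \<le> (LINT y|lborel. norm (u y))" for \<xi>
    unfolding fh_def by (rule norm_fourier_integral_le)
  have Em[measurable]: "E \<in> borel_measurable borel" unfolding E_def by measurable
  have E: "integrable lborel E"
  proof (rule Bochner_Integration.integrable_bound)
    show "integrable lborel (\<lambda>\<xi>::real^'d. gauss (0 + e *\<^sub>R \<xi>))"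
      using e integrable_gauss by (intro integrable_lborel_affine) auto
  qed (auto simp: E_def norm_mult)
  \<comment> \<open>\<open>fh\<close> is only bounded; the Gaussian in \<open>E\<close> makes the
    product integrable and so supplies the majorant for the limit over the cubes.\<close>
  have fhE: "integrable lborel (\<lambda>\<xi>. fh \<xi> * E \<xi>)"
    by (rule integrable_bounded_mult[OF _ fhb E]) measurable
  have cont: "continuous_on UNIV (\<lambda>x. LINT \<xi>|lborel. G l \<xi> * iexp (\<xi> \<bullet> x))" for l
    by (rule continuous_fourier_integral[OF G])
  have GE: "integrable lborel (\<lambda>\<xi>. G l \<xi> * E \<xi>)" for l
  proof (rule Bochner_Integration.integrable_bound[OF G[of l]])
    show "(\<lambda>\<xi>. G l \<xi> * E \<xi>) \<in> borel_measurable lborel"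
      using borel_measurable_integrable[OF G[of l]] by measurable
    show "AE \<xi> in lborel. norm (G l \<xi> * E \<xi>) \<le> norm (G l \<xi>)"
      by (intro AE_I2) (simp add: E_def norm_mult abs_of_pos gauss_pos gauss_le_1 mult_left_le)
  qed
  have mean: "(LINT z|lborel. (\<Sum>l\<in>cube N. LINT \<xi>|lborel. G l \<xi> * iexp (\<xi> \<bullet> (x + e *\<^sub>R z))) * gauss z)
      = ?s * (LINT \<xi>|lborel. ?c * ((\<Prod>i\<in>UNIV. \<Sum>n\<le>N. \<phi> n (\<xi> $ i)) * (fh \<xi> * E \<xi>)))" for N
  proof -
    have int: "integrable lborel (\<lambda>z. (LINT \<xi>|lborel. G l \<xi> * iexp (\<xi> \<bullet> (x + e *\<^sub>R z))) * complex_of_real (gauss z))" for l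
    proof (rule integrable_bounded_mult[OF _ norm_fourier_integral_le])
      have "(\<lambda>x. LINT \<xi>|lborel. G l \<xi> * iexp (\<xi> \<bullet> x)) \<in> borel_measurable borel"
        using cont by (rule borel_measurable_continuous_onI)
      then show "(\<lambda>z. LINT \<xi>|lborel. G l \<xi> * iexp (\<xi> \<bullet> (x + e *\<^sub>R z))) \<in> borel_measurable lborel"
        by (rule measurable_compose[rotated]) measurable
    qed (intro integrable_of_real integrable_gauss)
    have "(LINT z|lborel. (\<Sum>l\<in>cube N. LINT \<xi>|lborel. G l \<xi> * iexp (\<xi> \<bullet> (x + e *\<^sub>R z))) * gauss z)
       = (\<Sum>l\<in>cube N. LINT z|lborel. (LINT \<xi>|lborel. G l \<xi> * iexp (\<xi> \<bullet> (x + e *\<^sub>R z))) * gauss z)"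
      by (subst Bochner_Integration.integral_sum[OF int, symmetric]) (simp only: sum_distrib_right)
    also have "\<dots> = (\<Sum>l\<in>cube N. ?s * (LINT \<xi>|lborel. G l \<xi> * E \<xi>))"
      unfolding gauss_mean_inverse_fourier[OF G] E_def ..
    also have "\<dots> = ?s * (LINT \<xi>|lborel. (\<Sum>l\<in>cube N. G l \<xi> * E \<xi>))"
      by (subst Bochner_Integration.integral_sum[OF GE]) (simp only: sum_distrib_left)
    also have "(\<lambda>\<xi>. \<Sum>l\<in>cube N. G l \<xi> * E \<xi>) = (\<lambda>\<xi>. ?c * ((\<Prod>i\<in>UNIV. \<Sum>n\<le>N. \<phi> n (\<xi> $ i)) * (fh \<xi> * E \<xi>)))"
      unfolding sum_cube_prod[symmetric] G_def by (simp add: sum_distrib_left sum_distrib_right mult_ac)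
    finally show ?thesis .
  qed
  have "(\<lambda>N. LINT \<xi>|lborel. ?c * ((\<Prod>i\<in>UNIV. \<Sum>n\<le>N. \<phi> n (\<xi> $ i)) * (fh \<xi> * E \<xi>)))
      \<longlonglongrightarrow> (LINT \<xi>|lborel. ?c * ((\<Prod>i\<in>(UNIV :: 'd set). 1) * (fh \<xi> * E \<xi>)))"
  proof (rule integral_dominated_convergence[where w="\<lambda>\<xi>. norm ?c * (M ^ CARD('d) * norm (fh \<xi> * E \<xi>))"])
    show "integrable lborel (\<lambda>\<xi>. norm ?c * (M ^ CARD('d) * norm (fh \<xi> * E \<xi>)))"
      by (intro integrable_mult_right integrable_norm fhE)
    have "(\<lambda>N. \<Sum>n\<le>N. \<phi> n t) \<longlonglongrightarrow> 1" for t
      using D unfolding decomposition_system_def sums_def_le by blast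
    then show "AE \<xi> in lborel. (\<lambda>N. ?c * ((\<Prod>i\<in>UNIV. \<Sum>n\<le>N. \<phi> n (\<xi> $ i)) * (fh \<xi> * E \<xi>))) \<longlonglongrightarrow> ?c * ((\<Prod>i\<in>(UNIV :: 'd set). 1) * (fh \<xi> * E \<xi>))"
      by (intro AE_I2 tendsto_mult tendsto_prod tendsto_const)
    show "AE \<xi> in lborel. norm (?c * ((\<Prod>i\<in>UNIV. \<Sum>n\<le>N. \<phi> n (\<xi> $ i)) * (fh \<xi> * E \<xi>))) \<le> norm ?c * (M ^ CARD('d) * norm (fh \<xi> * E \<xi>))" for N
    proof (rule AE_I2)
      fix \<xi> :: "real ^ 'd"
      have "norm (\<Prod>i\<in>UNIV. \<Sum>n\<le>N. \<phi> n (\<xi> $ i)) \<le> M ^ CARD('d)"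
        unfolding prod_norm[symmetric]
        using prod_mono[of UNIV "\<lambda>i. norm (\<Sum>n\<le>N. \<phi> n (\<xi> $ i))" "\<lambda>_. M"] M by simp
      then show "norm (?c * ((\<Prod>i\<in>UNIV. \<Sum>n\<le>N. \<phi> n (\<xi> $ i)) * (fh \<xi> * E \<xi>))) \<le> norm ?c * (M ^ CARD('d) * norm (fh \<xi> * E \<xi>))"
        unfolding norm_mult by (intro mult_left_mono mult_right_mono mult_nonneg_nonneg norm_ge_zero)
    qed
  qed measurable
  then have lim: "(\<lambda>N. LINT \<xi>|lborel. ?c * ((\<Prod>i\<in>UNIV. \<Sum>n\<le>N. \<phi> n (\<xi> $ i)) * (fh \<xi> * E \<xi>)))
      \<longlonglongrightarrow> ?c * (LINT \<xi>|lborel. fh \<xi> * E \<xi>)"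
    by (simp only: prod.neutral_const mult_1 integral_mult_right_zero)
  have "(LINT \<xi>|lborel. fh \<xi> * E \<xi>) = ?s * (LINT z|lborel. u (x + e *\<^sub>R z) * gauss z)"
    unfolding fh_def E_def by (rule fourier_gauss_summation[OF u e])
  \<comment> \<open>One \<open>?s\<close> comes from \<open>gauss_mean_inverse_fourier\<close>, the
    other from \<open>fourier_gauss_summation\<close>, and \<open>?c\<close> joins the normalising
    constants of the two transforms.\<close>
  moreover have "?s * (?c * (?s * w)) = w" for w
  proof -
    have "sqrt (2 * pi) ^ CARD('d) * sqrt (2 * pi) ^ CARD('d) = (2 * pi) ^ CARD('d)"
      by (subst power_mult_distrib[symmetric], subst real_sqrt_mult_self) simp
    then have "sqrt (2 * pi) ^ CARD('d) * sqrt (2 * pi) ^ CARD('d) * inverse ((2 * pi) ^ CARD('d)) = 1"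
      by (simp only:) (rule right_inverse, simp)
    then have "?s * ?s * ?c = 1" by (simp only: of_real_mult[symmetric] of_real_1)
    then show ?thesis by (metis mult.assoc mult.commute mult_1)
  qed
  ultimately have eq: "?s * (?c * (LINT \<xi>|lborel. fh \<xi> * E \<xi>)) = (LINT z|lborel. u (x + e *\<^sub>R z) * gauss z)"
    by simp
  show ?thesis
    using tendsto_mult[OF tendsto_const[of ?s] lim] unfolding mean eq .
qed

text \<open>Real numbers and finite sets \<open>K\<close> keep the estimate stable under the limit
  of the partial sums over cubes; the passage to the sum over all \<open>k\<close> is left to the
  end.\<close>

lemma faber_schauder_bound:
  fixes \<phi> :: "nat \<Rightarrow> real \<Rightarrow> complex" and p :: real
  assumes D: "decomposition_system \<phi>" and p: "1 \<le> p"
  obtains Q where "Q > 0" "\<And>(f :: real ^ 'd \<Rightarrow> complex) j K. f \<in> besov_space \<phi> (1 / p) p 1 \<Longrightarrow> j \<in> levels \<Longrightarrow> finite K \<Longrightarrow>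
    (\<Sum>k\<in>K. norm (fs_coeff (continuous_rep f) j k) powr p) \<le> (Q * enn2real (besov_norm \<phi> (1 / p) p 1 f)) powr p"
proof -
  obtain b b' b'' :: "real \<Rightarrow> complex" where b: "\<And>s. (b has_vector_derivative b' s) (at s)"
    "\<And>s. (b' has_vector_derivative b'' s) (at s)" "continuous_on UNIV b''"
    "\<And>s. \<bar>s\<bar> \<ge> 9 \<Longrightarrow> b s = 0 \<and> b' s = 0 \<and> b'' s = 0" "\<And>s. \<bar>s\<bar> < 4 \<Longrightarrow> b s = 1"
    by (rule bump_exists[OF D]) (rule that)
  define \<psi> where "\<psi> t = (LINT s|lborel. b s * iexp (s * t)) / (2 * pi)" for t
  obtain C where C: "C > 0" "\<And>s. norm (b s) \<le> C" "\<And>t. norm (\<psi> t) \<le> C / (1 + t\<^sup>2)"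
    "\<And>t h. 0 \<le> h \<Longrightarrow> h \<le> 1 \<Longrightarrow> norm (\<psi> (t + h) - \<psi> t) \<le> C * h / (1 + t\<^sup>2)"
    by (rule bump_kernel_bounds[where a=9, OF b(1-4), folded \<psi>_def]) (assumption, simp, rule that)
  have bc: "continuous_on UNIV b"
    using b(1) by (auto intro!: continuous_at_imp_continuous_on has_vector_derivative_continuous)
  have [measurable]: "b \<in> borel_measurable borel" using bc by (rule borel_measurable_continuous_onI)
  have ib: "integrable lborel b"
  proof -
    have "integrable lborel (\<lambda>s. indicator {-9..9} s *\<^sub>R b s)"
      by (rule borel_integrable_compact) (auto intro: continuous_on_subset[OF bc])
    also have "(\<lambda>s. indicator {-9..9} s *\<^sub>R b s) = b"
      using b(4) by (auto simp: fun_eq_iff indicator_def)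
    finally show ?thesis .
  qed
  have \<psi>m: "\<psi> \<in> borel_measurable borel" unfolding \<psi>_def by measurable
  note k = integrable_kern[OF \<psi>m C(3)]
  \<comment> \<open>One constant for both kernel bounds, so that the power p - 1 from Jensen's
    inequality and the first power from the grid combine to the power p.\<close>
  define A where "A = max (2 * (LINT t|lborel. norm (\<psi> t))) (12 * pi * C)"
  have A: "A > 0" using C(1) by (simp add: A_def less_max_iff_disj)
  have A1: "(LINT t|lborel. norm (kern \<psi> n j t)) \<le> A" for n j
    using integral_norm_kern[OF \<psi>m C(3), of n j] by (simp add: A_def)
  have A2: "(\<Sum>k\<in>K. norm (kern \<psi> n j (2 powi (- max j 0) * of_int k - y))) \<le> A * 2 ^ n"
    if "j \<ge> -1" "finite K" for n j K y
  proof -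
    have "12 * pi * C * 2 ^ n \<le> A * 2 ^ n" by (intro mult_right_mono) (auto simp: A_def)
    moreover have "(\<Sum>k\<in>K. norm (kern \<psi> n j (2 powi (- max j 0) * of_int k - y))) \<le> 12 * pi * C * 2 ^ n"
      by (rule kern_sum_bound[OF C(1,3) _ that]) (rule C(4))
    ultimately show ?thesis by linarith
  qed
  define Q where "Q = A ^ CARD('d)"
  have Q: "Q > 0" using A by (simp add: Q_def)
  have main: "(\<Sum>k\<in>K. norm (fs_coeff (continuous_rep f) j k) powr p) \<le> (Q * enn2real (besov_norm \<phi> (1 / p) p 1 f)) powr p"
    if f: "f \<in> besov_space \<phi> (1 / p) p 1" and j: "j \<in> levels" and K: "finite K" for f :: "real ^ 'd \<Rightarrow> complex" and j K
  proof -
    have fi: "integrable lebesgue f" and fin: "besov_norm \<phi> (1 / p) p 1 f < \<infinity>"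
      using f by (auto simp: besov_space_def)
    obtain u where u: "integrable lborel u" and AEu: "AE x in lebesgue. u x = f x"
      using lebesgue_integrable_imp_lborel[OF fi] .
    define c where "c = complex_of_real ((2 * pi) powr (- real CARD('d) / 2))"
    have c2: "c * c = inverse ((2 * pi) ^ CARD('d))"
    proof -
      have "(2 * pi) powr (- real CARD('d) / 2) * (2 * pi) powr (- real CARD('d) / 2) = inverse ((2 * pi) ^ CARD('d))"
        by (simp only: powr_add[symmetric]) (simp add: powr_minus powr_realpow)
      then show ?thesis unfolding c_def by (simp only: of_real_mult[symmetric])
    qed
    define fh where "fh \<xi> = (LINT y|lborel. u y * iexp (- (\<xi> \<bullet> y)))" for \<xi>
    \<comment> \<open>The factors \<open>c\<close> of the two transforms are merged here, which
      makes \<open>F l\<close> an integral without a constant in front.\<close>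
    define G where "G l \<xi> = inverse ((2 * pi) ^ CARD('d)) * ((\<Prod>i\<in>UNIV. \<phi> (l $ i) (\<xi> $ i)) * fh \<xi>)" for l :: "nat ^ 'd" and \<xi>
    define F where "F l x = (LINT \<xi>|lborel. G l \<xi> * iexp (\<xi> \<bullet> x))" for l x
    have [measurable]: "u \<in> borel_measurable borel" using borel_measurable_integrable[OF u] by simp
    have [measurable]: "\<phi> n \<in> borel_measurable borel" for n
      by (rule borel_measurable_continuous_onI[OF decomposition_system_continuous[OF D]])
    have [measurable]: "fh \<in> borel_measurable borel" unfolding fh_def by measurable
    have fhb: "norm (fh \<xi>) \<le> (LINT y|lborel. norm (u y))" for \<xi>
      unfolding fh_def by (rule norm_fourier_integral_le)
    have Gi: "integrable lborel (G l)" for l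
      unfolding G_def
      by (intro integrable_mult_right, subst mult.commute,
          rule integrable_bounded_mult[OF _ fhb integrable_prod_decomposition_system[OF D]]) measurable
    have Fc: "continuous_on UNIV (F l)" for l
      unfolding F_def by (rule continuous_fourier_integral[OF Gi])
    have Fm[measurable]: "F l \<in> borel_measurable borel" for l
      by (rule borel_measurable_continuous_onI[OF Fc])
    have Fb: "norm (F l x) \<le> (LINT \<xi>|lborel. norm (G l \<xi>))" for l x
      unfolding F_def by (rule norm_fourier_integral_le)
    have rep: "F l = conv (F l) (\<lambda>i. kern \<psi> (l $ i) (-1))" for l
      unfolding F_def
    proof (rule block_reproducing[OF bc C(2) ib _ k \<psi>_def Gi])
      show "b s = 1" if "\<bar>s\<bar> < 4" for s using that by (rule b(5))
    next
      fix \<xi> i assume "G l \<xi> \<noteq> 0"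
      then have "\<phi> (l $ i) (\<xi> $ i) \<noteq> 0" by (auto simp: G_def)
      then show "\<bar>\<xi> $ i\<bar> \<le> 2 ^ (l $ i + 1)" by (rule decomposition_system_support(1)[OF D])
    qed
    have block: "dyadic_block \<phi> f l = F l" for l
    proof
      fix x
      have m: "(\<lambda>\<xi>. ((\<Prod>i\<in>UNIV. \<phi> (l $ i) (\<xi> $ i)) * (c * fh \<xi>)) * iexp (\<xi> \<bullet> x)) \<in> borel_measurable lborel"
        by measurable
      have "dyadic_block \<phi> f l x = c * (LINT \<xi>|lebesgue. ((\<Prod>i\<in>UNIV. \<phi> (l $ i) (\<xi> $ i)) * (c * fh \<xi>)) * iexp (\<xi> \<bullet> x))"
        unfolding dyadic_block_def inverse_fourier_def fourier_eq_lborel[OF u AEu fi] fh_def c_def ..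
      also have "\<dots> = (LINT \<xi>|lborel. c * (((\<Prod>i\<in>UNIV. \<phi> (l $ i) (\<xi> $ i)) * (c * fh \<xi>)) * iexp (\<xi> \<bullet> x)))"
        by (simp only: integral_completion[OF m] integral_mult_right_zero)
      also have "\<dots> = (LINT \<xi>|lborel. (c * c) * ((\<Prod>i\<in>UNIV. \<phi> (l $ i) (\<xi> $ i)) * fh \<xi>) * iexp (\<xi> \<bullet> x))"
        by (simp only: mult_ac)
      also have "\<dots> = F l x" unfolding c2 F_def G_def by simp
      finally show "dyadic_block \<phi> f l x = F l x" .
    qed

    \<comment> \<open>The terms of the norm for \<open>q = 1\<close>. Since their sum is finite,
      each is a real number \<open>W l\<close>, and \<open>norm (F l x) powr p\<close> is
      integrable.\<close>
    define a where "a l = ennreal (2 powr (real (\<Sum>i\<in>UNIV. l $ i) * (1 / p))) * Lp_norm p (F l)" for l :: "nat ^ 'd"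
    define S where "S = enn2real (besov_norm \<phi> (1 / p) p 1 f)"
    have a_sum: "(\<Sum>\<^sub>\<infinity>l. a l) = ennreal S"
      using fin by (simp add: besov_norm_def a_def block S_def)
    have S0: "S \<ge> 0" by (simp add: S_def)
    have a_fin: "(\<Sum>l\<in>L. a l) \<le> ennreal S" if "finite L" for L
      unfolding a_sum[symmetric] by (subst nonneg_infsum_complete) (auto intro!: SUP_upper that)
    have a_top: "a l < \<infinity>" for l
      using a_fin[of "{l}"] by (simp add: le_less_trans)
    define W where "W l = enn2real (a l)" for l
    have W0: "W l \<ge> 0" for l by (simp add: W_def)
    have aW: "a l = ennreal (W l)" for l using a_top[of l] by (simp add: W_def)
    have W_sum: "(\<Sum>l\<in>L. W l) \<le> S" if "finite L" for L
      using a_fin[OF that] S0 W0 by (simp add: aW sum_ennreal)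
    have Fp: "integrable lborel (\<lambda>x. norm (F l x) powr p)"
      and Wp: "W l powr p = 2 ^ (\<Sum>i\<in>UNIV. l $ i) * (LINT x|lborel. norm (F l x) powr p)" for l
    proof -
      let ?n = "\<Sum>i\<in>UNIV. l $ i" and ?I = "LINT x|lborel. norm (F l x) powr p"
      have "Lp_norm p (F l) \<noteq> \<infinity>"
        using a_top[of l] by (auto simp: a_def ennreal_mult_top ennreal_mult_less_top)
      then have nn: "(\<integral>\<^sup>+ x. ennreal (norm (F l x) powr p) \<partial>lborel) \<noteq> \<infinity>"
        by (auto simp: Lp_norm_def epowr_def nn_integral_completion)
      show Fp: "integrable lborel (\<lambda>x. norm (F l x) powr p)"
        using nn by (intro integrableI_bounded) (auto simp: less_top)
      have I: "?I \<ge> 0" by (rule Bochner_Integration.integral_nonneg) simp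
      have "Lp_norm p (F l) = ennreal ?I epowr (1 / p)"
        unfolding Lp_norm_def nn_integral_completion by (subst nn_integral_eq_integral[OF Fp]) auto
      then have "W l = 2 powr (real ?n * (1 / p)) * ?I powr (1 / p)"
        using I by (simp add: W_def a_def epowr_ennreal ennreal_mult[symmetric])
      then show "W l powr p = 2 ^ ?n * ?I"
        using p I by (simp add: powr_mult powr_powr powr_realpow del: of_nat_sum)
    qed
    have est1: "(\<Sum>k\<in>K. norm (fs_coeff (F l) j k) powr p) \<le> (Q * W l) powr p" for l
      unfolding Q_def by (rule block_estimates(1)[OF p A A1 _ k Fm Fb Fp rep W0 Wp j K]) (rule A2)
    have est2: "norm (F l x) \<le> Q * W l" for l x
      unfolding Q_def by (rule block_estimates(2)[OF p A A1 _ k Fm Fb Fp rep W0 Wp]) (rule A2)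

    \<comment> \<open>Here the fine index 1 enters: the uniform bounds of the blocks are summable,
      as the Weierstrass test demands.\<close>
    have Wsummable: "(\<lambda>l. Q * W l) summable_on UNIV"
    proof (intro summable_on_cmult_right nonneg_bdd_above_summable_on)
      show "bdd_above (sum W ` {F. F \<subseteq> UNIV \<and> finite F})"
        using W_sum by (auto intro!: bdd_aboveI2)
    qed (use W0 in auto)
    define g where "g x = (\<Sum>\<^sub>\<infinity>l. F l x)" for x
    have ul: "uniform_limit UNIV (\<lambda>N x. \<Sum>l\<in>cube N. F l x) g sequentially"
      unfolding g_def
      by (rule filterlim_compose[OF Weierstrass_m_test_general[OF _ Wsummable] filterlim_cube]) (rule est2)
    have partial_cont: "continuous_on UNIV (\<lambda>x. \<Sum>l\<in>cube N. F l x)" for N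
      by (intro continuous_intros Fc)
    have gc: "continuous_on UNIV g"
      by (rule uniform_limit_theorem[OF _ ul]) (simp_all add: partial_cont)
    have glim: "(\<lambda>N. \<Sum>l\<in>cube N. F l x) \<longlonglongrightarrow> g x" for x
      using tendsto_uniform_limitI[OF ul] by simp
    have pb: "norm (\<Sum>l\<in>cube N. F l x) \<le> Q * S" for N x
    proof -
      have "norm (\<Sum>l\<in>cube N. F l x) \<le> (\<Sum>l\<in>cube N. Q * W l)"
        by (rule order_trans[OF norm_sum sum_mono]) (rule est2)
      also have "\<dots> = Q * (\<Sum>l\<in>cube N. W l)" by (simp only: sum_distrib_left)
      also have "\<dots> \<le> Q * S" using Q by (intro mult_left_mono W_sum finite_cube) auto
      finally show ?thesis .
    qed
    have gb: "norm (g x) \<le> Q * S" for x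
      by (rule LIMSEQ_le_const2[OF tendsto_norm[OF glim]]) (use pb in auto)
    have gm[measurable]: "g \<in> borel_measurable borel" by (rule borel_measurable_continuous_onI[OF gc])
    \<comment> \<open>The means of the partial sums converge to those of \<open>g\<close> by the
      bound \<open>pb\<close>, and to those of \<open>u\<close> on the Fourier side.\<close>
    have "AE x in lebesgue. u x = g x"
    proof (rule AE_eq_if_gauss_means_eq[OF u gc gb])
      fix e :: real and x :: "real ^ 'd" assume e: "e > 0"
      have "(\<lambda>N. LINT z|lborel. (\<Sum>l\<in>cube N. F l (x + e *\<^sub>R z)) * gauss z) \<longlonglongrightarrow> (LINT z|lborel. g (x + e *\<^sub>R z) * gauss z)"
      proof (rule integral_dominated_convergence[where w="\<lambda>z. Q * S * gauss z"])
        show "integrable lborel (\<lambda>z::real^'d. Q * S * gauss z)" by (intro integrable_mult_right integrable_gauss)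
        show "AE z in lborel. (\<lambda>N. (\<Sum>l\<in>cube N. F l (x + e *\<^sub>R z)) * gauss z) \<longlonglongrightarrow> g (x + e *\<^sub>R z) * gauss z"
          by (intro AE_I2 tendsto_intros glim)
        show "AE z in lborel. norm ((\<Sum>l\<in>cube N. F l (x + e *\<^sub>R z)) * complex_of_real (gauss z)) \<le> Q * S * gauss z" for N
          by (intro AE_I2) (simp add: norm_mult abs_of_pos gauss_pos pb mult_right_mono less_imp_le)
      qed measurable
      moreover have "(\<lambda>N. LINT z|lborel. (\<Sum>l\<in>cube N. F l (x + e *\<^sub>R z)) * gauss z) \<longlonglongrightarrow> (LINT z|lborel. u (x + e *\<^sub>R z) * gauss z)"
        using gauss_mean_blocks_tendsto[OF D u e, of x] Gi unfolding F_def G_def fh_def by simp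
      ultimately show "(LINT z|lborel. u (x + e *\<^sub>R z) * gauss z) = (LINT z|lborel. g (x + e *\<^sub>R z) * gauss z)"
        by (rule LIMSEQ_unique[rotated])
    qed
    then have "AE x in lebesgue. g x = f x" using AEu by eventually_elim simp
    then have cr: "continuous_rep f = g" by (rule continuous_rep_eqI[OF gc])

    \<comment> \<open>The blocks are added by Minkowski's inequality with the weights
      \<open>Q * W l\<close>; the bound does not depend on \<open>N\<close>, and for finite
      \<open>K\<close> it survives the pointwise limit.\<close>
    have "(\<Sum>k\<in>K. norm (fs_coeff (\<lambda>x. \<Sum>l\<in>cube N. F l x) j k) powr p) \<le> (Q * S) powr p" for N
    proof -
      have "(\<Sum>k\<in>K. norm (fs_coeff (\<lambda>x. \<Sum>l\<in>cube N. F l x) j k) powr p) = (\<Sum>k\<in>K. norm (\<Sum>l\<in>cube N. fs_coeff (F l) j k) powr p)"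
        by (simp only: fs_coeff_sum[OF finite_cube])
      also have "\<dots> \<le> (\<Sum>l\<in>cube N. Q * W l) powr p"
        by (rule minkowski_sum[OF p K finite_cube]) (use est1 Q W0 in auto)
      also have "(\<Sum>l\<in>cube N. Q * W l) = Q * (\<Sum>l\<in>cube N. W l)" by (simp only: sum_distrib_left)
      also have "(Q * (\<Sum>l\<in>cube N. W l)) powr p \<le> (Q * S) powr p"
        using Q p W0 by (intro powr_mono2 mult_left_mono W_sum finite_cube mult_nonneg_nonneg sum_nonneg) auto
      finally show ?thesis .
    qed
    moreover have "(\<lambda>N. \<Sum>k\<in>K. norm (fs_coeff (\<lambda>x. \<Sum>l\<in>cube N. F l x) j k) powr p) \<longlonglongrightarrow> (\<Sum>k\<in>K. norm (fs_coeff g j k) powr p)"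
      using p by (intro tendsto_sum tendsto_powr' tendsto_norm fs_coeff_tendsto glim tendsto_const) auto
    ultimately show ?thesis unfolding cr S_def[symmetric] by (intro LIMSEQ_le_const2) auto
  qed
  show ?thesis by (rule that[OF Q main])
qed

theorem proposition5p3:
  fixes \<phi> :: "nat \<Rightarrow> real \<Rightarrow> complex" and p :: real
  assumes "decomposition_system \<phi>" and "1 \<le> p"
  shows "\<exists>c::real. c > 0 \<and>
    (\<forall>f :: real ^ 'd \<Rightarrow> complex. f \<in> besov_space \<phi> (1 / p) p 1 \<longrightarrow>
      seq_norm (1 / p) p \<infinity> (fs_coeff (continuous_rep f)) =
        (SUP j\<in>levels. (\<Sum>\<^sub>\<infinity>k. ennreal (norm (fs_coeff (continuous_rep f) j k) powr p)) epowr (1 / p)) \<and>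
      (SUP j\<in>levels. (\<Sum>\<^sub>\<infinity>k. ennreal (norm (fs_coeff (continuous_rep f) j k) powr p)) epowr (1 / p))
        \<le> ennreal c * besov_norm \<phi> (1 / p) p 1 f)"
proof -
  obtain Q where Q: "Q > 0" "\<And>(f :: real ^ 'd \<Rightarrow> complex) j K. f \<in> besov_space \<phi> (1 / p) p 1 \<Longrightarrow> j \<in> levels \<Longrightarrow> finite K \<Longrightarrow>
    (\<Sum>k\<in>K. norm (fs_coeff (continuous_rep f) j k) powr p) \<le> (Q * enn2real (besov_norm \<phi> (1 / p) p 1 f)) powr p"
    using faber_schauder_bound[OF assms] by blast
  have "(SUP j\<in>levels. (\<Sum>\<^sub>\<infinity>k. ennreal (norm (fs_coeff (continuous_rep f) j k) powr p)) epowr (1 / p))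
        \<le> ennreal Q * besov_norm \<phi> (1 / p) p 1 f"
    if f: "f \<in> besov_space \<phi> (1 / p) p 1" for f :: "real ^ 'd \<Rightarrow> complex"
  proof (rule SUP_least)
    fix j :: "int ^ 'd" assume j: "j \<in> levels"
    let ?S = "enn2real (besov_norm \<phi> (1 / p) p 1 f)"
    let ?X = "\<Sum>\<^sub>\<infinity>k. ennreal (norm (fs_coeff (continuous_rep f) j k) powr p)"
    have S: "besov_norm \<phi> (1 / p) p 1 f = ennreal ?S"
      using f by (simp add: besov_space_def)
    \<comment> \<open>An unordered sum in \<open>ennreal\<close> is the supremum of its finite
      partial sums, so bounds for finite \<open>K\<close> suffice.\<close>
    have X: "?X \<le> ennreal ((Q * ?S) powr p)"
    proof (rule infsum_le_finite_sums)
      fix K :: "(int ^ 'd) set" assume K: "finite K"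
      show "(\<Sum>k\<in>K. ennreal (norm (fs_coeff (continuous_rep f) j k) powr p)) \<le> ennreal ((Q * ?S) powr p)"
        using Q(2)[OF f j K] by (simp add: sum_ennreal ennreal_leI)
    qed (rule nonneg_summable_on_complete, simp)
    then obtain r where r: "r \<ge> 0" "?X = ennreal r"
      by (cases ?X) (auto simp: top_unique)
    then have "r \<le> (Q * ?S) powr p" using X by simp
    then have "r powr (1 / p) \<le> ((Q * ?S) powr p) powr (1 / p)"
      using r assms(2) by (intro powr_mono2) auto
    also have "\<dots> = Q * ?S" using Q(1) assms(2) by (simp add: powr_powr)
    finally show "?X epowr (1 / p) \<le> ennreal Q * besov_norm \<phi> (1 / p) p 1 f"
      using Q(1) r by (subst S) (simp add: epowr_ennreal ennreal_mult[symmetric] ennreal_leI)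
  qed
  then show ?thesis
    using Q(1) by (intro exI[of _ Q]) (simp add: seq_norm_def)
qed

end
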